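(* Let $f \in H^k(\Omega)$. Then: 1. Suppose that $\varepsilon = c N^{\alpha}$ for some $0 < \alpha < 1$ and $c > 0$. Then $$E_{N,\tau}(f) \lesssim \Big [ (c N^{\alpha} \pi / T)^{-k} + \left (e^{-\pi^2 N^{2(1-\alpha)} / (4 c^2 T^2)} + \sqrt{c T}\, \tau /N^{(1-\alpha)/2} \right ) e^{\pi^2/(4 T^2)} \Big ] \|f\|_{H^k(\Omega)},$$ for all $N$ satisfying $$N^{1-\alpha} \geq \frac{\sqrt{2 \log(2)}\, T}{\pi} , \qquad c N^{\alpha} \geq \frac{1}{\sqrt{2}(T-B)} \sqrt{\log\left (\frac{\sqrt{2 \pi} B N}{T \tau^2} \right ) }.$$ 2. Suppose that $\varepsilon = c N$ for some $c > 0$. Then $$E_{N,\tau}(f) \lesssim \Big [ (\min\{c,1\} N \pi/T)^{-k} + \left ( \frac{1}{\sqrt{e^{\pi^2 / (2 c^2 T^2)} - 1}} + \sqrt{c T}\, \tau \right ) e^{\pi^2 / (4 T^2)} \Big ] \|f\|_{H^k(\Omega)},$$ for all $N$ satisfying $$c N \geq \frac{1}{\sqrt{2}(T-B)} \sqrt{\log\left (\frac{\sqrt{2 \pi} B N}{T \tau^2} \right ) }.$$ In particular, if $\tau < 1/2$ and $$c \leq \min \left\{ 1 , \frac{\pi}{T \sqrt{2 \log(1+\tau^{-2})}} \right \},$$ then, for all such $N$, $$E_{N,\tau}(f) \lesssim \left ( (c N \pi / T)^{-k} + \tau\, e^{\pi^2 / (4 T^2)} \right ) \|f\|_{H^k(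\Omega)}.$$
   Context: Setting. Let $T>0$ and let $\Omega \subset (-T,T)$ be a (one-dimensional) domain of positive measure; put $B = \max_{x\in\Omega}|x|$, so $B<T$. Let $\tau>0$ be a fixed (regularization) parameter and let $\phi(r)=e^{-r^2}$ be the Gaussian radial basis function. For a positive integer $N$ and a shape parameter $\varepsilon>0$ define the synthesis operator on coefficient vectors $z=(z_n)_{n=-N}^{N}\in\mathbb{C}^{2N+1}$ by $$\mathcal{T}_N z = \sum_{n=-N}^{N} z_n \sqrt{\varepsilon}\,\phi\big(\varepsilon(\cdot - nT/N)\big),$$ and, for $f\in L^2(\Omega)$, define $$E_{N,\tau}(f) = \inf_{z\in\mathbb{C}^{2N+1}} \left\{ \|f-\mathcal{T}_N z\|_{L^2(\Omega)} + \tau \|z\|_{\ell^2}\right\}.$$ Sobolev spaces. $k$ is a positive integer and $H^k(\Omega)$ is the usual $L^2$-based Sobolev space of order $k$. On the real line the norm is $\|g\|_{H^k(\mathbb{R})}^2=\int_{-\infty}^\infty (1+|\omega|)^{2k}|\hat g(\omega)|^2\,d\omega$, where $\hat g(\omega)=\int_{-\infty}^{\infty} g(x)e^{-i\omega x}\,dx$. The domain $\Omega$ is such that the Sobolev extension theorem holds (for instance an interval): every $f\in H^k(\Omega)$ has an extension $g\in H^k(\mathbb{R})$ with $\|g\|_{H^k(\mathbb{R})}\le C_{k,\Omega}\|f\|_{H^k(\Omega)}$. Conventions. $X\lesssim Y$ means $X\le C\,Y$ with a constant $C>0$ depending only on $k$ and $\Omega$ (not on $N$, $\tau$, $c$, $\alpha$,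 $T$, $f$). Inequalities involving $\sqrt{\log(\cdot)}$ are understood to include that the quantity under the square root is nonnegative. *)

theory Defs
  imports "HOL-Analysis.Analysis"
begin

definition square_integrable_on :: "(real \<Rightarrow> complex) \<Rightarrow> real set \<Rightarrow> bool" where
  "square_integrable_on f S \<longleftrightarrow>
     f \<in> borel_measurable (lebesgue_on S) \<and> integrable (lebesgue_on S) (\<lambda>x. (norm (f x))\<^sup>2)"

definition L2norm_on :: "real set \<Rightarrow> (real \<Rightarrow> complex) \<Rightarrow> real" where
  "L2norm_on S f = sqrt (integral\<^sup>L (lebesgue_on S) (\<lambda>x. (norm (f x))\<^sup>2))"

(* Elements of L^2, H^k are represented by functions real => complex. For a function space on S
   the values outside S are irrelevant. *)

subsection \<open>The Sobolev space of an open set\<close>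

definition test_function :: "real set \<Rightarrow> (real \<Rightarrow> real) \<Rightarrow> bool" where
  "test_function S \<psi> \<longleftrightarrow>
     (\<forall>j x. (deriv ^^ j) \<psi> field_differentiable at x) \<and>
     (\<exists>K. compact K \<and> K \<subseteq> S \<and> (\<forall>x. x \<notin> K \<longrightarrow> \<psi> x = 0))"

definition has_weak_deriv :: "real set \<Rightarrow> nat \<Rightarrow> (real \<Rightarrow> complex) \<Rightarrow> (real \<Rightarrow> complex) \<Rightarrow> bool" where
  "has_weak_deriv S j f g \<longleftrightarrow> square_integrable_on g S \<and>
     (\<forall>\<psi>. test_function S \<psi> \<longrightarrow>
        integral\<^sup>L (lebesgue_on S) (\<lambda>x. f x * of_real ((deriv ^^ j) \<psi> x)) =
        (-1) ^ j * integral\<^sup>L (lebesgue_on S) (\<lambda>x. g x * of_real (\<psi> x)))"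

(* On an open set the weak derivative is unique up to null sets, so norms do not depend
   on the choice. *)
definition weak_deriv :: "real set \<Rightarrow> nat \<Rightarrow> (real \<Rightarrow> complex) \<Rightarrow> real \<Rightarrow> complex" where
  "weak_deriv S j f = (SOME g. has_weak_deriv S j f g)"

definition sobolev :: "nat \<Rightarrow> real set \<Rightarrow> (real \<Rightarrow> complex) set" where
  "sobolev k S = {f. square_integrable_on f S \<and> (\<forall>j\<le>k. \<exists>g. has_weak_deriv S j f g)}"

definition sobolev_norm :: "nat \<Rightarrow> real set \<Rightarrow> (real \<Rightarrow> complex) \<Rightarrow> real" where
  "sobolev_norm k S f = sqrt (\<Sum>j\<le>k. (L2norm_on S (weak_deriv S j f))\<^sup>2)"

subsection \<open>The Sobolev space of the real line, by Fourier transform\<close>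

definition fourier_trunc :: "real \<Rightarrow> (real \<Rightarrow> complex) \<Rightarrow> real \<Rightarrow> complex" where
  "fourier_trunc R g \<omega> =
     integral\<^sup>L (lebesgue_on {-R..R}) (\<lambda>x. g x * exp (- \<i> * of_real (\<omega> * x)))"

(* The Fourier transform on L^2 (Plancherel): the integral over the line is the limit in L^2 of
   the integrals over {-R..R}. The nonnegative integral is used so that a difference that is not
   square integrable cannot count as small. *)
definition has_fourier :: "(real \<Rightarrow> complex) \<Rightarrow> (real \<Rightarrow> complex) \<Rightarrow> bool" where
  "has_fourier g G \<longleftrightarrow> square_integrable_on g UNIV \<and> square_integrable_on G UNIV \<and>
     ((\<lambda>R. \<integral>\<^sup>+\<omega>. ennreal ((norm (fourier_trunc R g \<omega> - G \<omega>))\<^sup>2) \<partial>lebesgue) \<longlongrightarrow> 0) at_top"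

definition fourier :: "(real \<Rightarrow> complex) \<Rightarrow> real \<Rightarrow> complex" where
  "fourier g = (SOME G. has_fourier g G)"

definition sobolev_line :: "nat \<Rightarrow> (real \<Rightarrow> complex) set" where
  "sobolev_line k = {g. \<exists>G. has_fourier g G \<and>
     integrable lebesgue (\<lambda>\<omega>. (1 + \<bar>\<omega>\<bar>) ^ (2 * k) * (norm (G \<omega>))\<^sup>2)}"

definition sobolev_line_norm :: "nat \<Rightarrow> (real \<Rightarrow> complex) \<Rightarrow> real" where
  "sobolev_line_norm k g =
     sqrt (integral\<^sup>L lebesgue (\<lambda>\<omega>. (1 + \<bar>\<omega>\<bar>) ^ (2 * k) * (norm (fourier g \<omega>))\<^sup>2))"

definition sobolev_extension :: "nat \<Rightarrow> real set \<Rightarrow> bool" where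
  "sobolev_extension k S \<longleftrightarrow>
     (\<exists>C. \<forall>f\<in>sobolev k S. \<exists>g\<in>sobolev_line k.
        (AE x in lebesgue_on S. g x = f x) \<and> sobolev_line_norm k g \<le> C * sobolev_norm k S f)"

subsection \<open>Regularized Gaussian approximation\<close>

definition gauss_rbf :: "real \<Rightarrow> real" where
  "gauss_rbf r = exp (- r\<^sup>2)"

(* A coefficient vector indexed by -N..N is a function on the integers of which only the values
   on that range are used, here and in approx_error. *)
definition synthesis :: "real \<Rightarrow> nat \<Rightarrow> real \<Rightarrow> (int \<Rightarrow> complex) \<Rightarrow> real \<Rightarrow> complex" where
  "synthesis T N \<epsilon> z x =
     (\<Sum>n\<in>{- int N..int N}. z n * of_real (sqrt \<epsilon> * gauss_rbf (\<epsilon> * (x - of_int n * T / real N))))"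

definition approx_error ::
  "real set \<Rightarrow> real \<Rightarrow> real \<Rightarrow> nat \<Rightarrow> real \<Rightarrow> (real \<Rightarrow> complex) \<Rightarrow> real" where
  "approx_error S T \<epsilon> N \<tau> f =
     (INF z. L2norm_on S (\<lambda>x. f x - synthesis T N \<epsilon> z x) +
             \<tau> * L2_set (\<lambda>n. norm (z n)) {- int N..int N})"

end

theory Submission
  imports Defs "HOL-Probability.Probability"
begin

text \<open>Let \<open>g\<close> be an extension of \<open>f\<close> to the line, \<open>G\<close> its Fourier transform, \<open>h = T/N\<close> the grid step and
\<open>W = \<epsilon>\<pi>/T\<close>. Keeping only the frequencies \<open>|\<omega>| \<le> W\<close> changes \<open>g\<close> in \<open>L\<^sup>2\<close> by at most
\<open>W\<^sup>-\<^sup>k\<close> times its Sobolev norm, and this is the first term of all the bounds. A wave of frequency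
\<open>|\<omega>| \<le> W\<close> is nearly a sum of Gaussians: by Poisson summation,
\<open>\<Sum>n\<in>\<int>. e\<^bsup>i\<omega>nh\<^esup> \<phi>(\<epsilon>(x - nh))\<close> is the multiple \<open>(\<surd>\<pi>/(\<epsilon>h)) e\<^bsup>-\<omega>\<^sup>2/(4\<epsilon>\<^sup>2)\<^esup>\<close> of \<open>e\<^bsup>i\<omega>x\<^esup>\<close>,
up to aliases at the frequencies \<open>\<omega> + 2\<pi>m/h\<close> with \<open>m \<noteq> 0\<close>. Dividing by this multiple costs a
factor \<open>e\<^bsup>\<omega>\<^sup>2/(4\<epsilon>\<^sup>2)\<^esup>\<close>, which the choice of \<open>W\<close> keeps below \<open>e\<^bsup>\<pi>\<^sup>2/(4T\<^sup>2)\<^esup>\<close>. Integrating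
against \<open>G\<close> over \<open>[-W, W]\<close> produces the coefficients \<open>frame_coeff\<close>.

Three quantities have to be controlled besides the truncation (\<open>lowpass_error\<close>).
\<^item> Aliasing (\<open>gaussian_quadrature\<close>, \<open>frame_expansion\<close>): relative to the main term the aliases are of size
  \<open>e\<^bsup>-4Y(1-\<theta>)\<^esup>\<close> with \<open>\<theta> = \<epsilon>/N\<close> and \<open>Y = \<pi>\<^sup>2/(4\<epsilon>\<^sup>2h\<^sup>2)\<close>. As \<open>Y\<theta>\<^sup>2 = \<pi>\<^sup>2/(4T\<^sup>2)\<close> and
  \<open>4(1-\<theta>) \<ge> 1-\<theta>\<^sup>2\<close>, this is at most \<open>e\<^bsup>-Y\<^esup> e\<^bsup>\<pi>\<^sup>2/(4T\<^sup>2)\<^esup>\<close>. The aliasing error is bounded uniformly in \<open>x\<close>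
  by the integral of \<open>|G|\<close>, which \<open>k \<ge> 1\<close> makes finite.
\<^item> The penalty \<open>\<tau>\<parallel>z\<parallel>\<close> (\<open>frame_coeff_square_sum\<close>): the coefficients are Fourier coefficients on
  \<open>[-\<pi>/h, \<pi>/h]\<close>, so Bessel's inequality bounds \<open>\<parallel>z\<parallel>\<close> by \<open>\<surd>(\<epsilon>T/N) e\<^bsup>\<pi>\<^sup>2/(4T\<^sup>2)\<^esup>\<close> times the norm of \<open>g\<close>.
\<^item> Dropping the centres with \<open>|n| > N\<close> (\<open>gaussian_tail_sum\<close>): the lower bound on \<open>\<epsilon>\<close> in the hypotheses
  says that this costs at most a multiple of \<open>\<tau>\<parallel>z\<parallel>\<close>.

If \<open>\<theta> \<ge> 1\<close> or \<open>Y < 1\<close>, the claimed bound is at least a constant times the norm of \<open>f\<close>, and \<open>z = 0\<close>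
already satisfies it. So there is a single estimate for arbitrary \<open>\<epsilon>\<close> (\<open>approx_error_sobolev\<close>), and the
statements for \<open>\<epsilon> = cN\<^sup>\<alpha>\<close> and \<open>\<epsilon> = cN\<close> are substitutions into it.

The Fourier analysis rests on two devices. Integrals over frequency are regularised by a Gaussian
window, which turns Parseval's identity for a continuous compactly supported test function into an
approximate identity (\<open>parseval_window_limit\<close>); duality against such test functions then gives
\<open>lowpass_error\<close>. Poisson summation is proved by Chernoff's trick: the difference quotient
\<open>(u(t) - u(0)) / (e\<^bsup>2\<pi>it\<^esup> - 1)\<close> of the periodisation has Fourier coefficients that telescope to the
partial sums and tend to zero by Bessel's inequality.\<close>

section \<open>Square-integrable functions on the line\<close>

abbreviation energy :: "(real \<Rightarrow> complex) \<Rightarrow> real" where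
  "energy f \<equiv> (\<integral>x. (norm (f x))\<^sup>2 \<partial>lborel)"

abbreviation finite_energy :: "(real \<Rightarrow> complex) \<Rightarrow> bool" where
  "finite_energy f \<equiv> integrable lborel (\<lambda>x. (norm (f x))\<^sup>2)"

abbreviation sobolev_energy :: "nat \<Rightarrow> (real \<Rightarrow> complex) \<Rightarrow> real" where
  "sobolev_energy k G \<equiv> (\<integral>\<omega>. (1 + \<bar>\<omega>\<bar>) ^ (2 * k) * (norm (G \<omega>))\<^sup>2 \<partial>lborel)"

abbreviation finite_sobolev_energy :: "nat \<Rightarrow> (real \<Rightarrow> complex) \<Rightarrow> bool" where
  "finite_sobolev_energy k G \<equiv> integrable lborel (\<lambda>\<omega>. (1 + \<bar>\<omega>\<bar>) ^ (2 * k) * (norm (G \<omega>))\<^sup>2)"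

lemma integrable_norm_le:
  fixes f :: "'a \<Rightarrow> real" and g :: "'a \<Rightarrow> 'b::{banach, second_countable_topology}"
  assumes "integrable M f" "g \<in> borel_measurable M" "\<And>x. norm (g x) \<le> f x"
  shows "integrable M g"
  by (rule Bochner_Integration.integrable_bound[OF assms(1,2)])
     (auto intro: order_trans[OF assms(3) abs_ge_self])

lemma integrable_mult_of_squares:
  fixes f g :: "'a \<Rightarrow> complex"
  assumes [measurable]: "f \<in> borel_measurable M" "g \<in> borel_measurable M"
    and f: "integrable M (\<lambda>x. (norm (f x))\<^sup>2)" and g: "integrable M (\<lambda>x. (norm (g x))\<^sup>2)"
  shows "integrable M (\<lambda>x. f x * g x)"
proof (rule Bochner_Integration.integrable_bound[OF Bochner_Integration.integrable_add[OF f g]])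
  show "AE x in M. norm (f x * g x) \<le> norm ((norm (f x))\<^sup>2 + (norm (g x))\<^sup>2)"
  proof (rule AE_I2)
    fix x
    have "0 \<le> (norm (f x) - norm (g x))\<^sup>2" by simp
    then have "2 * (norm (f x) * norm (g x)) \<le> (norm (f x))\<^sup>2 + (norm (g x))\<^sup>2"
      by (simp add: power2_diff)
    moreover have "0 \<le> norm (f x) * norm (g x)" by simp
    ultimately show "norm (f x * g x) \<le> norm ((norm (f x))\<^sup>2 + (norm (g x))\<^sup>2)"
      unfolding norm_mult real_norm_def by linarith
  qed
qed simp

lemma Cauchy_Schwarz_integral:
  fixes f g :: "'a \<Rightarrow> complex"
  assumes [measurable]: "f \<in> borel_measurable M" "g \<in> borel_measurable M"
    and f: "integrable M (\<lambda>x. (norm (f x))\<^sup>2)" and g: "integrable M (\<lambda>x. (norm (g x))\<^sup>2)"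
  shows "(\<integral>x. norm (f x) * norm (g x) \<partial>M)
           \<le> sqrt (\<integral>x. (norm (f x))\<^sup>2 \<partial>M) * sqrt (\<integral>x. (norm (g x))\<^sup>2 \<partial>M)"
proof -
  have fg: "integrable M (\<lambda>x. norm (f x) * norm (g x))"
    using integrable_norm[OF integrable_mult_of_squares[OF assms]] by (simp add: norm_mult)
  have "ennreal ((\<integral>x. norm (f x) * norm (g x) \<partial>M)\<^sup>2)
        = (\<integral>\<^sup>+x. ennreal (norm (f x)) * ennreal (norm (g x)) \<partial>M)\<^sup>2"
    using nn_integral_eq_integral[OF fg] by (simp add: ennreal_mult ennreal_power)
  also have "\<dots> \<le> (\<integral>\<^sup>+x. ennreal (norm (f x)) ^ 2 \<partial>M) * (\<integral>\<^sup>+x. ennreal (norm (g x)) ^ 2 \<partial>M)"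
    by (rule Cauchy_Schwarz_nn_integral) simp_all
  also have "\<dots> = ennreal ((\<integral>x. (norm (f x))\<^sup>2 \<partial>M) * (\<integral>x. (norm (g x))\<^sup>2 \<partial>M))"
    using nn_integral_eq_integral[OF f] nn_integral_eq_integral[OF g]
    by (simp add: ennreal_mult ennreal_power)
  finally have "(\<integral>x. norm (f x) * norm (g x) \<partial>M)\<^sup>2 \<le> (\<integral>x. (norm (f x))\<^sup>2 \<partial>M) * (\<integral>x. (norm (g x))\<^sup>2 \<partial>M)"
    by (subst (asm) ennreal_le_iff) auto
  then show ?thesis
    unfolding real_sqrt_mult[symmetric] by (rule real_le_rsqrt)
qed

lemma norm_integral_mult_le:
  fixes f g :: "'a \<Rightarrow> complex"
  assumes "f \<in> borel_measurable M" "g \<in> borel_measurable M"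
    and "integrable M (\<lambda>x. (norm (f x))\<^sup>2)" and "integrable M (\<lambda>x. (norm (g x))\<^sup>2)"
  shows "norm (\<integral>x. f x * g x \<partial>M)
           \<le> sqrt (\<integral>x. (norm (f x))\<^sup>2 \<partial>M) * sqrt (\<integral>x. (norm (g x))\<^sup>2 \<partial>M)"
  using order_trans[OF integral_norm_bound[of M "\<lambda>x. f x * g x"]] Cauchy_Schwarz_integral[OF assms]
  by (simp add: norm_mult)

section \<open>The Fourier integral under a Gaussian window\<close>

text \<open>The absolutely convergent Fourier integral. For a general \<open>L\<^sup>2\<close> function the transform is only an
\<open>L\<^sup>2\<close> limit of such integrals over growing intervals; the two are connected in \<open>parseval_fourier\<close>.\<close>

definition ft :: "(real \<Rightarrow> complex) \<Rightarrow> real \<Rightarrow> complex" where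
  "ft p \<omega> = (\<integral>x. p x * cis (- (\<omega> * x)) \<partial>lborel)"

lemma borel_measurable_cis [measurable]: "cis \<in> borel_measurable borel"
  by (intro borel_measurable_continuous_onI continuous_on_cis continuous_on_id)

lemma borel_measurable_cnj [measurable]: "cnj \<in> borel_measurable borel"
  by (intro borel_measurable_continuous_onI continuous_intros)

lemma integrable_mult_cis:
  assumes "integrable lborel p"
  shows "integrable lborel (\<lambda>x. p x * cis (a * x))"
proof -
  have [measurable]: "p \<in> borel_measurable lborel" using assms by auto
  show ?thesis
    by (rule Bochner_Integration.integrable_bound[OF assms]) (auto simp: norm_mult)
qed

lemma borel_measurable_ft [measurable]:
  assumes "p \<in> borel_measurable borel"
  shows "ft p \<in> borel_measurable borel"
proof -
  have [measurable]: "p \<in> borel_measurable borel" by fact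
  show ?thesis unfolding ft_def by measurable
qed

lemma norm_ft_le: "norm (ft p \<omega>) \<le> (\<integral>x. norm (p x) \<partial>lborel)"
  unfolding ft_def
  by (rule order_trans[OF integral_norm_bound]) (simp add: norm_mult)

text \<open>By Fubini. This is the only exchange of integrals that Parseval's identity and the band-limiting below need.\<close>

lemma ft_multiplication_formula:
  assumes p: "integrable lborel p" and k: "integrable lborel k"
  shows "(\<integral>\<omega>. ft p \<omega> * k \<omega> \<partial>lborel) = (\<integral>x. p x * ft k x \<partial>lborel)"
proof -
  have [measurable]: "p \<in> borel_measurable borel" "k \<in> borel_measurable borel"
    using p k by auto
  have int: "integrable (lborel \<Otimes>\<^sub>M lborel) (\<lambda>(\<omega>, x). p x * cis (- (\<omega> * x)) * k \<omega>)"
  proof (rule lborel_pair.Fubini_integrable)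
    have "(\<lambda>\<omega>. \<integral>x. norm (case (\<omega>, x) of (\<omega>, x) \<Rightarrow> p x * cis (- (\<omega> * x)) * k \<omega>) \<partial>lborel)
          = (\<lambda>\<omega>. (\<integral>x. norm (p x) \<partial>lborel) * norm (k \<omega>))"
      by (simp add: norm_mult)
    then show "integrable lborel (\<lambda>\<omega>. \<integral>x. norm (case (\<omega>, x) of (\<omega>, x) \<Rightarrow> p x * cis (- (\<omega> * x)) * k \<omega>) \<partial>lborel)"
      using k by auto
    show "AE \<omega> in lborel. integrable lborel (\<lambda>y. case (\<omega>, y) of (\<omega>, x) \<Rightarrow> p x * cis (- (\<omega> * x)) * k \<omega>)"
      using integrable_mult_cis[OF p, of "- _"] by auto
  qed measurable
  have "(\<integral>\<omega>. ft p \<omega> * k \<omega> \<partial>lborel) = (\<integral>\<omega>. (\<integral>x. p x * cis (- (\<omega> * x)) * k \<omega> \<partial>lborel) \<partial>lborel)"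
    unfolding ft_def by simp
  also have "\<dots> = (\<integral>x. (\<integral>\<omega>. p x * cis (- (\<omega> * x)) * k \<omega> \<partial>lborel) \<partial>lborel)"
    using lborel_pair.Fubini_integral[OF int] by simp
  also have "\<dots> = (\<integral>x. p x * ft k x \<partial>lborel)"
    unfolding ft_def
    by (intro Bochner_Integration.integral_cong refl) (simp add: mult_ac flip: integral_mult_right_zero)
  finally show ?thesis .
qed

lemma integral_std_normal_cis:
  "(\<integral>x. of_real (std_normal_density x) * cis (t * x) \<partial>lborel) = complex_of_real (exp (- t\<^sup>2 / 2))"
proof -
  have "(\<integral>x. of_real (std_normal_density x) * cis (t * x) \<partial>lborel)
        = (\<integral>x. std_normal_density x *\<^sub>R cis (t * x) \<partial>lborel)"
    by (simp add: scaleR_conv_of_real)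
  also have "\<dots> = char std_normal_distribution t"
    unfolding char_def
    by (subst integral_density) (auto simp: cis_conv_exp mult_ac)
  finally show ?thesis by (simp add: char_std_normal_distribution)
qed

text \<open>After rescaling to the standard normal density this is the value of its characteristic function.\<close>

lemma ft_gaussian:
  assumes "b > 0"
  shows "ft (\<lambda>\<omega>. of_real (exp (- (b * \<omega>)\<^sup>2 / 2))) t
         = of_real (sqrt (2 * pi) / b * exp (- (t / b)\<^sup>2 / 2))"
proof -
  have "ft (\<lambda>\<omega>. of_real (exp (- (b * \<omega>)\<^sup>2 / 2))) t
        = \<bar>1/b\<bar> *\<^sub>R (\<integral>x. of_real (exp (- (b * (0 + (1/b) * x))\<^sup>2 / 2)) * cis (- (t * (0 + (1/b) * x))) \<partial>lborel)"
    unfolding ft_def using assms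
    by (intro lborel_integral_real_affine) simp
  also have "\<dots> = (1/b) *\<^sub>R (\<integral>x. of_real (sqrt (2*pi)) * (of_real (std_normal_density x) * cis (- (t / b) * x)) \<partial>lborel)"
    using assms by (simp add: std_normal_density_def mult_ac)
  also have "\<dots> = (1/b) *\<^sub>R (of_real (sqrt (2*pi)) * complex_of_real (exp (- (- (t/b))\<^sup>2 / 2)))"
    by (subst integral_mult_right_zero) (simp only: integral_std_normal_cis)
  finally show ?thesis using assms
    by (simp add: scaleR_conv_of_real)
qed

lemma integrable_gaussian:
  assumes "b > 0"
  shows "integrable lborel (\<lambda>\<omega>::real. exp (- (b * \<omega>)\<^sup>2 / 2))"
proof -
  have "integrable lborel (\<lambda>x. std_normal_density (0 + b * x))"
    using assms by (intro lborel_integrable_real_affine integrable_normal_density) auto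
  then have "integrable lborel (\<lambda>x. sqrt (2 * pi) * std_normal_density (0 + b * x))"
    by (rule integrable_mult_right)
  then show ?thesis by (simp add: std_normal_density_def)
qed

lemma ft_mult_cis: "ft (\<lambda>x. p x * cis (a * x)) \<omega> = ft p (\<omega> - a)"
  unfolding ft_def by (simp add: cis_mult mult.assoc algebra_simps)

text \<open>Convolution with the normal density of standard deviation \<open>b\<close>, an approximate identity as \<open>b \<rightarrow> 0\<close>. The
integration variable is scaled by \<open>b\<close> so that the limit can be taken under the integral sign.\<close>

definition gauss_mean :: "real \<Rightarrow> (real \<Rightarrow> complex) \<Rightarrow> real \<Rightarrow> complex" where
  "gauss_mean b \<psi> x = (\<integral>s. of_real (std_normal_density s) * \<psi> (x + b * s) \<partial>lborel)"

text \<open>The window \<open>e\<^bsup>-(b\<omega>)\<^sup>2/2\<^esup>\<close> makes the inversion integral converge absolutely; its own transform is a narrow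
Gaussian, so the integral returns a local mean of \<open>\<psi>\<close> in place of \<open>\<psi>\<close>.\<close>

lemma gauss_windowed_inversion:
  assumes psi: "integrable lborel \<psi>" and b: "b > 0"
  shows "(\<integral>\<omega>. ft \<psi> \<omega> * (of_real (exp (- (b * \<omega>)\<^sup>2 / 2)) * cis (x * \<omega>)) \<partial>lborel) = 2 * pi * gauss_mean b \<psi> x"
proof -
  have g: "integrable lborel (\<lambda>\<omega>. complex_of_real (exp (- (b * \<omega>)\<^sup>2 / 2)))"
    using integrable_gaussian[OF b] by (rule integrable_of_real)
  have "(\<integral>\<omega>. ft \<psi> \<omega> * (of_real (exp (- (b * \<omega>)\<^sup>2 / 2)) * cis (x * \<omega>)) \<partial>lborel)
        = (\<integral>y. \<psi> y * of_real (sqrt (2 * pi) / b * exp (- ((y - x) / b)\<^sup>2 / 2)) \<partial>lborel)"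
    by (subst ft_multiplication_formula[OF psi integrable_mult_cis[OF g]])
       (simp only: ft_mult_cis ft_gaussian[OF b])
  also have "\<dots> = \<bar>b\<bar> *\<^sub>R (\<integral>s. \<psi> (x + b * s) * of_real (sqrt (2 * pi) / b * exp (- ((x + b * s - x) / b)\<^sup>2 / 2)) \<partial>lborel)"
    using b by (intro lborel_integral_real_affine) simp
  also have "\<dots> = b *\<^sub>R (\<integral>s. of_real (2 * pi / b) * (of_real (std_normal_density s) * \<psi> (x + b * s)) \<partial>lborel)"
  proof -
    have "sqrt (2 * pi) / b * exp (- (s\<^sup>2 / 2)) = 2 * pi / b * std_normal_density s" for s
      unfolding std_normal_density_def using b
      by (simp add: field_simps flip: power2_eq_square)
    then show ?thesis
      using b by (intro arg_cong2[where f=scaleR] Bochner_Integration.integral_cong refl)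
        (simp_all only: of_real_mult[symmetric] mult_ac, simp_all add: mult_ac)
  qed
  also have "\<dots> = 2 * pi * gauss_mean b \<psi> x"
    unfolding gauss_mean_def using b
    by (subst integral_mult_right_zero) (simp add: scaleR_conv_of_real)
  finally show ?thesis .
qed

lemma gauss_windowed_parseval:
  assumes p: "integrable lborel p" and psi: "integrable lborel \<psi>" and b: "b > 0"
  shows "(\<integral>\<omega>. ft p \<omega> * cnj (ft \<psi> \<omega>) * of_real (exp (- (b * \<omega>)\<^sup>2 / 2)) \<partial>lborel)
         = 2 * pi * (\<integral>x. p x * cnj (gauss_mean b \<psi> x) \<partial>lborel)"
proof -
  have [measurable]: "p \<in> borel_measurable borel" "\<psi> \<in> borel_measurable borel"
    using p psi by auto
  let ?k = "\<lambda>\<omega>. cnj (ft \<psi> \<omega>) * of_real (exp (- (b * \<omega>)\<^sup>2 / 2))"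
  have g: "integrable lborel (\<lambda>\<omega>. (\<integral>x. norm (\<psi> x) \<partial>lborel) * exp (- (b * \<omega>)\<^sup>2 / 2))"
    using integrable_gaussian[OF b] by (rule integrable_mult_right)
  have k: "integrable lborel ?k"
    by (rule Bochner_Integration.integrable_bound[OF g])
       (auto simp: norm_mult intro!: mult_right_mono order_trans[OF norm_ft_le])
  have "ft ?k x = cnj (2 * pi * gauss_mean b \<psi> x)" for x
    unfolding gauss_windowed_inversion[OF psi b, symmetric] ft_def[of ?k]
    by (simp add: cis_cnj mult_ac flip: Bochner_Integration.integral_cnj)
  then have "(\<integral>x. p x * ft ?k x \<partial>lborel) = (\<integral>x. 2 * pi * (p x * cnj (gauss_mean b \<psi> x)) \<partial>lborel)"
    by (simp add: mult_ac)
  then show ?thesis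
    using ft_multiplication_formula[OF p k] by (simp add: mult.assoc)
qed

section \<open>Parseval's identity against test functions\<close>

lemma integrable_bounded_support:
  fixes p :: "real \<Rightarrow> 'b::{banach, second_countable_topology}"
  assumes [measurable]: "p \<in> borel_measurable borel"
    and "\<And>x. norm (p x) \<le> K" "\<And>x. \<bar>x\<bar> > R \<Longrightarrow> p x = 0"
  shows "integrable lborel p"
proof (rule Bochner_Integration.integrable_bound)
  show "integrable lborel (\<lambda>x. indicator {-R..R} x * K)"
    by (intro integrable_mult_left integrable_real_indicator) (auto simp: emeasure_lborel_Icc_eq)
  show "AE x in lborel. norm (p x) \<le> norm (indicator {-R..R} x * K)"
    using assms(2,3) by (auto simp: indicator_def intro!: AE_I2 order_trans[OF assms(2) abs_ge_self])
qed simp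

text \<open>The test functions for duality in \<open>L\<^sup>2\<close>: dense, and continuous so that their Gaussian means converge pointwise.\<close>

definition continuous_compact_support :: "(real \<Rightarrow> complex) \<Rightarrow> bool" where
  "continuous_compact_support \<psi> \<longleftrightarrow> continuous_on UNIV \<psi> \<and> (\<exists>R. \<forall>x. \<bar>x\<bar> > R \<longrightarrow> \<psi> x = 0)"

context
  fixes \<psi> assumes psi: "continuous_compact_support \<psi>"
begin

lemma ccs_measurable [measurable]: "\<psi> \<in> borel_measurable borel"
  using psi by (simp add: continuous_compact_support_def borel_measurable_continuous_onI)

lemma ccs_bounded: obtains K where "\<And>x. norm (\<psi> x) \<le> K"
proof -
  obtain R where R: "\<And>x. \<bar>x\<bar> > R \<Longrightarrow> \<psi> x = 0" and c: "continuous_on UNIV \<psi>"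
    using psi by (auto simp: continuous_compact_support_def)
  have "bounded (\<psi> ` {-R..R})"
    by (intro compact_imp_bounded compact_continuous_image continuous_on_subset[OF c]) auto
  then obtain K where K: "\<forall>x\<in>{-R..R}. norm (\<psi> x) \<le> K"
    by (auto simp: bounded_iff)
  have "norm (\<psi> x) \<le> max K 0" for x
    using bspec[OF K, of x] R[of x] by (cases "\<bar>x\<bar> > R") (auto simp: le_max_iff_disj abs_le_iff not_less)
  then show ?thesis using that by blast
qed

lemma ccs_integrable: "integrable lborel \<psi>"
proof -
  obtain R where R: "\<And>x. \<bar>x\<bar> > R \<Longrightarrow> \<psi> x = 0"
    using psi by (auto simp: continuous_compact_support_def)
  obtain K where K: "\<And>x. norm (\<psi> x) \<le> K" using ccs_bounded by blast
  show ?thesis by (rule integrable_bounded_support[OF ccs_measurable K R])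
qed

lemma ccs_integrable_square: "finite_energy \<psi>"
proof -
  obtain R where R: "\<And>x. \<bar>x\<bar> > R \<Longrightarrow> \<psi> x = 0"
    using psi by (auto simp: continuous_compact_support_def)
  obtain K where K: "\<And>x. norm (\<psi> x) \<le> K" using ccs_bounded by blast
  show ?thesis
    by (rule integrable_bounded_support[where K="K\<^sup>2" and R=R])
       (use K R in \<open>auto intro!: power_mono\<close>)
qed

lemma integrable_std_normal_mult_ccs:
  "integrable lborel (\<lambda>s. of_real (std_normal_density s) * \<psi> (x + b * s))"
proof -
  obtain K where K: "\<And>x. norm (\<psi> x) \<le> K" using ccs_bounded by blast
  show ?thesis
  proof (rule Bochner_Integration.integrable_bound)
    show "integrable lborel (\<lambda>s. std_normal_density s * K)"
      by (intro integrable_mult_left integrable_normal_density) simp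
    show "AE s in lborel. norm (complex_of_real (std_normal_density s) * \<psi> (x + b * s)) \<le> norm (std_normal_density s * K)"
      using K order_trans[OF norm_ge_zero K]
      by (auto simp: norm_mult abs_mult intro!: AE_I2 mult_left_mono)
  qed simp
qed

lemma norm_gauss_mean_le:
  assumes K: "\<And>x. norm (\<psi> x) \<le> K"
  shows "norm (gauss_mean b \<psi> x) \<le> K"
proof -
  have i: "integrable lborel (\<lambda>s. std_normal_density s * K)"
    by (intro integrable_mult_left integrable_normal_density) simp
  have "norm (gauss_mean b \<psi> x) \<le> (\<integral>s. norm (complex_of_real (std_normal_density s) * \<psi> (x + b * s)) \<partial>lborel)"
    unfolding gauss_mean_def by (rule integral_norm_bound)
  also have "\<dots> \<le> (\<integral>s. std_normal_density s * K \<partial>lborel)"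
    using integrable_norm[OF integrable_std_normal_mult_ccs[of x b]] i
    by (intro integral_mono) (auto simp: norm_mult intro!: mult_left_mono K)
  also have "\<dots> = K" by (simp add: integral_normal_density)
  finally show ?thesis .
qed

lemma gauss_mean_tendsto:
  "(\<lambda>n. gauss_mean (1 / real (Suc n)) \<psi> x) \<longlonglongrightarrow> \<psi> x"
proof -
  obtain K where K: "\<And>x. norm (\<psi> x) \<le> K" using ccs_bounded by blast
  have c: "continuous_on UNIV \<psi>" using psi by (simp add: continuous_compact_support_def)
  have "(\<lambda>n. \<integral>s. of_real (std_normal_density s) * \<psi> (x + 1 / real (Suc n) * s) \<partial>lborel)
        \<longlonglongrightarrow> (\<integral>s. of_real (std_normal_density s) * \<psi> x \<partial>lborel)"
  proof (rule integral_dominated_convergence)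
    show "integrable lborel (\<lambda>s. std_normal_density s * K)"
      by (intro integrable_mult_left integrable_normal_density) simp
    show "AE s in lborel. norm (complex_of_real (std_normal_density s) * \<psi> (x + 1 / real (Suc n) * s)) \<le> std_normal_density s * K" for n
      using K by (auto simp: norm_mult intro!: AE_I2 mult_left_mono)
    show "AE s in lborel. (\<lambda>n. complex_of_real (std_normal_density s) * \<psi> (x + 1 / real (Suc n) * s))
            \<longlonglongrightarrow> complex_of_real (std_normal_density s) * \<psi> x"
    proof (intro AE_I2 tendsto_mult tendsto_const)
      fix s
      have "(\<lambda>n. x + 1 / real (Suc n) * s) \<longlonglongrightarrow> x + 0 * s"
        by (intro tendsto_intros LIMSEQ_inverse_real_of_nat[unfolded inverse_eq_divide])
      then show "(\<lambda>n. \<psi> (x + 1 / real (Suc n) * s)) \<longlonglongrightarrow> \<psi> x"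
        using continuous_on_tendsto_compose[OF c] by auto
    qed
  qed simp_all
  moreover have "(\<integral>s. of_real (std_normal_density s) * \<psi> x \<partial>lborel) = \<psi> x"
  proof -
    have "(\<integral>s. complex_of_real (std_normal_density s) \<partial>lborel) = of_real (\<integral>s. std_normal_density s \<partial>lborel)"
      by (rule integral_complex_of_real)
    then show ?thesis by (simp add: integral_normal_density)
  qed
  ultimately show ?thesis by (simp add: gauss_mean_def)
qed

lemma parseval_window_limit:
  assumes p: "integrable lborel p"
  shows "(\<lambda>n. \<integral>\<omega>. ft p \<omega> * cnj (ft \<psi> \<omega>) * of_real (exp (- (1 / real (Suc n) * \<omega>)\<^sup>2 / 2)) \<partial>lborel)
         \<longlonglongrightarrow> 2 * pi * (\<integral>x. p x * cnj (\<psi> x) \<partial>lborel)"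
proof -
  have [measurable]: "p \<in> borel_measurable borel" using p by auto
  obtain K where K: "\<And>x. norm (\<psi> x) \<le> K" using ccs_bounded by blast
  have "(\<lambda>n. \<integral>x. p x * cnj (gauss_mean (1 / real (Suc n)) \<psi> x) \<partial>lborel) \<longlonglongrightarrow> (\<integral>x. p x * cnj (\<psi> x) \<partial>lborel)"
  proof (rule integral_dominated_convergence)
    show "integrable lborel (\<lambda>x. norm (p x) * K)" using p by simp
    show "AE x in lborel. norm (p x * cnj (gauss_mean (1 / real (Suc n)) \<psi> x)) \<le> norm (p x) * K" for n
      using norm_gauss_mean_le[OF K] by (auto simp: norm_mult intro!: AE_I2 mult_left_mono)
    show "AE x in lborel. (\<lambda>n. p x * cnj (gauss_mean (1 / real (Suc n)) \<psi> x)) \<longlonglongrightarrow> p x * cnj (\<psi> x)"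
      by (intro AE_I2 tendsto_intros gauss_mean_tendsto)
    show "(\<lambda>x. p x * cnj (gauss_mean (1 / real (Suc n)) \<psi> x)) \<in> borel_measurable lborel" for n
      unfolding gauss_mean_def by measurable
  qed measurable
  then show ?thesis
    by (subst gauss_windowed_parseval[OF p ccs_integrable]) (auto intro!: tendsto_intros)
qed

lemma gaussian_window_tendsto:
  "(\<lambda>n. exp (- (1 / real (Suc n) * \<omega>)\<^sup>2 / 2)) \<longlonglongrightarrow> 1"
proof -
  have "(\<lambda>n. exp (- (1 / real (Suc n) * \<omega>)\<^sup>2 / 2)) \<longlonglongrightarrow> exp (- (0 * \<omega>)\<^sup>2 / 2)"
    by (intro tendsto_intros LIMSEQ_inverse_real_of_nat[unfolded inverse_eq_divide]) simp
  then show ?thesis by simp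
qed

text \<open>The window increases to 1 as \<open>b\<close> decreases to 0, so square integrability of the transform comes out of
monotone convergence and does not have to be assumed.\<close>

lemma
  shows plancherel_ccs_integrable: "finite_energy (ft \<psi>)" (is ?I)
    and plancherel_ccs: "energy (ft \<psi>) = 2 * pi * energy \<psi>" (is ?E)
proof -
  let ?f = "\<lambda>n \<omega>. (norm (ft \<psi> \<omega>))\<^sup>2 * exp (- (1 / real (Suc n) * \<omega>)\<^sup>2 / 2)"
  have int: "integrable lborel (?f n)" for n
  proof (rule Bochner_Integration.integrable_bound)
    show "integrable lborel (\<lambda>\<omega>. (\<integral>x. norm (\<psi> x) \<partial>lborel)\<^sup>2 * exp (- (1 / real (Suc n) * \<omega>)\<^sup>2 / 2))"
      by (intro integrable_mult_right integrable_gaussian) simp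
    show "AE \<omega> in lborel. norm (?f n \<omega>) \<le> norm ((\<integral>x. norm (\<psi> x) \<partial>lborel)\<^sup>2 * exp (- (1 / real (Suc n) * \<omega>)\<^sup>2 / 2))"
      by (auto intro!: AE_I2 mult_right_mono power_mono norm_ft_le)
  qed measurable
  have mono: "AE \<omega> in lborel. mono (\<lambda>n. ?f n \<omega>)"
  proof (intro AE_I2 monoI mult_left_mono)
    fix \<omega> :: real and m n :: nat assume "m \<le> n"
    then have "(1 / real (Suc n))\<^sup>2 \<le> (1 / real (Suc m))\<^sup>2"
      by (intro power_mono divide_left_mono) auto
    then have "(1 / real (Suc n))\<^sup>2 * \<omega>\<^sup>2 \<le> (1 / real (Suc m))\<^sup>2 * \<omega>\<^sup>2"
      by (rule mult_right_mono) simp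
    then show "exp (- (1 / real (Suc m) * \<omega>)\<^sup>2 / 2) \<le> exp (- (1 / real (Suc n) * \<omega>)\<^sup>2 / 2)"
      by (simp only: power_mult_distrib exp_le_cancel_iff)
  qed simp
  have lim: "AE \<omega> in lborel. (\<lambda>n. ?f n \<omega>) \<longlonglongrightarrow> (norm (ft \<psi> \<omega>))\<^sup>2"
    by (intro AE_I2) (use tendsto_mult[OF tendsto_const gaussian_window_tendsto] in force)
  have "complex_of_real (integral\<^sup>L lborel (?f n))
        = (\<integral>\<omega>. ft \<psi> \<omega> * cnj (ft \<psi> \<omega>) * of_real (exp (- (1 / real (Suc n) * \<omega>)\<^sup>2 / 2)) \<partial>lborel)" for n
    by (subst integral_complex_of_real[symmetric])
       (intro Bochner_Integration.integral_cong refl, simp only: of_real_mult complex_norm_square)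
  moreover have "2 * pi * (\<integral>x. \<psi> x * cnj (\<psi> x) \<partial>lborel) = complex_of_real (2 * pi * energy \<psi>)"
    by (simp only: complex_norm_square[symmetric] integral_complex_of_real of_real_mult)
  ultimately have "(\<lambda>n. complex_of_real (integral\<^sup>L lborel (?f n))) \<longlonglongrightarrow> complex_of_real (2 * pi * energy \<psi>)"
    using parseval_window_limit[OF ccs_integrable] by simp
  then have conv: "(\<lambda>n. integral\<^sup>L lborel (?f n)) \<longlonglongrightarrow> 2 * pi * energy \<psi>"
    by (simp only: tendsto_of_real_iff)
  show ?I by (rule integrable_monotone_convergence[OF int mono lim conv]) simp
  show ?E by (rule integral_monotone_convergence[OF int mono lim conv]) simp
qed

lemma parseval_ccs:
  assumes p: "integrable lborel p" and P: "finite_energy (ft p)"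
  shows "(\<integral>\<omega>. ft p \<omega> * cnj (ft \<psi> \<omega>) \<partial>lborel) = 2 * pi * (\<integral>x. p x * cnj (\<psi> x) \<partial>lborel)"
proof (rule LIMSEQ_unique[OF _ parseval_window_limit[OF p]])
  have [measurable]: "p \<in> borel_measurable borel" using p by auto
  have int: "integrable lborel (\<lambda>\<omega>. ft p \<omega> * cnj (ft \<psi> \<omega>))"
    using P plancherel_ccs_integrable by (intro integrable_mult_of_squares) auto
  show "(\<lambda>n. \<integral>\<omega>. ft p \<omega> * cnj (ft \<psi> \<omega>) * of_real (exp (- (1 / real (Suc n) * \<omega>)\<^sup>2 / 2)) \<partial>lborel)
        \<longlonglongrightarrow> (\<integral>\<omega>. ft p \<omega> * cnj (ft \<psi> \<omega>) \<partial>lborel)"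
  proof (rule integral_dominated_convergence[OF _ _ integrable_norm[OF int]])
    show "AE \<omega> in lborel. (\<lambda>n. ft p \<omega> * cnj (ft \<psi> \<omega>) * of_real (exp (- (1 / real (Suc n) * \<omega>)\<^sup>2 / 2)))
           \<longlonglongrightarrow> ft p \<omega> * cnj (ft \<psi> \<omega>)"
    proof (rule AE_I2)
      fix \<omega>
      have "(\<lambda>n. ft p \<omega> * cnj (ft \<psi> \<omega>) * of_real (exp (- (1 / real (Suc n) * \<omega>)\<^sup>2 / 2)))
           \<longlonglongrightarrow> ft p \<omega> * cnj (ft \<psi> \<omega>) * of_real 1"
        by (intro tendsto_mult[OF tendsto_const] tendsto_of_real gaussian_window_tendsto)
      then show "(\<lambda>n. ft p \<omega> * cnj (ft \<psi> \<omega>) * of_real (exp (- (1 / real (Suc n) * \<omega>)\<^sup>2 / 2)))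
           \<longlonglongrightarrow> ft p \<omega> * cnj (ft \<psi> \<omega>)" by simp
    qed
    show "AE \<omega> in lborel. norm (ft p \<omega> * cnj (ft \<psi> \<omega>) * complex_of_real (exp (- (1 / real (Suc n) * \<omega>)\<^sup>2 / 2)))
           \<le> norm (ft p \<omega> * cnj (ft \<psi> \<omega>))" for n
      by (rule AE_I2) (simp add: norm_mult mult_left_le)
  qed measurable
qed

end

lemma integrable_indicator_of_square:
  fixes f :: "real \<Rightarrow> complex"
  assumes [measurable]: "f \<in> borel_measurable borel" and f: "finite_energy f"
  shows "integrable lborel (\<lambda>x. indicator {-R..R} x * f x)"
proof -
  have "integrable lborel (\<lambda>x. (norm (indicator {-R..R} x :: complex))\<^sup>2)"
    by (rule integrable_bounded_support[where K=1 and R=R]) (auto simp: indicator_def)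
  then show ?thesis using f by (intro integrable_mult_of_squares) auto
qed

lemma fourier_trunc_eq_ft:
  assumes [measurable]: "g \<in> borel_measurable borel"
  shows "fourier_trunc R g = ft (\<lambda>x. indicator {-R..R} x * g x)"
proof
  fix \<omega>
  have "fourier_trunc R g \<omega> = (\<integral>x. indicator {-R..R} x *\<^sub>R (g x * exp (- \<i> * of_real (\<omega> * x))) \<partial>lebesgue)"
    unfolding fourier_trunc_def by (subst integral_restrict_space) auto
  also have "\<dots> = (\<integral>x. indicator {-R..R} x *\<^sub>R (g x * exp (- \<i> * of_real (\<omega> * x))) \<partial>lborel)"
    by (rule integral_completion) measurable
  also have "\<dots> = ft (\<lambda>x. indicator {-R..R} x * g x) \<omega>"
    unfolding ft_def
    by (intro Bochner_Integration.integral_cong refl)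
       (auto simp: indicator_def cis_conv_exp mult_ac)
  finally show "fourier_trunc R g \<omega> = ft (\<lambda>x. indicator {-R..R} x * g x) \<omega>" .
qed

lemma square_integrable_on_UNIV_borel:
  assumes "f \<in> borel_measurable borel"
  shows "square_integrable_on f UNIV \<longleftrightarrow> finite_energy f"
proof -
  have [measurable]: "f \<in> borel_measurable borel" by fact
  have "f \<in> borel_measurable lebesgue"
    using measurable_completion[of f lborel borel] by simp
  then show ?thesis
    unfolding square_integrable_on_def lebesgue_on_UNIV_eq
    by (simp add: integrable_completion)
qed

text \<open>On the support of \<open>\<psi>\<close> the function \<open>g\<close> agrees with its truncation to any large interval \<open>[-R, R]\<close>, and the
truncation is integrable, so \<open>parseval_ccs\<close> applies to it. The transform of the truncation tends to \<open>G\<close> in \<open>L\<^sup>2\<close>,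
and the transform of \<open>\<psi>\<close> is in \<open>L\<^sup>2\<close>, so the frequency side converges by the Cauchy-Schwarz inequality.\<close>

lemma parseval_fourier:
  assumes [measurable]: "g \<in> borel_measurable borel" "G \<in> borel_measurable borel"
    and FG: "has_fourier g G" and psi: "continuous_compact_support \<psi>"
  shows "(\<integral>\<omega>. G \<omega> * cnj (ft \<psi> \<omega>) \<partial>lborel) = 2 * pi * (\<integral>x. g x * cnj (\<psi> x) \<partial>lborel)"
proof -
  note [measurable] = ccs_measurable[OF psi]
  obtain R0 where R0: "\<And>x. \<bar>x\<bar> > R0 \<Longrightarrow> \<psi> x = 0"
    using psi by (auto simp: continuous_compact_support_def)
  have g2: "finite_energy g" and G2: "finite_energy G"
    using FG by (auto simp: has_fourier_def square_integrable_on_UNIV_borel)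
  let ?p = "\<lambda>R x. indicator {-R..R} x * g x"
  let ?e = "\<lambda>R. \<integral>\<^sup>+\<omega>. ennreal ((norm (ft (?p R) \<omega> - G \<omega>))\<^sup>2) \<partial>lborel"
  let ?\<Psi> = "sqrt (energy (ft \<psi>))"
  let ?D = "2 * pi * (\<integral>x. g x * cnj (\<psi> x) \<partial>lborel) - (\<integral>\<omega>. G \<omega> * cnj (ft \<psi> \<omega>) \<partial>lborel)"
  have e0: "(?e \<longlongrightarrow> 0) at_top"
    using FG by (simp add: has_fourier_def fourier_trunc_eq_ft nn_integral_completion)
  have bound: "norm ?D \<le> sqrt (enn2real (?e R)) * ?\<Psi>" if R: "R \<ge> R0" and fin: "?e R < top" for R
  proof -
    have p: "integrable lborel (?p R)"
      by (rule integrable_indicator_of_square[OF _ g2]) simp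
    have d2: "integrable lborel (\<lambda>\<omega>. (norm (ft (?p R) \<omega> - G \<omega>))\<^sup>2)"
      by (rule integrableI_bounded) (use fin in auto)
    \<comment> \<open>finite distance to the square-integrable \<open>G\<close>\<close>
    have P2: "integrable lborel (\<lambda>\<omega>. (norm (ft (?p R) \<omega>))\<^sup>2)"
    proof (rule Bochner_Integration.integrable_bound)
      show "integrable lborel (\<lambda>\<omega>. 2 * (norm (ft (?p R) \<omega> - G \<omega>))\<^sup>2 + 2 * (norm (G \<omega>))\<^sup>2)"
        using d2 G2 by auto
      show "AE \<omega> in lborel. norm ((norm (ft (?p R) \<omega>))\<^sup>2) \<le> norm (2 * (norm (ft (?p R) \<omega> - G \<omega>))\<^sup>2 + 2 * (norm (G \<omega>))\<^sup>2)"
      proof (rule AE_I2)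
        fix \<omega>
        have "norm (ft (?p R) \<omega>) \<le> norm (ft (?p R) \<omega> - G \<omega>) + norm (G \<omega>)"
          by (metis diff_add_cancel norm_triangle_ineq)
        then have "(norm (ft (?p R) \<omega>))\<^sup>2 \<le> (norm (ft (?p R) \<omega> - G \<omega>) + norm (G \<omega>))\<^sup>2"
          by (rule power_mono) simp
        also have "\<dots> \<le> 2 * (norm (ft (?p R) \<omega> - G \<omega>))\<^sup>2 + 2 * (norm (G \<omega>))\<^sup>2"
          using zero_le_power2[of "norm (ft (?p R) \<omega> - G \<omega>) - norm (G \<omega>)"]
          by (simp add: power2_sum power2_diff)
        finally show "norm ((norm (ft (?p R) \<omega>))\<^sup>2) \<le> norm (2 * (norm (ft (?p R) \<omega> - G \<omega>))\<^sup>2 + 2 * (norm (G \<omega>))\<^sup>2)"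
          by simp
      qed
    qed measurable
    have "(\<integral>x. ?p R x * cnj (\<psi> x) \<partial>lborel) = (\<integral>x. g x * cnj (\<psi> x) \<partial>lborel)"
    proof (intro Bochner_Integration.integral_cong refl)
      fix x show "?p R x * cnj (\<psi> x) = g x * cnj (\<psi> x)"
        using R R0[of x] by (cases "\<bar>x\<bar> > R0") (auto simp: indicator_def)
    qed
    then have "?D = (\<integral>\<omega>. ft (?p R) \<omega> * cnj (ft \<psi> \<omega>) \<partial>lborel) - (\<integral>\<omega>. G \<omega> * cnj (ft \<psi> \<omega>) \<partial>lborel)"
      using parseval_ccs[OF psi p P2] by simp
    also have "\<dots> = (\<integral>\<omega>. (ft (?p R) \<omega> - G \<omega>) * cnj (ft \<psi> \<omega>) \<partial>lborel)"
      using integrable_mult_of_squares[of "ft (?p R)" lborel "\<lambda>\<omega>. cnj (ft \<psi> \<omega>)"]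
        integrable_mult_of_squares[of G lborel "\<lambda>\<omega>. cnj (ft \<psi> \<omega>)"] P2 G2 plancherel_ccs_integrable[OF psi]
      by (subst Bochner_Integration.integral_diff[symmetric]) (auto simp: algebra_simps)
    finally have "norm ?D \<le> sqrt (\<integral>\<omega>. (norm (ft (?p R) \<omega> - G \<omega>))\<^sup>2 \<partial>lborel) * ?\<Psi>"
      using norm_integral_mult_le[of "\<lambda>\<omega>. ft (?p R) \<omega> - G \<omega>" lborel "\<lambda>\<omega>. cnj (ft \<psi> \<omega>)"] d2
        plancherel_ccs_integrable[OF psi] by simp
    then show ?thesis
      using nn_integral_eq_integral[OF d2] by simp
  qed
  have ev: "eventually (\<lambda>R. norm ?D \<le> sqrt (enn2real (?e R)) * ?\<Psi>) at_top"
    using eventually_conj[OF eventually_ge_at_top[of R0] order_tendstoD(2)[OF e0 ennreal_zero_less_top]]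
    by (rule eventually_mono) (elim conjE, rule bound)
  have "((\<lambda>R. enn2real (?e R)) \<longlongrightarrow> 0) at_top"
    using e0 by (intro tendsto_enn2real) simp_all
  then have lim: "((\<lambda>R. sqrt (enn2real (?e R)) * ?\<Psi>) \<longlongrightarrow> sqrt 0 * ?\<Psi>) at_top"
    by (intro tendsto_mult tendsto_real_sqrt tendsto_const)
  have "norm ?D \<le> sqrt 0 * ?\<Psi>"
    by (rule tendsto_lowerbound[OF lim ev]) simp
  then show ?thesis by simp
qed

section \<open>Band-limiting a square-integrable function\<close>

lemma tendsto_clamp_truncation:
  fixes z :: "nat \<Rightarrow> complex"
  assumes "z \<longlonglongrightarrow> l" "norm l \<le> K" "K > 0"
  shows "(\<lambda>n. (K / max K (norm (z n))) *\<^sub>R z n) \<longlonglongrightarrow> l"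
proof -
  have "(\<lambda>n. (K / max K (norm (z n))) *\<^sub>R z n) \<longlonglongrightarrow> (K / max K (norm l)) *\<^sub>R l"
    using assms by (intro tendsto_intros) auto
  then show ?thesis using assms by (simp add: max_absorb1)
qed

text \<open>Duality is tested with \<open>r\<close> itself, cut off to be bounded with bounded support. Such a function is almost
everywhere the limit of continuous ones; clamping their values and multiplying by a continuous cutoff makes
the limit dominated.\<close>

lemma bounded_truncation_by_duality:
  fixes r :: "real \<Rightarrow> complex"
  assumes r[measurable]: "r \<in> borel_measurable borel"
    and rint: "\<And>S. integrable lborel (\<lambda>x. indicator {-S..S} x * (norm (r x))\<^sup>2)"
    and dual: "\<And>\<psi>. continuous_compact_support \<psi> \<Longrightarrow>
        norm (\<integral>x. r x * cnj (\<psi> x) \<partial>lborel) \<le> A * sqrt (energy \<psi>)"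
    and A: "A \<ge> 0" and K: "K > 0" and R: "R > 0"
  shows "(\<integral>x. (if norm (r x) \<le> K \<and> \<bar>x\<bar> \<le> R then (norm (r x))\<^sup>2 else 0) \<partial>lborel) \<le> A\<^sup>2"
proof -
  define \<rho> where "\<rho> = (\<lambda>x. if norm (r x) \<le> K \<and> \<bar>x\<bar> \<le> R then r x else 0)"
  have [measurable]: "\<rho> \<in> borel_measurable borel" unfolding \<rho>_def by measurable
  have \<rho>K: "norm (\<rho> x) \<le> K" for x using K by (auto simp: \<rho>_def)
  have "\<rho> \<in> borel_measurable lebesgue"
    using measurable_completion[of \<rho> lborel borel] by simp
  then have "\<rho> measurable_on UNIV"
    by (rule lebesgue_measurable_imp_measurable_on) simp
  then obtain N q where N: "negligible N" and q: "\<And>n. continuous_on UNIV (q n)"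
    and lim: "\<And>x. x \<notin> N \<Longrightarrow> (\<lambda>n. q n x) \<longlonglongrightarrow> \<rho> x"
    unfolding measurable_on_def by auto
  have "N \<in> null_sets (completion lborel)"
    using N negligible_iff_null_sets by blast
  then obtain N' where N': "N' \<in> null_sets lborel" "N \<subseteq> N'"
    using null_sets_completion_iff2 by metis
  have AEN: "AE x in lborel. x \<notin> N"
    using AE_not_in[OF N'(1)] by (rule AE_mp) (use N'(2) in auto)
  \<comment> \<open>a continuous cutoff that is 1 on \<open>[-R, R]\<close> and 0 outside \<open>[-R-1, R+1]\<close>\<close>
  define cut where "cut = (\<lambda>x::real. max 0 (min 1 (R + 1 - \<bar>x\<bar>)))"
  have cut: "0 \<le> cut x" "cut x \<le> 1" for x by (auto simp: cut_def)
  define \<phi> where "\<phi> = (\<lambda>n x. cut x *\<^sub>R ((K / max K (norm (q n x))) *\<^sub>R q n x))"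
  have ccs: "continuous_compact_support (\<phi> n)" for n
    unfolding continuous_compact_support_def
  proof (intro conjI exI allI impI)
    show "continuous_on UNIV (\<phi> n)"
      unfolding \<phi>_def cut_def using K by (intro continuous_intros q) auto
    fix x :: real assume "\<bar>x\<bar> > R + 1"
    then show "\<phi> n x = 0" by (simp add: \<phi>_def cut_def)
  qed
  have [measurable]: "\<phi> n \<in> borel_measurable borel" for n by (rule ccs_measurable[OF ccs])
  have \<phi>K: "norm (\<phi> n x) \<le> indicator {-(R+1)..R+1} x * K" for n x
  proof (cases "\<bar>x\<bar> > R + 1")
    case True then show ?thesis using K by (simp add: \<phi>_def cut_def)
  next
    case False
    have "K / max K (norm (q n x)) * norm (q n x) \<le> K"
    proof -
      have "norm (q n x) / max K (norm (q n x)) \<le> 1" using K by (simp add: divide_le_eq)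
      from mult_left_mono[OF this less_imp_le[OF K]] show ?thesis by simp
    qed
    then have "cut x * (K / max K (norm (q n x)) * norm (q n x)) \<le> 1 * K"
      using cut K by (intro mult_mono) auto
    moreover have "indicator {-(R+1)..R+1} x = (1::real)" using False by (auto simp: indicator_def)
    ultimately show ?thesis using cut[of x] K by (simp add: \<phi>_def mult.assoc)
  qed
  have \<phi>lim: "(\<lambda>n. \<phi> n x) \<longlonglongrightarrow> \<rho> x" if "x \<notin> N" for x
  proof -
    have "(\<lambda>n. \<phi> n x) \<longlonglongrightarrow> cut x *\<^sub>R \<rho> x"
      unfolding \<phi>_def
      by (intro tendsto_scaleR tendsto_const tendsto_clamp_truncation lim that \<rho>K K)
    moreover have "cut x *\<^sub>R \<rho> x = \<rho> x" by (auto simp: \<rho>_def cut_def)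
    ultimately show ?thesis by simp
  qed
  let ?V = "\<integral>x. (norm (\<rho> x))\<^sup>2 \<partial>lborel"
  have "(\<lambda>n. \<integral>x. r x * cnj (\<phi> n x) \<partial>lborel) \<longlonglongrightarrow> (\<integral>x. r x * cnj (\<rho> x) \<partial>lborel)"
  proof (rule integral_dominated_convergence)
    let ?I = "indicator {-(R+1)..R+1}"
    have "integrable lborel (\<lambda>x. norm (?I x * r x))"
    proof -
      have "integrable lborel (\<lambda>x. (norm (?I x * r x))\<^sup>2)"
      proof -
        have "(\<lambda>x. (norm (?I x * r x))\<^sup>2) = (\<lambda>x. indicator {-(R+1)..R+1} x * (norm (r x))\<^sup>2)"
          by (auto simp: indicator_def)
        then show ?thesis using rint[of "R + 1"] by simp
      qed
      then have "integrable lborel (\<lambda>x. ?I x * (?I x * r x))"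
        by (intro integrable_indicator_of_square) auto
      moreover have "(\<lambda>x. ?I x * (?I x * r x)) = (\<lambda>x. ?I x * r x)"
        by (auto simp: indicator_def)
      ultimately show ?thesis by (simp add: integrable_norm)
    qed
    then show "integrable lborel (\<lambda>x. norm (?I x * r x) * K)" by (rule integrable_mult_left)
    show "AE x in lborel. norm (r x * cnj (\<phi> n x)) \<le> norm (?I x * r x) * K" for n
    proof (rule AE_I2)
      fix x
      have "norm (r x) * norm (\<phi> n x) \<le> norm (r x) * (?I x * K)"
        by (intro mult_left_mono \<phi>K) simp
      then show "norm (r x * cnj (\<phi> n x)) \<le> norm (?I x * r x) * K"
        by (auto simp: norm_mult indicator_def split: if_splits)
    qed
    show "AE x in lborel. (\<lambda>n. r x * cnj (\<phi> n x)) \<longlonglongrightarrow> r x * cnj (\<rho> x)"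
      using AEN by eventually_elim (intro tendsto_intros \<phi>lim)
  qed measurable
  moreover have "(\<integral>x. r x * cnj (\<rho> x) \<partial>lborel) = of_real ?V"
  proof -
    have "r x * cnj (\<rho> x) = \<rho> x * cnj (\<rho> x)" for x by (simp add: \<rho>_def)
    then have "(\<lambda>x. r x * cnj (\<rho> x)) = (\<lambda>x. complex_of_real ((norm (\<rho> x))\<^sup>2))"
      by (simp only: complex_norm_square)
    then show ?thesis by (simp only: integral_complex_of_real)
  qed
  ultimately have "(\<lambda>n. \<integral>x. r x * cnj (\<phi> n x) \<partial>lborel) \<longlonglongrightarrow> complex_of_real ?V"
    by simp
  then have l1: "(\<lambda>n. norm (\<integral>x. r x * cnj (\<phi> n x) \<partial>lborel)) \<longlonglongrightarrow> norm (complex_of_real ?V)"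
    by (rule tendsto_norm)
  have "(\<lambda>n. \<integral>x. (norm (\<phi> n x))\<^sup>2 \<partial>lborel) \<longlonglongrightarrow> ?V"
  proof (rule integral_dominated_convergence)
    show "integrable lborel (\<lambda>x. indicator {-(R+1)..R+1} x * K\<^sup>2)"
      by (intro integrable_mult_left integrable_real_indicator) (auto simp: emeasure_lborel_Icc_eq)
    show "AE x in lborel. norm ((norm (\<phi> n x))\<^sup>2) \<le> indicator {-(R+1)..R+1} x * K\<^sup>2" for n
    proof (rule AE_I2)
      fix x
      have "(norm (\<phi> n x))\<^sup>2 \<le> (indicator {-(R+1)..R+1} x * K)\<^sup>2"
        by (intro power_mono \<phi>K) simp
      then show "norm ((norm (\<phi> n x))\<^sup>2) \<le> indicator {-(R+1)..R+1} x * K\<^sup>2"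
        by (auto simp: indicator_def split: if_splits)
    qed
    show "AE x in lborel. (\<lambda>n. (norm (\<phi> n x))\<^sup>2) \<longlonglongrightarrow> (norm (\<rho> x))\<^sup>2"
      using AEN by eventually_elim (intro tendsto_intros \<phi>lim)
  qed measurable
  then have l2: "(\<lambda>n. A * sqrt (\<integral>x. (norm (\<phi> n x))\<^sup>2 \<partial>lborel)) \<longlonglongrightarrow> A * sqrt ?V"
    by (intro tendsto_intros)
  have V0: "?V \<ge> 0" by simp
  have "norm (complex_of_real ?V) \<le> A * sqrt ?V"
    using LIMSEQ_le[OF l1 l2] dual[OF ccs] by blast
  then have le: "?V \<le> A * sqrt ?V"
    by (simp only: norm_of_real abs_of_nonneg[OF V0])
  \<comment> \<open>in the limit both sides of the duality bound contain the energy of the truncation\<close>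
  have "v \<le> A\<^sup>2" if "v \<ge> 0" "v \<le> A * sqrt v" for v
  proof (cases "v = 0")
    case False
    then have "sqrt v * sqrt v \<le> A * sqrt v" "sqrt v > 0" using that by auto
    then have "sqrt v \<le> A" by (rule mult_right_le_imp_le)
    then show ?thesis by (rule sqrt_le_D)
  qed simp
  from this[OF V0 le] have "?V \<le> A\<^sup>2" .
  moreover have "(\<lambda>x. (norm (\<rho> x))\<^sup>2) = (\<lambda>x. if norm (r x) \<le> K \<and> \<bar>x\<bar> \<le> R then (norm (r x))\<^sup>2 else 0)"
    by (auto simp: \<rho>_def)
  ultimately show ?thesis by simp
qed

lemma L2_bound_by_duality:
  fixes r :: "real \<Rightarrow> complex"
  assumes r[measurable]: "r \<in> borel_measurable borel"
    and rint: "\<And>S. integrable lborel (\<lambda>x. indicator {-S..S} x * (norm (r x))\<^sup>2)"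
    and dual: "\<And>\<psi>. continuous_compact_support \<psi> \<Longrightarrow>
        norm (\<integral>x. r x * cnj (\<psi> x) \<partial>lborel) \<le> A * sqrt (energy \<psi>)"
    and A: "A \<ge> 0" and R: "R > 0"
  shows "(\<integral>x. indicator {-R..R} x * (norm (r x))\<^sup>2 \<partial>lborel) \<le> A\<^sup>2"
proof (rule LIMSEQ_le_const2)
  show "(\<lambda>n. \<integral>x. (if norm (r x) \<le> real (Suc n) \<and> \<bar>x\<bar> \<le> R then (norm (r x))\<^sup>2 else 0) \<partial>lborel)
        \<longlonglongrightarrow> (\<integral>x. indicator {-R..R} x * (norm (r x))\<^sup>2 \<partial>lborel)"
  proof (rule integral_dominated_convergence[OF _ _ rint[of R]])
    show "AE x in lborel. (\<lambda>n. if norm (r x) \<le> real (Suc n) \<and> \<bar>x\<bar> \<le> R then (norm (r x))\<^sup>2 else 0)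
            \<longlonglongrightarrow> indicator {-R..R} x * (norm (r x))\<^sup>2"
    proof (rule AE_I2, rule tendsto_eventually)
      fix x
      obtain n0 where n0: "norm (r x) \<le> real n0" using real_arch_simple by blast
      show "\<forall>\<^sub>F n in sequentially. (if norm (r x) \<le> real (Suc n) \<and> \<bar>x\<bar> \<le> R then (norm (r x))\<^sup>2 else 0)
              = indicator {-R..R} x * (norm (r x))\<^sup>2"
        using eventually_ge_at_top[of n0]
      proof eventually_elim
        case (elim n)
        then have "norm (r x) \<le> real (Suc n)" using n0 by linarith
        then show ?case by (auto simp: indicator_def)
      qed
    qed
    show "AE x in lborel. norm (if norm (r x) \<le> real (Suc n) \<and> \<bar>x\<bar> \<le> R then (norm (r x))\<^sup>2 else 0)
            \<le> indicator {-R..R} x * (norm (r x))\<^sup>2" for n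
      by (auto simp: indicator_def intro!: AE_I2)
  qed measurable
  show "\<exists>N. \<forall>n\<ge>N. (\<integral>x. (if norm (r x) \<le> real (Suc n) \<and> \<bar>x\<bar> \<le> R then (norm (r x))\<^sup>2 else 0) \<partial>lborel) \<le> A\<^sup>2"
    by (intro exI allI impI bounded_truncation_by_duality[OF r rint dual A _ R]) auto
qed

definition lowpass :: "real \<Rightarrow> (real \<Rightarrow> complex) \<Rightarrow> real \<Rightarrow> complex" where
  "lowpass W G x = (\<integral>\<omega>. indicator {-W..W} \<omega> * G \<omega> * cis (\<omega> * x) \<partial>lborel) / (2 * pi)"

text \<open>Against a test function \<open>\<psi>\<close>, Parseval's identity for \<open>g\<close> and the multiplication formula for the compactly
supported part of \<open>G\<close> leave only the integral of \<open>G\<close> times the transform of \<open>\<psi>\<close> over \<open>|\<omega>| > W\<close>. Duality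
turns this into an \<open>L\<^sup>2\<close> bound. For negative \<open>W\<close> the band is empty, and the lemma bounds \<open>g\<close> itself by \<open>G\<close>.\<close>

lemma lowpass_error:
  assumes [measurable]: "g \<in> borel_measurable borel" "G \<in> borel_measurable borel"
    and FG: "has_fourier g G" and R: "R > 0"
  shows "(\<integral>x. indicator {-R..R} x * (norm (g x - lowpass W G x))\<^sup>2 \<partial>lborel)
         \<le> (\<integral>\<omega>. (if \<bar>\<omega>\<bar> \<le> W then 0 else (norm (G \<omega>))\<^sup>2) \<partial>lborel) / (2 * pi)"
    and "integrable lborel (\<lambda>x. indicator {-R..R} x * (norm (g x - lowpass W G x))\<^sup>2)"
proof -
  have g2: "finite_energy g" and G2: "finite_energy G"
    using FG by (auto simp: has_fourier_def square_integrable_on_UNIV_borel)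
  define H where "H = (\<lambda>\<omega>. indicator {-W..W} \<omega> * G \<omega>)"
  define D where "D = (\<lambda>\<omega>. if \<bar>\<omega>\<bar> \<le> W then 0 else G \<omega>)"
  have [measurable]: "H \<in> borel_measurable borel" "D \<in> borel_measurable borel"
    unfolding H_def D_def by measurable
  have H: "integrable lborel H" unfolding H_def by (rule integrable_indicator_of_square[OF _ G2]) simp
  have D2: "finite_energy D"
    by (rule Bochner_Integration.integrable_bound[OF G2]) (auto simp: D_def)
  have H2: "finite_energy H"
    by (rule Bochner_Integration.integrable_bound[OF G2]) (auto simp: H_def indicator_def)
  have lp_ft: "ft (\<lambda>\<omega>. cnj (H \<omega>)) x = cnj (2 * pi * lowpass W G x)" for x
    unfolding ft_def lowpass_def H_def
    by (simp add: cis_cnj mult_ac flip: Bochner_Integration.integral_cnj)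
  have lp_m[measurable]: "lowpass W G \<in> borel_measurable borel"
    unfolding lowpass_def by measurable
  define C where "C = (\<integral>\<omega>. norm (H \<omega>) \<partial>lborel) / (2 * pi)"
  have lpC: "norm (lowpass W G x) \<le> C" for x
    unfolding lowpass_def C_def H_def
    by (auto simp: norm_divide norm_mult intro!: divide_right_mono order_trans[OF integral_norm_bound])
  have loc: "integrable lborel (\<lambda>x. indicator {-S..S} x * (norm (g x - lowpass W G x))\<^sup>2)" for S
  proof (rule Bochner_Integration.integrable_bound)
    show "integrable lborel (\<lambda>x. 2 * (norm (g x))\<^sup>2 + indicator {-S..S} x * (2 * C\<^sup>2))"
      by (intro Bochner_Integration.integrable_add integrable_mult_right g2 integrable_mult_left integrable_real_indicator)
         (auto simp: emeasure_lborel_Icc_eq)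
    show "AE x in lborel. norm (indicator {-S..S} x * (norm (g x - lowpass W G x))\<^sup>2)
           \<le> norm (2 * (norm (g x))\<^sup>2 + indicator {-S..S} x * (2 * C\<^sup>2))"
    proof (rule AE_I2)
      fix x
      have "norm (g x - lowpass W G x) \<le> norm (g x) + C"
        using norm_triangle_ineq4[of "g x" "lowpass W G x"] lpC[of x] by linarith
      then have "(norm (g x - lowpass W G x))\<^sup>2 \<le> (norm (g x) + C)\<^sup>2" by (rule power_mono) simp
      also have "\<dots> \<le> 2 * (norm (g x))\<^sup>2 + 2 * C\<^sup>2"
        using zero_le_power2[of "norm (g x) - C"] by (simp add: power2_sum power2_diff)
      finally show "norm (indicator {-S..S} x * (norm (g x - lowpass W G x))\<^sup>2)
           \<le> norm (2 * (norm (g x))\<^sup>2 + indicator {-S..S} x * (2 * C\<^sup>2))"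
        by (auto simp: indicator_def)
    qed
  qed measurable
  then show "integrable lborel (\<lambda>x. indicator {-R..R} x * (norm (g x - lowpass W G x))\<^sup>2)" .
  let ?A = "sqrt (energy D) / sqrt (2 * pi)"
  have dual: "norm (\<integral>x. (g x - lowpass W G x) * cnj (\<psi> x) \<partial>lborel) \<le> ?A * sqrt (energy \<psi>)"
    if psi: "continuous_compact_support \<psi>" for \<psi>
  proof -
    note [measurable] = ccs_measurable[OF psi]
    have i\<psi>: "integrable lborel \<psi>" by (rule ccs_integrable[OF psi])
    have p2: "finite_energy (ft \<psi>)" by (rule plancherel_ccs_integrable[OF psi])
    have "(\<integral>\<omega>. ft \<psi> \<omega> * cnj (H \<omega>) \<partial>lborel) = (\<integral>x. \<psi> x * cnj (2 * pi * lowpass W G x) \<partial>lborel)"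
      using ft_multiplication_formula[OF i\<psi>, of "\<lambda>\<omega>. cnj (H \<omega>)"] H by (simp only: lp_ft) simp
    also have "\<dots> = (\<integral>x. complex_of_real (2 * pi) * (\<psi> x * cnj (lowpass W G x)) \<partial>lborel)"
      by (simp add: mult_ac)
    also have "\<dots> = complex_of_real (2 * pi) * (\<integral>x. \<psi> x * cnj (lowpass W G x) \<partial>lborel)"
      by (rule integral_mult_right_zero)
    finally have "(\<integral>\<omega>. ft \<psi> \<omega> * cnj (H \<omega>) \<partial>lborel) = complex_of_real (2 * pi) * (\<integral>x. \<psi> x * cnj (lowpass W G x) \<partial>lborel)" .
    from arg_cong[OF this, of cnj]
    have low: "(\<integral>\<omega>. H \<omega> * cnj (ft \<psi> \<omega>) \<partial>lborel) = 2 * pi * (\<integral>x. lowpass W G x * cnj (\<psi> x) \<partial>lborel)"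
      by (simp add: mult_ac flip: Bochner_Integration.integral_cnj)
    have i1: "integrable lborel (\<lambda>x. g x * cnj (\<psi> x))"
      using g2 ccs_integrable_square[OF psi] by (intro integrable_mult_of_squares) auto
    have i2: "integrable lborel (\<lambda>x. lowpass W G x * cnj (\<psi> x))"
      by (rule Bochner_Integration.integrable_bound[of _ "\<lambda>x. C * norm (\<psi> x)"])
         (use i\<psi> lpC order_trans[OF norm_ge_zero lpC] in \<open>auto simp: norm_mult intro!: mult_right_mono\<close>)
    have i3: "integrable lborel (\<lambda>\<omega>. G \<omega> * cnj (ft \<psi> \<omega>))"
      using G2 p2 by (intro integrable_mult_of_squares) auto
    have i4: "integrable lborel (\<lambda>\<omega>. H \<omega> * cnj (ft \<psi> \<omega>))"
      using H2 p2 by (intro integrable_mult_of_squares) auto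
    have "2 * pi * (\<integral>x. (g x - lowpass W G x) * cnj (\<psi> x) \<partial>lborel)
          = (\<integral>\<omega>. G \<omega> * cnj (ft \<psi> \<omega>) \<partial>lborel) - (\<integral>\<omega>. H \<omega> * cnj (ft \<psi> \<omega>) \<partial>lborel)"
      using i1 i2 by (simp add: left_diff_distrib parseval_fourier[OF _ _ FG psi] low right_diff_distrib)
    also have "\<dots> = (\<integral>\<omega>. D \<omega> * cnj (ft \<psi> \<omega>) \<partial>lborel)"
      unfolding Bochner_Integration.integral_diff[OF i3 i4, symmetric]
      by (intro Bochner_Integration.integral_cong refl) (auto simp: D_def H_def indicator_def)
    finally have e: "complex_of_real (2 * pi) * (\<integral>x. (g x - lowpass W G x) * cnj (\<psi> x) \<partial>lborel)
        = (\<integral>\<omega>. D \<omega> * cnj (ft \<psi> \<omega>) \<partial>lborel)" by simp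
    have "2 * pi * norm (\<integral>x. (g x - lowpass W G x) * cnj (\<psi> x) \<partial>lborel) = norm (\<integral>\<omega>. D \<omega> * cnj (ft \<psi> \<omega>) \<partial>lborel)"
      unfolding e[symmetric] norm_mult norm_of_real by simp
    also have "\<dots> \<le> sqrt (energy D) * sqrt (energy (ft \<psi>))"
      using norm_integral_mult_le[of D lborel "\<lambda>\<omega>. cnj (ft \<psi> \<omega>)"] D2 p2 by simp
    also have "\<dots> = 2 * pi * (?A * sqrt (energy \<psi>))"
    proof -
      have "a * (s * v) = s * s * (a / s * v)" if "s \<noteq> 0" for a s v :: real
        using that by simp
      from this[of "sqrt (2 * pi)"] show ?thesis
        unfolding plancherel_ccs[OF psi] real_sqrt_mult[of "2 * pi"] by simp
    qed
    finally show ?thesis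
      by (rule mult_left_le_imp_le) simp
  qed
  have "(\<integral>x. indicator {-R..R} x * (norm (g x - lowpass W G x))\<^sup>2 \<partial>lborel) \<le> ?A\<^sup>2"
    by (rule L2_bound_by_duality[OF _ loc dual _ R]) auto
  also have "?A\<^sup>2 = energy D / (2 * pi)"
    by (simp add: power_divide)
  also have "(\<lambda>\<omega>. (norm (D \<omega>))\<^sup>2) = (\<lambda>\<omega>. if \<bar>\<omega>\<bar> \<le> W then 0 else (norm (G \<omega>))\<^sup>2)"
    by (auto simp: D_def)
  finally show "(\<integral>x. indicator {-R..R} x * (norm (g x - lowpass W G x))\<^sup>2 \<partial>lborel)
         \<le> (\<integral>\<omega>. (if \<bar>\<omega>\<bar> \<le> W then 0 else (norm (G \<omega>))\<^sup>2) \<partial>lborel) / (2 * pi)" .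
qed

section \<open>Bessel's inequality and Poisson summation\<close>

lemma cis_int_mult_2pi: "cis (2 * pi * of_int m) = 1"
  by (rule cis_multiple_2pi) simp

lemma integral_cis_Icc:
  assumes "a \<noteq> 0" "L \<ge> 0"
  shows "(\<integral>x. indicator {-L..L} x *\<^sub>R cis (a * x) \<partial>lborel) = (cis (a * L) - cis (- (a * L))) / (\<i> * a)"
proof -
  have "((\<lambda>x. cis (a * x) / (\<i> * a)) has_vector_derivative cis (a * x)) (at x within {-L..L})" for x
  proof -
    have "((\<lambda>x. exp (\<i> * (a * of_real x)) / (\<i> * a)) has_vector_derivative exp (\<i> * (a * x))) (at x within {-L..L})"
    proof -
      have "- (\<i> * (z * \<i>)) = z" for z by (simp add: complex_eq_iff)
      then show ?thesis using assms
        by (auto intro!: derivative_eq_intros has_vector_derivative_real_field)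
    qed
    then show ?thesis by (simp add: cis_conv_exp)
  qed
  moreover have "continuous_on {-L..L} (\<lambda>x. cis (a * x))"
    by (intro continuous_on_cis continuous_intros)
  ultimately have "has_bochner_integral lborel (\<lambda>x. indicator {-L..L} x *\<^sub>R cis (a * x))
      (cis (a * L) / (\<i> * a) - cis (a * (-L)) / (\<i> * a))"
    using assms by (intro has_bochner_integral_FTC_Icc) auto
  then show ?thesis
    by (simp add: has_bochner_integral_integral_eq diff_divide_distrib)
qed

lemma integral_Fourier_mode:
  assumes "L > 0"
  shows "(\<integral>x. indicator {-L..<L} x *\<^sub>R cis (pi * of_int m / L * x) \<partial>lborel) = (if m = 0 then 2 * of_real L else 0)"
proof -
  have "(\<integral>x. indicator {-L..<L} x *\<^sub>R cis (pi * of_int m / L * x) \<partial>lborel)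
        = (\<integral>x. indicator {-L..L} x *\<^sub>R cis (pi * of_int m / L * x) \<partial>lborel)"
  proof (rule integral_cong_AE)
    show "AE x in lborel. indicator {-L..<L} x *\<^sub>R cis (pi * of_int m / L * x) = indicator {-L..L} x *\<^sub>R cis (pi * of_int m / L * x)"
      using AE_lborel_singleton[of L] by eventually_elim (auto simp: indicator_def)
  qed measurable
  also have "\<dots> = (if m = 0 then 2 * of_real L else 0)"
  proof (cases "m = 0")
    case True
    have "(\<integral>x. complex_of_real (indicator {-L..L} x) \<partial>lborel) = of_real (\<integral>x. indicator {-L..L} x \<partial>lborel)"
      by (rule integral_complex_of_real)
    then show ?thesis using True assms by (simp add: scaleR_conv_of_real)
  next
    case False
    have "cis (pi * of_int m) = cis (- (pi * of_int m)) * cis (2 * pi * of_int m)"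
      by (simp add: cis_mult algebra_simps)
    also have "\<dots> = cis (- (pi * of_int m))" unfolding cis_int_mult_2pi by simp
    finally show ?thesis using False assms by (subst integral_cis_Icc) auto
  qed
  finally show ?thesis .
qed

text \<open>With \<open>c n\<close> the coefficients and \<open>Q\<close> the conjugate of their trigonometric polynomial, \<open>\<Sum>|c n|\<^sup>2\<close> is the integral of
\<open>H Q\<close>, while orthogonality gives \<open>Q\<close> the energy \<open>2L \<Sum>|c n|\<^sup>2\<close>. The Cauchy-Schwarz inequality finishes.
The half-open interval lets integer translates tile the line.\<close>

lemma Bessel_inequality:
  fixes H :: "real \<Rightarrow> complex" and F :: "int set"
  assumes [measurable]: "H \<in> borel_measurable borel" and H2: "finite_energy H"
    and supp: "\<And>x. x \<notin> {-L..<L} \<Longrightarrow> H x = 0" and L: "L > 0" and F: "finite F"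
  shows "(\<Sum>n\<in>F. (norm (ft H (pi * of_int n / L)))\<^sup>2) \<le> 2 * L * energy H"
proof -
  define c where "c = (\<lambda>n::int. ft H (pi * of_int n / L))"
  define Q where "Q = (\<lambda>x. \<Sum>n\<in>F. cnj (c n) * (indicator {-L..<L} x *\<^sub>R cis (- (pi * of_int n / L * x))))"
  define S where "S = (\<Sum>n\<in>F. (norm (c n))\<^sup>2)"
  have S0: "S \<ge> 0" unfolding S_def by (simp add: sum_nonneg)
  have intcis: "integrable lborel (\<lambda>x. indicator {-L..<L} x *\<^sub>R cis (a * x))" for a
    by (rule integrable_bounded_support[where K=1 and R=L]) (auto simp: indicator_def)
  have H1: "integrable lborel H"
  proof -
    have "(\<lambda>x. indicator {-L..L} x * H x) = H"
    proof
      fix x show "indicator {-L..L} x * H x = H x"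
        by (cases "x \<in> {-L..<L}") (auto simp: supp)
    qed
    then show ?thesis using integrable_indicator_of_square[OF _ H2, of L] by simp
  qed
  have [measurable]: "Q \<in> borel_measurable borel" unfolding Q_def by measurable
  have QQ: "of_real ((norm (Q x))\<^sup>2) = (\<Sum>n\<in>F. \<Sum>m\<in>F. cnj (c n) * c m * (indicator {-L..<L} x *\<^sub>R cis (pi * of_int (m - n) / L * x)))" for x
  proof -
    have "of_real ((norm (Q x))\<^sup>2) = Q x * cnj (Q x)" by (simp only: complex_norm_square)
    also have "\<dots> = (\<Sum>n\<in>F. \<Sum>m\<in>F. (cnj (c n) * (indicator {-L..<L} x *\<^sub>R cis (- (pi * of_int n / L * x))))
         * (c m * (indicator {-L..<L} x *\<^sub>R cis (pi * of_int m / L * x))))"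
      by (simp add: Q_def sum_product cis_cnj)
    also have "\<dots> = (\<Sum>n\<in>F. \<Sum>m\<in>F. cnj (c n) * c m * (indicator {-L..<L} x *\<^sub>R cis (pi * of_int (m - n) / L * x)))"
    proof (intro sum.cong refl)
      fix n m
      have "cis (- (pi * of_int n / L * x)) * cis (pi * of_int m / L * x) = cis (pi * of_int (m - n) / L * x)"
        by (simp add: cis_mult diff_divide_distrib algebra_simps)
      then show "(cnj (c n) * (indicator {-L..<L} x *\<^sub>R cis (- (pi * of_int n / L * x))))
         * (c m * (indicator {-L..<L} x *\<^sub>R cis (pi * of_int m / L * x)))
         = cnj (c n) * c m * (indicator {-L..<L} x *\<^sub>R cis (pi * of_int (m - n) / L * x))"
        by (auto simp: indicator_def mult_ac)
    qed
    finally show ?thesis .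
  qed
  have Q2c: "integrable lborel (\<lambda>x. complex_of_real ((norm (Q x))\<^sup>2))"
    unfolding QQ by (intro Bochner_Integration.integrable_sum integrable_mult_right intcis)
  have Q2: "finite_energy Q"
    using Q2c by (simp only: complex_of_real_integrable_eq)
  have "complex_of_real (energy Q) = (\<integral>x. complex_of_real ((norm (Q x))\<^sup>2) \<partial>lborel)"
    by (rule integral_complex_of_real[symmetric])
  also have "\<dots> = (\<Sum>n\<in>F. \<Sum>m\<in>F. cnj (c n) * c m * (if m - n = 0 then 2 * of_real L else 0))"
    unfolding QQ
    by (subst Bochner_Integration.integral_sum, intro Bochner_Integration.integrable_sum integrable_mult_right intcis,
        intro sum.cong refl, subst Bochner_Integration.integral_sum, intro integrable_mult_right intcis,
        intro sum.cong refl, subst integral_mult_right_zero, simp only: integral_Fourier_mode[OF L])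
  also have "\<dots> = (\<Sum>n\<in>F. \<Sum>m\<in>F. if m = n then cnj (c n) * c n * (2 * of_real L) else 0)"
    by (intro sum.cong refl) auto
  also have "\<dots> = (\<Sum>n\<in>F. 2 * of_real L * of_real ((norm (c n))\<^sup>2))"
    using F by (intro sum.cong refl) (simp add: complex_norm_square mult_ac del: of_real_power)
  also have "\<dots> = complex_of_real (2 * L * S)" by (simp add: S_def sum_distrib_left)
  finally have QS: "energy Q = 2 * L * S" by (simp only: of_real_eq_iff)
  have "(\<integral>x. H x * Q x \<partial>lborel) = (\<integral>x. (\<Sum>n\<in>F. cnj (c n) * (H x * cis (- (pi * of_int n / L * x)))) \<partial>lborel)"
  proof (intro Bochner_Integration.integral_cong refl)
    fix x
    show "H x * Q x = (\<Sum>n\<in>F. cnj (c n) * (H x * cis (- (pi * of_int n / L * x))))"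
      unfolding Q_def sum_distrib_left
      by (intro sum.cong refl) (use supp[of x] in \<open>auto simp: indicator_def mult_ac\<close>)
  qed
  also have "\<dots> = (\<Sum>n\<in>F. cnj (c n) * c n)"
  proof -
    have hi: "integrable lborel (\<lambda>x. H x * cis (- (pi * of_int n / L * x)))" for n :: int
      using integrable_mult_cis[OF H1, of "- (pi * of_int n / L)"] by simp
    have cn: "(\<integral>x. H x * cis (- (pi * of_int n / L * x)) \<partial>lborel) = c n" for n
      by (simp add: c_def ft_def)
    show ?thesis
      by (simp only: Bochner_Integration.integral_sum[OF integrable_mult_right[OF hi]] integral_mult_right_zero cn)
  qed
  also have "\<dots> = of_real S" unfolding S_def of_real_sum
    by (intro sum.cong refl) (simp add: complex_norm_square mult_ac del: of_real_power)
  finally have "S = norm (\<integral>x. H x * Q x \<partial>lborel)" using S0 by simp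
  also have "\<dots> \<le> sqrt (energy H) * sqrt (2 * L * S)"
    using norm_integral_mult_le[of H lborel Q] H2 Q2 unfolding QS by simp
  finally have "S\<^sup>2 \<le> (sqrt (energy H) * sqrt (2 * L * S))\<^sup>2"
    using S0 by (rule power_mono)
  also have "\<dots> = energy H * (2 * L * S)"
    using S0 L by (simp add: power_mult_distrib)
  finally have "S * S \<le> (2 * L * energy H) * S" by (simp add: power2_eq_square mult_ac)
  then have "S \<le> 2 * L * energy H"
    using S0 L by (cases "S = 0") auto
  then show ?thesis by (simp add: S_def c_def)
qed

text \<open>Makes the difference quotient in the proof of \<open>poisson_summation\<close> bounded.\<close>

lemma norm_cis_2pi_minus_1_ge:
  assumes "\<bar>t\<bar> \<le> 1/2"
  shows "\<bar>t\<bar> \<le> norm (cis (2 * pi * t) - 1)"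
proof -
  have "cis (2 * pi * t) - 1 = cis (pi * t) * (2 * \<i> * sin (pi * t))"
  proof -
    have "cis (2 * pi * t) = cis (pi * t) * cis (pi * t)" by (simp add: cis_mult mult.assoc)
    moreover have "1 = cis (pi * t) * cis (- (pi * t))" by (simp add: cis_mult)
    moreover have "cis (pi * t) - cis (- (pi * t)) = 2 * \<i> * sin (pi * t)"
      by (simp add: complex_eq_iff)
    ultimately show ?thesis by (metis right_diff_distrib)
  qed
  then have n: "norm (cis (2 * pi * t) - 1) = 2 * \<bar>sin (pi * t)\<bar>" by (simp add: norm_mult)
  define x where "x = pi * t"
  have "\<bar>sin x - x\<bar> \<le> \<bar>x\<bar> ^ 3 / 6"
    using Maclaurin_sin_bound[of x 3] by (simp add: eval_nat_numeral sin_coeff_def fact_numeral)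
  moreover have "\<bar>x\<bar> ^ 3 / 6 \<le> \<bar>x\<bar> / 2"
  proof -
    have "\<bar>x\<bar> = pi * \<bar>t\<bar>" by (simp add: x_def abs_mult)
    also have "\<dots> \<le> pi * (1/2)" using assms by (intro mult_left_mono) auto
    also have "\<dots> \<le> 17/10" using pi_approx by simp
    finally have "\<bar>x\<bar>\<^sup>2 \<le> (17/10)\<^sup>2" by (intro power_mono) auto
    then have "\<bar>x\<bar>\<^sup>2 \<le> 3" by (simp add: power2_eq_square)
    then have "\<bar>x\<bar> * \<bar>x\<bar>\<^sup>2 \<le> \<bar>x\<bar> * 3" by (intro mult_left_mono) auto
    then show ?thesis by (simp add: power3_eq_cube power2_eq_square)
  qed
  ultimately have "\<bar>sin x\<bar> \<ge> \<bar>x\<bar> / 2" by linarith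
  moreover have "\<bar>x\<bar> \<ge> \<bar>t\<bar>"
    using mult_right_mono[of 1 pi "\<bar>t\<bar>"] pi_gt3 by (simp add: x_def abs_mult)
  ultimately show ?thesis unfolding n x_def by linarith
qed

lemma sum_int_symmetric_Suc:
  fixes f :: "int \<Rightarrow> 'a::comm_monoid_add"
  shows "(\<Sum>n\<in>{-int (Suc K)..int (Suc K)}. f n) = f (int (Suc K)) + (f (- int (Suc K)) + (\<Sum>n\<in>{-int K..int K}. f n))"
proof -
  have "{-int (Suc K)..int (Suc K)} = insert (int (Suc K)) (insert (- int (Suc K)) {-int K..int K})"
    by auto
  then show ?thesis by (simp only:) (subst sum.insert, auto)+
qed

lemma sum_unit_cells:
  "(\<Sum>n\<in>{-int K..int K}. indicator {-1/2..<1/2} (x - of_int n)) = (indicator {- real K - 1/2..<real K + 1/2} x :: real)"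
proof (induction K)
  case (Suc K)
  show ?case unfolding sum_int_symmetric_Suc Suc by (auto simp: indicator_def)
qed simp

lemma dirichlet_telescope:
  "(cis \<theta> - 1) * (\<Sum>m\<in>{-int M..int M}. cis (- (\<theta> * of_int m))) = cis (\<theta> * (real M + 1)) - cis (- (\<theta> * real M))"
proof (induction M)
  case (Suc M)
  show ?case unfolding sum_int_symmetric_Suc distrib_left Suc
    by (simp add: cis_mult left_diff_distrib algebra_simps)
qed simp

lemma has_sum_int_symmetric_limit:
  assumes "(f has_sum s) (UNIV :: int set)"
  shows "(\<lambda>K. \<Sum>n\<in>{-int K..int K}. f n) \<longlonglongrightarrow> s"
proof -
  have "filterlim (\<lambda>K. {-int K..int K}) (finite_subsets_at_top UNIV) sequentially"
    unfolding filterlim_finite_subsets_at_top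
  proof (intro allI impI)
    fix X :: "int set" assume "finite X \<and> X \<subseteq> UNIV"
    then have X: "finite X" by simp
    define k0 where "k0 = Max (insert 0 ((\<lambda>n. nat \<bar>n\<bar>) ` X))"
    have k0: "nat \<bar>n\<bar> \<le> k0" if "n \<in> X" for n
      unfolding k0_def using X that by (intro Max_ge) auto
    show "\<forall>\<^sub>F K in sequentially. finite {-int K..int K} \<and> X \<subseteq> {-int K..int K} \<and> {-int K..int K} \<subseteq> UNIV"
      using eventually_ge_at_top[of k0]
    proof eventually_elim
      case (elim K)
      have "- int K \<le> n \<and> n \<le> int K" if "n \<in> X" for n
        using k0[OF that] elim by linarith
      then show ?case by auto
    qed
  qed
  then show ?thesis using assms unfolding has_sum_def by (rule filterlim_compose[rotated])
qed

text \<open>Chernoff's proof. The periodisation \<open>u\<close> of \<open>v\<close> has the \<open>m\<close>-th Fourier coefficient \<open>ft v (2\<pi>m)\<close>. Writing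
\<open>u(t) - u(0) = D(t) (e\<^bsup>2\<pi>it\<^esup> - 1)\<close>, its symmetric partial sums at 0 differ from \<open>u(0)\<close> by the difference of two
single Fourier coefficients of \<open>D\<close>. The Lipschitz bound makes \<open>D\<close> bounded, and by Bessel's inequality its
coefficients tend to zero.\<close>

theorem poisson_summation:
  fixes v :: "real \<Rightarrow> complex" and b :: "int \<Rightarrow> real"
  assumes v: "integrable lborel v" and b: "b summable_on UNIV"
    and bd: "\<And>n t. \<bar>t\<bar> \<le> 1/2 \<Longrightarrow> norm (v (of_int n + t)) \<le> b n"
    and lip: "\<And>n t. \<bar>t\<bar> \<le> 1/2 \<Longrightarrow> norm (v (of_int n + t) - v (of_int n)) \<le> b n * \<bar>t\<bar>"
  shows "(\<lambda>M. \<Sum>m\<in>{-int M..int M}. ft v (2 * pi * of_int m)) \<longlonglongrightarrow> (\<Sum>\<^sub>\<infinity>n. v (of_int n))"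
proof -
  have [measurable]: "v \<in> borel_measurable borel" using v by auto
  define u where "u = (\<lambda>t. \<Sum>\<^sub>\<infinity>n::int. v (of_int n + t))"
  define I where "I = (\<lambda>t. indicator {-1/2..<1/2::real} t :: real)"
  have [measurable]: "I \<in> borel_measurable borel" unfolding I_def by measurable
  have I_half: "I t \<noteq> 0 \<Longrightarrow> \<bar>t\<bar> \<le> 1/2" for t by (auto simp: I_def indicator_def split: if_splits)
  define B where "B = (\<Sum>\<^sub>\<infinity>n. b n)"
  have b0: "b n \<ge> 0" for n using bd[of 0 n] by (auto intro: order_trans[OF norm_ge_zero])
  have hasB: "(b has_sum B) UNIV" unfolding B_def using b by simp
  have B0: "B \<ge> 0" unfolding B_def by (rule infsum_nonneg) (simp add: b0)
  have hasu: "((\<lambda>n. v (of_int n + t)) has_sum u t) UNIV" if "\<bar>t\<bar> \<le> 1/2" for t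
  proof -
    have "(\<lambda>n. norm (v (of_int n + t))) summable_on UNIV"
      by (rule summable_on_comparison_test[OF b]) (use bd that in auto)
    then show ?thesis unfolding u_def by (rule has_sum_infsum[OF abs_summable_summable])
  qed
  have ulip: "norm (u t - u 0) \<le> B * \<bar>t\<bar>" if "\<bar>t\<bar> \<le> 1/2" for t
  proof (rule norm_infsum_le)
    show "((\<lambda>n. v (of_int n + t) - v (of_int n + 0)) has_sum (u t - u 0)) UNIV"
      using has_sum_add[OF hasu[OF that], of "\<lambda>n. - v (of_int n + 0)" "- u 0"] hasu[of 0]
      by (simp add: has_sum_uminus)
    show "((\<lambda>n. b n * \<bar>t\<bar>) has_sum B * \<bar>t\<bar>) UNIV" by (intro has_sum_cmult_left hasB)
  qed (use lip that in auto)
  define w where "w = (\<lambda>K t. I t *\<^sub>R (\<Sum>n\<in>{-int K..int K}. v (of_int n + t)))"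
  have [measurable]: "w K \<in> borel_measurable borel" for K unfolding w_def by measurable
  have wlim: "(\<lambda>K. w K t) \<longlonglongrightarrow> I t *\<^sub>R u t" for t
  proof (cases "I t = 0")
    case False
    then show ?thesis unfolding w_def
      by (intro tendsto_scaleR tendsto_const has_sum_int_symmetric_limit hasu I_half)
  qed (simp add: w_def)
  have Iu[measurable]: "(\<lambda>t. I t *\<^sub>R u t) \<in> borel_measurable borel"
    by (rule borel_measurable_LIMSEQ_metric[OF _ wlim]) measurable
  have wB: "norm (w K t) \<le> I t * B" for K t
  proof (cases "I t = 0")
    case False
    then have t: "\<bar>t\<bar> \<le> 1/2" and It: "I t = 1"
      using I_half by (auto simp: I_def indicator_def split: if_splits)
    have "norm (\<Sum>n\<in>{-int K..int K}. v (of_int n + t)) \<le> (\<Sum>n\<in>{-int K..int K}. b n)"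
      by (rule sum_norm_le) (use bd t in auto)
    also have "\<dots> \<le> B" unfolding B_def by (rule finite_sum_le_infsum[OF b]) (auto simp: b0)
    finally show ?thesis by (simp add: w_def It)
  qed (simp add: w_def)
  have intIB: "integrable lborel (\<lambda>t. I t * B)"
    by (rule integrable_bounded_support[where K=B and R="1/2"]) (auto simp: I_def indicator_def B0)
  \<comment> \<open>unfold the periodisation: the unit cells around the integers in \<open>[-K, K]\<close> tile one interval\<close>
  have coeff: "(\<integral>t. (I t *\<^sub>R u t) * cis (- (2 * pi * of_int m * t)) \<partial>lborel) = ft v (2 * pi * of_int m)" for m
  proof (rule LIMSEQ_unique)
    show "(\<lambda>K. \<integral>t. w K t * cis (- (2 * pi * of_int m * t)) \<partial>lborel)
          \<longlonglongrightarrow> (\<integral>t. (I t *\<^sub>R u t) * cis (- (2 * pi * of_int m * t)) \<partial>lborel)"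
    proof (rule integral_dominated_convergence[OF _ _ intIB])
      show "AE t in lborel. norm (w K t * cis (- (2 * pi * of_int m * t))) \<le> I t * B" for K
        using wB by (auto simp: norm_mult)
      show "AE t in lborel. (\<lambda>K. w K t * cis (- (2 * pi * of_int m * t))) \<longlonglongrightarrow> (I t *\<^sub>R u t) * cis (- (2 * pi * of_int m * t))"
        by (intro AE_I2 tendsto_mult tendsto_const wlim)
    qed measurable
    have eq: "(\<integral>t. w K t * cis (- (2 * pi * of_int m * t)) \<partial>lborel)
          = (\<integral>x. indicator {- real K - 1/2..<real K + 1/2} x *\<^sub>R (v x * cis (- (2 * pi * of_int m * x))) \<partial>lborel)" for K
    proof -
      let ?h = "\<lambda>n x. I (x - of_int n) *\<^sub>R (v x * cis (- (2 * pi * of_int m * x)))"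
      have vi: "integrable lborel (\<lambda>x. v x * cis (- (2 * pi * of_int m * x)))"
        using integrable_mult_cis[OF v, of "- (2 * pi * of_int m)"] by simp
      have hi: "integrable lborel (?h n)" for n :: int
        by (rule Bochner_Integration.integrable_bound[OF vi]) (auto simp: I_def indicator_def)
      have shift: "?h n (of_int n + 1 * t) = I t *\<^sub>R (v (of_int n + t) * cis (- (2 * pi * of_int m * t)))" for n :: int and t
      proof -
        have "cis (- (2 * pi * of_int m * (of_int n + t))) = cis (2 * pi * of_int (- (m * n))) * cis (- (2 * pi * of_int m * t))"
          unfolding cis_mult by (simp add: algebra_simps)
        then show ?thesis by (simp only: cis_int_mult_2pi) simp
      qed
      have hi': "integrable lborel (\<lambda>t. I t *\<^sub>R (v (of_int n + t) * cis (- (2 * pi * of_int m * t))))" for n :: int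
        using lborel_integrable_real_affine[OF hi[of n], of 1 "of_int n"] unfolding shift by simp
      have "(\<integral>t. w K t * cis (- (2 * pi * of_int m * t)) \<partial>lborel)
            = (\<integral>t. (\<Sum>n\<in>{-int K..int K}. I t *\<^sub>R (v (of_int n + t) * cis (- (2 * pi * of_int m * t)))) \<partial>lborel)"
        by (simp add: w_def scaleR_sum_right sum_distrib_right)
      also have "\<dots> = (\<Sum>n\<in>{-int K..int K}. \<integral>t. I t *\<^sub>R (v (of_int n + t) * cis (- (2 * pi * of_int m * t))) \<partial>lborel)"
        by (rule Bochner_Integration.integral_sum[OF hi'])
      also have "\<dots> = (\<Sum>n\<in>{-int K..int K}. \<integral>x. ?h n x \<partial>lborel)"
      proof (intro sum.cong refl)
        fix n :: int
        show "(\<integral>t. I t *\<^sub>R (v (of_int n + t) * cis (- (2 * pi * of_int m * t))) \<partial>lborel) = (\<integral>x. ?h n x \<partial>lborel)"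
          using lborel_integral_real_affine[of 1 "?h n" "of_int n"] unfolding shift by simp
      qed
      also have "\<dots> = (\<integral>x. (\<Sum>n\<in>{-int K..int K}. ?h n x) \<partial>lborel)"
        by (rule Bochner_Integration.integral_sum[OF hi, symmetric])
      also have "(\<lambda>x. \<Sum>n\<in>{-int K..int K}. ?h n x) = (\<lambda>x. indicator {- real K - 1/2..<real K + 1/2} x *\<^sub>R (v x * cis (- (2 * pi * of_int m * x))))"
        unfolding I_def by (simp only: sum_unit_cells scaleR_sum_left[symmetric])
      finally show ?thesis .
    qed
    show "(\<lambda>K. \<integral>t. w K t * cis (- (2 * pi * of_int m * t)) \<partial>lborel) \<longlonglongrightarrow> ft v (2 * pi * of_int m)"
      unfolding eq ft_def
    proof (rule integral_dominated_convergence[OF _ _ integrable_norm[OF v]])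
      show "AE x in lborel. (\<lambda>K. indicator {- real K - 1/2..<real K + 1/2} x *\<^sub>R (v x * cis (- (2 * pi * of_int m * x))))
              \<longlonglongrightarrow> v x * cis (- (2 * pi * of_int m * x))"
      proof (rule AE_I2, rule tendsto_eventually)
        fix x :: real
        obtain k0 where k0: "\<bar>x\<bar> \<le> real k0" using real_arch_simple by blast
        show "\<forall>\<^sub>F K in sequentially. indicator {- real K - 1/2..<real K + 1/2} x *\<^sub>R (v x * cis (- (2 * pi * of_int m * x)))
              = v x * cis (- (2 * pi * of_int m * x))"
          using eventually_ge_at_top[of k0]
        proof eventually_elim
          case (elim K)
          then have "\<bar>x\<bar> \<le> real K" using k0 by linarith
          then show ?case by (auto simp: indicator_def)
        qed
      qed
      show "AE x in lborel. norm (indicator {- real K - 1/2..<real K + 1/2} x *\<^sub>R (v x * cis (- (2 * pi * of_int m * x)))) \<le> norm (v x)" for K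
        by (auto simp: indicator_def norm_mult)
    qed measurable
  qed
  define D where "D = (\<lambda>t. (I t *\<^sub>R u t - I t *\<^sub>R u 0) / (cis (2 * pi * t) - 1))"
  have [measurable]: "D \<in> borel_measurable borel" unfolding D_def by measurable
  have Dbd: "norm (D t) \<le> B" for t
  proof (cases "I t = 0 \<or> t = 0")
    case False
    then have t: "\<bar>t\<bar> \<le> 1/2" "t \<noteq> 0" and It: "I t = 1"
      using I_half by (auto simp: I_def indicator_def split: if_splits)
    have "norm (D t) \<le> (B * \<bar>t\<bar>) / \<bar>t\<bar>"
      unfolding D_def norm_divide It using norm_cis_2pi_minus_1_ge[OF t(1)] ulip[OF t(1)] t(2) B0
      by (intro frac_le) auto
    then show ?thesis using t by simp
  qed (auto simp: D_def B0)
  have Dsupp: "D t = 0" if "t \<notin> {-(1/2)..<1/2}" for t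
    using that by (auto simp: D_def I_def indicator_def)
  have D1: "integrable lborel D"
    by (rule integrable_bounded_support[OF _ Dbd, where R="1/2"]) (auto intro!: Dsupp)
  have D2: "finite_energy D"
    by (rule integrable_bounded_support[where K="B\<^sup>2" and R="1/2"])
       (auto intro!: power_mono Dbd Dsupp)
  define d where "d = (\<lambda>m::int. ft D (2 * pi * of_int m))"
  have bessel: "(\<Sum>n\<in>F. (norm (d n))\<^sup>2) \<le> energy D" if "finite F" for F
    using Bessel_inequality[of D "1/2" F] D2 Dsupp that by (simp add: d_def mult_ac)
  have d0: "(\<lambda>M. d (\<sigma> M)) \<longlonglongrightarrow> 0" if "inj \<sigma>" for \<sigma> :: "nat \<Rightarrow> int"
  proof -
    have "summable (\<lambda>M. (norm (d (\<sigma> M)))\<^sup>2)"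
    proof (rule summableI_nonneg_bounded)
      fix k
      have "(\<Sum>i<k. (norm (d (\<sigma> i)))\<^sup>2) = (\<Sum>n\<in>\<sigma> ` {..<k}. (norm (d n))\<^sup>2)"
        by (subst sum.reindex) (auto intro: inj_on_subset[OF that])
      also have "\<dots> \<le> energy D" by (rule bessel) simp
      finally show "(\<Sum>i<k. (norm (d (\<sigma> i)))\<^sup>2) \<le> energy D" .
    qed simp
    then have "(\<lambda>M. (norm (d (\<sigma> M)))\<^sup>2) \<longlonglongrightarrow> 0" by (rule summable_LIMSEQ_zero)
    then have "(\<lambda>M. sqrt ((norm (d (\<sigma> M)))\<^sup>2)) \<longlonglongrightarrow> sqrt 0" by (rule tendsto_real_sqrt)
    then have "(\<lambda>M. norm (d (\<sigma> M))) \<longlonglongrightarrow> 0" by simp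
    then show ?thesis by (rule tendsto_norm_zero_cancel)
  qed
  \<comment> \<open>the Dirichlet kernel telescopes after multiplication by its denominator\<close>
  have partial: "(\<Sum>m\<in>{-int M..int M}. ft v (2 * pi * of_int m)) = u 0 + d (- int (Suc M)) - d (int M)" for M
  proof -
    let ?e = "\<lambda>m t. cis (- (2 * pi * of_int m * t))"
    have ui: "integrable lborel (\<lambda>t. I t *\<^sub>R u t)"
    proof (rule integrable_norm_le[OF intIB])
      show "norm (I t *\<^sub>R u t) \<le> I t * B" for t
        by (rule LIMSEQ_le_const2[OF tendsto_norm[OF wlim]]) (use wB in blast)
    qed simp
    have i1: "integrable lborel (\<lambda>t. (I t *\<^sub>R u t) * ?e m t)" for m :: int
      using integrable_mult_cis[OF ui, of "- (2 * pi * of_int m)"] by simp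
    have i2: "integrable lborel (\<lambda>t. u 0 * (I t *\<^sub>R ?e m t))" for m :: int
      by (intro integrable_mult_right, rule integrable_bounded_support[where K=1 and R="1/2"])
         (auto simp: I_def indicator_def)
    have mode: "(\<integral>t. I t *\<^sub>R ?e m t \<partial>lborel) = (if m = 0 then 1 else 0)" for m :: int
      using integral_Fourier_mode[of "1/2" "-m"] by (simp add: I_def mult_ac)
    have "(\<Sum>m\<in>{-int M..int M}. ft v (2 * pi * of_int m)) - u 0
          = (\<Sum>m\<in>{-int M..int M}. (\<integral>t. (I t *\<^sub>R u t) * ?e m t \<partial>lborel) - (\<integral>t. u 0 * (I t *\<^sub>R ?e m t) \<partial>lborel))"
      by (simp only: sum_subtractf coeff integral_mult_right_zero mode sum_distrib_left[symmetric]) simp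
    also have "\<dots> = (\<integral>t. (\<Sum>m\<in>{-int M..int M}. (I t *\<^sub>R u t) * ?e m t - u 0 * (I t *\<^sub>R ?e m t)) \<partial>lborel)"
      using i1 i2 by (subst Bochner_Integration.integral_sum) auto
    also have "\<dots> = (\<integral>t. D t * ?e (- int (Suc M)) t - D t * ?e (int M) t \<partial>lborel)"
    proof (intro Bochner_Integration.integral_cong refl)
      fix t
      have "(\<Sum>m\<in>{-int M..int M}. (I t *\<^sub>R u t) * ?e m t - u 0 * (I t *\<^sub>R ?e m t))
            = (I t *\<^sub>R u t - I t *\<^sub>R u 0) * (\<Sum>m\<in>{-int M..int M}. ?e m t)"
        by (simp add: sum_distrib_left scaleR_conv_of_real algebra_simps)
      also have "I t *\<^sub>R u t - I t *\<^sub>R u 0 = D t * (cis (2 * pi * t) - 1)"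
      proof (cases "I t = 0 \<or> t = 0")
        case False
        then have "norm (cis (2 * pi * t) - 1) > 0"
          using norm_cis_2pi_minus_1_ge[OF I_half, of t] by linarith
        then show ?thesis by (auto simp: D_def)
      qed (auto simp: D_def)
      also have "D t * (cis (2 * pi * t) - 1) * (\<Sum>m\<in>{-int M..int M}. ?e m t)
                 = D t * ((cis (2 * pi * t) - 1) * (\<Sum>m\<in>{-int M..int M}. cis (- (2 * pi * t * of_int m))))"
        by (simp add: mult_ac)
      also have "\<dots> = D t * ?e (- int (Suc M)) t - D t * ?e (int M) t"
        unfolding dirichlet_telescope by (simp add: algebra_simps)
      finally show "(\<Sum>m\<in>{-int M..int M}. (I t *\<^sub>R u t) * ?e m t - u 0 * (I t *\<^sub>R ?e m t))
                    = D t * ?e (- int (Suc M)) t - D t * ?e (int M) t" .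
    qed
    also have "\<dots> = d (- int (Suc M)) - d (int M)"
    proof -
      have Di: "integrable lborel (\<lambda>t. D t * ?e m t)" for m :: int
        using integrable_mult_cis[OF D1, of "- (2 * pi * of_int m)"] by simp
      show ?thesis
        unfolding d_def ft_def by (rule Bochner_Integration.integral_diff[OF Di Di])
    qed
    finally show ?thesis by (simp add: algebra_simps)
  qed
  have "(\<lambda>M. u 0 + d (- int (Suc M)) - d (int M)) \<longlonglongrightarrow> u 0 + 0 - 0"
    by (intro tendsto_intros d0) (auto simp: inj_def)
  then show ?thesis unfolding partial by (simp add: u_def)
qed

section \<open>Sums of a modulated Gaussian over a grid\<close>

lemma summable_on_exp_neg_abs: "(\<lambda>n::int. exp (- \<bar>real_of_int n\<bar>)) summable_on UNIV"
proof (rule nonneg_bdd_above_summable_on)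
  \<comment> \<open>the slack \<open>4 e\<^bsup>-K\<^esup>\<close> absorbs the two new terms because \<open>e \<ge> 3/2\<close>\<close>
  have part: "(\<Sum>n\<in>{-int K..int K}. exp (- \<bar>real_of_int n\<bar>)) \<le> 5 - 4 * exp (- real K)" for K
  proof (induction K)
    case (Suc K)
    have "exp (- real (Suc K)) * (3/2) \<le> exp (- real (Suc K)) * exp 1"
      using exp_ge_add_one_self[of 1] by (intro mult_left_mono) auto
    also have "\<dots> = exp (- real K)" by (simp flip: exp_add)
    finally show ?case unfolding sum_int_symmetric_Suc using Suc by (simp add: algebra_simps)
  qed simp
  show "bdd_above (sum (\<lambda>n::int. exp (- \<bar>real_of_int n\<bar>)) ` {F. F \<subseteq> UNIV \<and> finite F})"
  proof (rule bdd_aboveI2)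
    fix F :: "int set" assume "F \<in> {F. F \<subseteq> UNIV \<and> finite F}"
    then have F: "finite F" by simp
    define K where "K = Max (insert 0 ((\<lambda>n. nat \<bar>n\<bar>) ` F))"
    have "nat \<bar>n\<bar> \<le> K" if "n \<in> F" for n
      unfolding K_def using F that by (intro Max_ge) auto
    then have "F \<subseteq> {-int K..int K}" by force
    then have "sum (\<lambda>n. exp (- \<bar>real_of_int n\<bar>)) F \<le> (\<Sum>n\<in>{-int K..int K}. exp (- \<bar>real_of_int n\<bar>))"
      by (intro sum_mono2) auto
    also have "\<dots> \<le> 5" using part[of K] by (smt (verit) exp_gt_zero)
    finally show "sum (\<lambda>n. exp (- \<bar>real_of_int n\<bar>)) F \<le> 5" .
  qed
qed simp

text \<open>The Gaussian \<open>e\<^bsup>-ax\<^sup>2\<^esup>\<close> carrying a wave of frequency \<open>-s\<close>. On the scale of the grid, \<open>a = (\<epsilon>h)\<^sup>2\<close> and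
\<open>s = \<omega>h\<close>.\<close>

definition gwave :: "real \<Rightarrow> real \<Rightarrow> real \<Rightarrow> complex" where
  "gwave a s x = of_real (exp (- (a * x\<^sup>2))) * cis (- (s * x))"

text \<open>A common summable majorant for the wave and its derivative on the unit cell around \<open>n\<close>. It suffices that
\<open>a X\<^sup>2 \<ge> 2X - 1/a\<close> and \<open>X \<le> e\<^sup>X\<close>, so no extremum has to be located.\<close>

lemma gaussian_moment_decay:
  assumes a: "a > 0" and t: "\<bar>t\<bar> \<le> 1/2"
  shows "(2 * a * \<bar>y + (of_int n + t)\<bar> + \<bar>s\<bar> + 1) * exp (- (a * (y + (of_int n + t))\<^sup>2))
         \<le> (2 * a + \<bar>s\<bar> + 1) * exp (1/a + \<bar>y\<bar> + 1/2) * exp (- \<bar>real_of_int n\<bar>)"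
proof -
  define X where "X = \<bar>y + (of_int n + t)\<bar>"
  have X0: "X \<ge> 0" by (simp add: X_def)
  have Xn: "X \<ge> \<bar>real_of_int n\<bar> - \<bar>y\<bar> - 1/2" using t unfolding X_def by linarith
  have sq: "2 * X - a * X\<^sup>2 \<le> 1 / a"
  proof -
    have "0 \<le> (a * X - 1)\<^sup>2 / a" using a by simp
    also have "\<dots> = a * X\<^sup>2 - 2 * X + 1 / a" using a by (simp add: power2_eq_square field_simps)
    finally show ?thesis by linarith
  qed
  have eX: "X \<le> exp X" "1 \<le> exp X" using X0 exp_ge_add_one_self[of X] by linarith+
  have "2 * a * X \<le> 2 * a * exp X" using a eX by (intro mult_left_mono) auto
  moreover have "\<bar>s\<bar> * 1 \<le> \<bar>s\<bar> * exp X" using eX by (intro mult_left_mono) auto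
  ultimately have "2 * a * X + \<bar>s\<bar> + 1 \<le> (2 * a + \<bar>s\<bar> + 1) * exp X"
    using eX unfolding distrib_right by linarith
  then have "(2 * a * X + \<bar>s\<bar> + 1) * exp (- (a * X\<^sup>2)) \<le> (2 * a + \<bar>s\<bar> + 1) * exp X * exp (- (a * X\<^sup>2))"
    by (rule mult_right_mono) simp
  also have "\<dots> = (2 * a + \<bar>s\<bar> + 1) * exp (X - a * X\<^sup>2)"
    by (simp add: mult.assoc flip: exp_add)
  also have "\<dots> \<le> (2 * a + \<bar>s\<bar> + 1) * exp (1/a + \<bar>y\<bar> + 1/2 - \<bar>real_of_int n\<bar>)"
    using sq Xn a by (intro mult_left_mono) auto
  also have "\<dots> = (2 * a + \<bar>s\<bar> + 1) * exp (1/a + \<bar>y\<bar> + 1/2) * exp (- \<bar>real_of_int n\<bar>)"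
    by (simp add: mult.assoc flip: exp_add)
  finally show ?thesis by (simp add: X_def)
qed

lemma norm_gwave [simp]: "norm (gwave a s x) = exp (- (a * x\<^sup>2))"
  by (simp add: gwave_def norm_mult)

lemma gwave_measurable [measurable]: "gwave a s \<in> borel_measurable borel"
  unfolding gwave_def by measurable

lemma gwave_deriv:
  "(gwave a s has_vector_derivative - (2 * a * x + \<i> * s) * gwave a s x) (at x within S)"
proof -
  have e: "gwave a s = (\<lambda>x. exp (- (complex_of_real a * (complex_of_real x)\<^sup>2) - \<i> * (complex_of_real s * complex_of_real x)))"
    by (simp add: gwave_def fun_eq_iff cis_conv_exp exp_add[symmetric] exp_of_real[symmetric])
  show ?thesis unfolding e
    by (rule has_vector_derivative_real_field)
       (auto intro!: derivative_eq_intros simp: algebra_simps)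
qed

lemma gwave_lipschitz:
  assumes a: "a > 0" and t: "\<bar>t\<bar> \<le> 1/2"
  shows "norm (gwave a s (y + (of_int n + t)) - gwave a s (y + of_int n))
         \<le> (2 * a + \<bar>s\<bar> + 1) * exp (1/a + \<bar>y\<bar> + 1/2) * exp (- \<bar>real_of_int n\<bar>) * \<bar>t\<bar>"
proof -
  let ?C = "(2 * a + \<bar>s\<bar> + 1) * exp (1/a + \<bar>y\<bar> + 1/2) * exp (- \<bar>real_of_int n\<bar>)"
  let ?S = "{y + of_int n - 1/2..y + of_int n + 1/2}"
  have "norm (gwave a s (y + (of_int n + t)) - gwave a s (y + of_int n)) \<le> ?C * norm ((y + (of_int n + t)) - (y + of_int n))"
  proof (rule differentiable_bound)
    show "(gwave a s has_derivative (\<lambda>h. h *\<^sub>R (- (2 * a * x + \<i> * s) * gwave a s x))) (at x within ?S)" for x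
      using gwave_deriv[of a s x ?S] by (simp add: has_vector_derivative_def)
    fix x assume x: "x \<in> ?S"
    define t' where "t' = x - y - of_int n"
    have t': "\<bar>t'\<bar> \<le> 1/2" and xt: "x = y + (of_int n + t')" 
      using x unfolding atLeastAtMost_iff t'_def abs_le_iff by linarith+
    have "norm (2 * a * x + \<i> * s) \<le> norm (2 * complex_of_real a * x) + norm (\<i> * complex_of_real s)"
      using norm_triangle_ineq[of "2 * complex_of_real a * x" "\<i> * complex_of_real s"] by simp
    also have "\<dots> \<le> 2 * a * \<bar>x\<bar> + \<bar>s\<bar> + 1" using a by (simp add: norm_mult)
    finally have "norm (- (2 * a * x + \<i> * s) * gwave a s x) \<le> (2 * a * \<bar>x\<bar> + \<bar>s\<bar> + 1) * exp (- (a * x\<^sup>2))"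
      unfolding norm_mult norm_minus_cancel norm_gwave by (rule mult_right_mono) simp
    also have "\<dots> \<le> ?C" using gaussian_moment_decay[OF a t', of y n s] unfolding xt .
    finally have D: "norm (- (2 * a * x + \<i> * s) * gwave a s x) \<le> ?C" .
    show "onorm (\<lambda>h. h *\<^sub>R (- (2 * a * x + \<i> * s) * gwave a s x)) \<le> ?C"
    proof (rule onorm_bound)
      show "0 \<le> ?C" using order_trans[OF norm_ge_zero D] .
      show "norm (h *\<^sub>R (- (2 * a * x + \<i> * s) * gwave a s x)) \<le> ?C * norm h" for h
        unfolding norm_scaleR real_norm_def mult.commute[of "\<bar>h\<bar>"]
        by (rule mult_right_mono[OF D abs_ge_zero])
    qed
  qed (use t in \<open>auto simp: abs_le_iff\<close>)
  then show ?thesis by simp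
qed

lemma ft_gwave:
  assumes a: "a > 0"
  shows "ft (\<lambda>t. gwave a s (y + t)) \<xi> = cis (\<xi> * y) * of_real (sqrt (pi / a) * exp (- (s + \<xi>)\<^sup>2 / (4 * a)))"
proof -
  define b where "b = sqrt (2 * a)"
  have b: "b > 0" and b2: "b\<^sup>2 = 2 * a" using a by (auto simp: b_def)
  have "ft (\<lambda>t. gwave a s (y + t)) \<xi> = (\<integral>x. gwave a s x * cis (- (\<xi> * (x - y))) \<partial>lborel)"
    unfolding ft_def
    using lborel_integral_real_affine[of 1 "\<lambda>x. gwave a s x * cis (- (\<xi> * (x - y)))" y] by simp
  also have "\<dots> = (\<integral>x. cis (\<xi> * y) * (of_real (exp (- (b * x)\<^sup>2 / 2)) * cis (- ((s + \<xi>) * x))) \<partial>lborel)"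
  proof (intro Bochner_Integration.integral_cong refl)
    fix x
    have "cis (- (s * x)) * cis (- (\<xi> * (x - y))) = cis (\<xi> * y) * cis (- ((s + \<xi>) * x))"
      by (simp add: cis_mult algebra_simps)
    then show "gwave a s x * cis (- (\<xi> * (x - y))) = cis (\<xi> * y) * (of_real (exp (- (b * x)\<^sup>2 / 2)) * cis (- ((s + \<xi>) * x)))"
      by (simp add: gwave_def b2 power_mult_distrib mult_ac)
  qed
  also have "\<dots> = cis (\<xi> * y) * ft (\<lambda>x. of_real (exp (- (b * x)\<^sup>2 / 2))) (s + \<xi>)"
    unfolding ft_def by (rule integral_mult_right_zero)
  also have "\<dots> = cis (\<xi> * y) * of_real (sqrt (2 * pi) / b * exp (- ((s + \<xi>) / b)\<^sup>2 / 2))"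
    by (simp only: ft_gaussian[OF b])
  also have "sqrt (2 * pi) / b * exp (- ((s + \<xi>) / b)\<^sup>2 / 2) = sqrt (pi / a) * exp (- (s + \<xi>)\<^sup>2 / (4 * a))"
  proof -
    have "sqrt (2 * pi) / b = sqrt (pi / a)" using a by (simp add: b_def real_sqrt_divide real_sqrt_mult)
    moreover have "- ((s + \<xi>) / b)\<^sup>2 / 2 = - (s + \<xi>)\<^sup>2 / (4 * a)" by (simp add: power_divide b2)
    ultimately show ?thesis by simp
  qed
  finally show ?thesis .
qed

lemma gwave_has_sum:
  assumes a: "a > 0"
  shows "((\<lambda>n. gwave a s (y + of_int n)) has_sum (\<Sum>\<^sub>\<infinity>n. gwave a s (y + of_int n))) UNIV"
    and "(\<lambda>n::int. exp (- (a * (y + of_int n)\<^sup>2))) summable_on UNIV"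
    and "(\<lambda>M. \<Sum>m\<in>{-int M..int M}. ft (\<lambda>t. gwave a s (y + t)) (2 * pi * of_int m))
         \<longlonglongrightarrow> (\<Sum>\<^sub>\<infinity>n. gwave a s (y + of_int n))"
proof -
  define b where "b = (\<lambda>n::int. (2 * a + \<bar>s\<bar> + 1) * exp (1/a + \<bar>y\<bar> + 1/2) * exp (- \<bar>real_of_int n\<bar>))"
  have b: "b summable_on UNIV" unfolding b_def by (intro summable_on_cmult_right summable_on_exp_neg_abs)
  have bd: "exp (- (a * (y + (of_int n + t))\<^sup>2)) \<le> b n" if "\<bar>t\<bar> \<le> 1/2" for n t
  proof -
    have "1 * exp (- (a * (y + (of_int n + t))\<^sup>2))
       \<le> (2 * a * \<bar>y + (of_int n + t)\<bar> + \<bar>s\<bar> + 1) * exp (- (a * (y + (of_int n + t))\<^sup>2))"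
      using a by (intro mult_right_mono) auto
    then show ?thesis using gaussian_moment_decay[OF a that, of y n s] unfolding b_def by linarith
  qed
  show sm: "(\<lambda>n::int. exp (- (a * (y + of_int n)\<^sup>2))) summable_on UNIV"
    by (rule summable_on_comparison_test[OF b]) (use bd[of 0] in auto)
  have "(\<lambda>n::int. norm (gwave a s (y + of_int n))) summable_on UNIV" using sm by simp
  from abs_summable_summable[OF this]
  show "((\<lambda>n. gwave a s (y + of_int n)) has_sum (\<Sum>\<^sub>\<infinity>n. gwave a s (y + of_int n))) UNIV"
    by (rule has_sum_infsum)
  have int: "integrable lborel (\<lambda>t. gwave a s (y + t))"
  proof -
    have "integrable lborel (\<lambda>x. exp (- (sqrt (2 * a) * (y + 1 * x))\<^sup>2 / 2))"
      using a by (intro lborel_integrable_real_affine[where f="\<lambda>x. exp (- (sqrt (2 * a) * x)\<^sup>2 / 2)"] integrable_gaussian) auto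
    then have "integrable lborel (\<lambda>x. exp (- (a * (y + x)\<^sup>2)))"
      using a by (simp add: power_mult_distrib)
    then show ?thesis by (rule Bochner_Integration.integrable_bound) auto
  qed
  show "(\<lambda>M. \<Sum>m\<in>{-int M..int M}. ft (\<lambda>t. gwave a s (y + t)) (2 * pi * of_int m))
         \<longlonglongrightarrow> (\<Sum>\<^sub>\<infinity>n. gwave a s (y + of_int n))"
    by (rule poisson_summation[OF int b]) (use bd gwave_lipschitz[OF a] in \<open>auto simp: b_def\<close>)
qed

text \<open>The sum over the grid is the integral \<open>\<kappa>\<close>, which is the term \<open>m = 0\<close> of the Poisson sum, up to the aliases \<open>m \<noteq> 0\<close>.
For \<open>|m| = j\<close> an alias is at most \<open>\<kappa>\<close> times \<open>exp (- (\<pi>\<^sup>2/a) (j\<^sup>2 - j\<theta>))\<close>, and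
\<open>j\<^sup>2 - j\<theta> \<ge> (1 - \<theta>) + (j - 1)\<close> reduces the sum over \<open>m\<close> to a geometric series. The condition \<open>4a \<le> \<pi>\<^sup>2\<close>
bounds its ratio by 1/3, whence the constant 3.\<close>

lemma gaussian_quadrature:
  assumes a: "a > 0" "4 * a \<le> pi\<^sup>2" and s: "\<bar>s\<bar> \<le> pi * \<theta>" and \<theta>: "0 \<le> \<theta>" "\<theta> \<le> 1"
  defines "\<kappa> \<equiv> sqrt (pi / a) * exp (- s\<^sup>2 / (4 * a))"
  shows "norm ((\<Sum>\<^sub>\<infinity>n. gwave a s (y + of_int n)) - of_real \<kappa>) \<le> \<kappa> * (3 * exp (- (pi\<^sup>2 / a * (1 - \<theta>))))"
proof -
  define q where "q = exp (- (pi\<^sup>2 / a * (1 - \<theta>)))"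
  define r where "r = exp (- (pi\<^sup>2 / a))"
  define F where "F = (\<lambda>m::int. ft (\<lambda>t. gwave a s (y + t)) (2 * pi * of_int m))"
  have \<kappa>0: "\<kappa> \<ge> 0" unfolding \<kappa>_def using a by simp
  have r3: "r \<le> 1/3"
  proof -
    have "4 \<le> pi\<^sup>2 / a" using a by (simp add: field_simps)
    then have "exp (pi\<^sup>2 / a) \<ge> 3" using exp_ge_add_one_self[of "pi\<^sup>2 / a"] by linarith
    then show ?thesis unfolding r_def exp_minus by (simp add: field_simps)
  qed
  have F0: "F 0 = of_real \<kappa>" unfolding F_def \<kappa>_def using ft_gwave[OF a(1), of s y 0] by simp
  have Fm: "norm (F m) \<le> \<kappa> * (q * r ^ k)" if m: "\<bar>m\<bar> = int (Suc k)" for m k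
  proof -
    define j where "j = real (Suc k)"
    have j: "\<bar>real_of_int m\<bar> = j" "j \<ge> 1" using m unfolding j_def by linarith+
    have "0 \<le> (j - 1) * (j - \<theta>)" using j \<theta> by (intro mult_nonneg_nonneg) auto
    then have 1: "(1 - \<theta>) + (j - 1) \<le> j\<^sup>2 - j * \<theta>" by (simp add: algebra_simps power2_eq_square)
    have "\<bar>of_int m * s\<bar> \<le> j * (pi * \<theta>)" unfolding abs_mult j(1) using j s by (intro mult_left_mono) auto
    then have "- (j * (pi * \<theta>)) \<le> of_int m * s" by linarith
    then have "pi * (- (j * (pi * \<theta>))) \<le> pi * (of_int m * s)" by (intro mult_left_mono) auto
    then have "pi\<^sup>2 * (j\<^sup>2 - j * \<theta>) \<le> pi * (of_int m * s) + pi\<^sup>2 * j\<^sup>2"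
      by (simp add: algebra_simps power2_eq_square)
    moreover have "pi\<^sup>2 * ((1 - \<theta>) + (j - 1)) \<le> pi\<^sup>2 * (j\<^sup>2 - j * \<theta>)" using 1 by (intro mult_left_mono) auto
    moreover have "(of_int m)\<^sup>2 = j\<^sup>2" using j(1) by (metis power2_abs)
    ultimately have 2: "4 * (pi\<^sup>2 * ((1 - \<theta>) + (j - 1))) \<le> (s + 2 * pi * of_int m)\<^sup>2 - s\<^sup>2"
      by (simp add: power2_sum power_mult_distrib algebra_simps)
    have "(s\<^sup>2 + 4 * (pi\<^sup>2 * ((1 - \<theta>) + (j - 1)))) / (4 * a) \<le> (s + 2 * pi * of_int m)\<^sup>2 / (4 * a)"
      using 2 a by (intro divide_right_mono) auto
    moreover have "(s\<^sup>2 + 4 * (pi\<^sup>2 * ((1 - \<theta>) + (j - 1)))) / (4 * a) = s\<^sup>2 / (4 * a) + pi\<^sup>2 / a * (1 - \<theta>) + real k * (pi\<^sup>2 / a)"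
      using a by (simp add: j_def field_simps)
    ultimately have "exp (- (s + 2 * pi * of_int m)\<^sup>2 / (4 * a))
        \<le> exp (- s\<^sup>2 / (4 * a) + - (pi\<^sup>2 / a * (1 - \<theta>)) + real k * - (pi\<^sup>2 / a))" by simp
    also have "\<dots> = exp (- s\<^sup>2 / (4 * a)) * (q * r ^ k)"
      unfolding exp_add exp_of_nat_mult q_def r_def by simp
    finally have "sqrt (pi / a) * exp (- (s + 2 * pi * of_int m)\<^sup>2 / (4 * a)) \<le> sqrt (pi / a) * (exp (- s\<^sup>2 / (4 * a)) * (q * r ^ k))"
      using a by (intro mult_left_mono) auto
    then show ?thesis unfolding F_def ft_gwave[OF a(1)] norm_mult norm_of_real using a
      by (simp add: \<kappa>_def abs_mult mult.assoc)
  qed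
  \<comment> \<open>the term \<open>3 r\<^sup>M\<close> makes the induction close when \<open>r \<le> 1/3\<close>\<close>
  have part: "norm ((\<Sum>m\<in>{-int M..int M}. F m) - of_real \<kappa>) \<le> \<kappa> * q * (3 - 3 * r ^ M)" for M
  proof (induction M)
    case 0 then show ?case by (simp add: F0)
  next
    case (Suc M)
    have "(\<Sum>m\<in>{-int (Suc M)..int (Suc M)}. F m) - of_real \<kappa>
          = F (int (Suc M)) + F (- int (Suc M)) + ((\<Sum>m\<in>{-int M..int M}. F m) - of_real \<kappa>)"
      unfolding sum_int_symmetric_Suc by simp
    then have "norm ((\<Sum>m\<in>{-int (Suc M)..int (Suc M)}. F m) - of_real \<kappa>)
          \<le> norm (F (int (Suc M))) + norm (F (- int (Suc M))) + norm ((\<Sum>m\<in>{-int M..int M}. F m) - of_real \<kappa>)"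
      by (metis add_right_mono norm_triangle_ineq norm_triangle_le)
    also have "\<dots> \<le> \<kappa> * (q * r ^ M) + \<kappa> * (q * r ^ M) + \<kappa> * q * (3 - 3 * r ^ M)"
      using Fm[of "int (Suc M)" M] Fm[of "- int (Suc M)" M] Suc by (intro add_mono) auto
    also have "\<dots> = \<kappa> * q * (3 - r ^ M)" by (simp add: algebra_simps)
    also have "\<dots> \<le> \<kappa> * q * (3 - 3 * r ^ Suc M)"
    proof -
      have "3 * r * r ^ M \<le> 1 * r ^ M" using r3 by (intro mult_right_mono) (auto simp: r_def)
      then show ?thesis using \<kappa>0 by (intro mult_left_mono) (auto simp: q_def)
    qed
    finally show ?case .
  qed
  have part': "norm ((\<Sum>m\<in>{-int M..int M}. F m) - of_real \<kappa>) \<le> \<kappa> * (3 * q)" for M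
  proof -
    have "\<kappa> * q * (3 - 3 * r ^ M) \<le> \<kappa> * q * 3"
      using \<kappa>0 by (intro mult_left_mono) (auto simp: r_def q_def)
    then show ?thesis using part[of M] by (simp add: mult_ac)
  qed
  have "(\<lambda>M. norm ((\<Sum>m\<in>{-int M..int M}. F m) - of_real \<kappa>)) \<longlonglongrightarrow> norm ((\<Sum>\<^sub>\<infinity>n. gwave a s (y + of_int n)) - of_real \<kappa>)"
    unfolding F_def by (intro tendsto_intros gwave_has_sum(3) a)
  then have "norm ((\<Sum>\<^sub>\<infinity>n. gwave a s (y + of_int n)) - of_real \<kappa>) \<le> \<kappa> * (3 * q)"
    by (rule LIMSEQ_le_const2) (use part' in blast)
  then show ?thesis by (simp add: q_def)
qed

text \<open>Comparison of a term with an integral: \<open>arctan\<close> telescopes, so a sum of such terms is at most \<open>\<pi>/2\<close> whatever \<open>b\<close> is.\<close>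

lemma arctan_step:
  assumes b: "b > 0" and j: "j \<ge> (0::real)"
  shows "b / (1 + (b * (j + 1))\<^sup>2) \<le> arctan (b * (j + 1)) - arctan (b * j)"
proof -
  have "\<exists>z. b * j < z \<and> z < b * (j + 1) \<and> arctan (b * (j + 1)) - arctan (b * j) = (b * (j + 1) - b * j) * inverse (1 + z\<^sup>2)"
    using b by (intro MVT2 DERIV_arctan) auto
  then obtain z where z: "b * j < z" "z < b * (j + 1)"
    and e: "arctan (b * (j + 1)) - arctan (b * j) = b * inverse (1 + z\<^sup>2)"
    by (auto simp: algebra_simps)
  have "0 \<le> z" using z b j by (smt (verit) mult_nonneg_nonneg)
  then have "z\<^sup>2 \<le> (b * (j + 1))\<^sup>2" using z by (intro power_mono) auto
  then have "inverse (1 + (b * (j + 1))\<^sup>2) \<le> inverse (1 + z\<^sup>2)"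
    by (intro le_imp_inverse_le) (auto intro: add_pos_nonneg)
  then show ?thesis unfolding e divide_inverse using b by (intro mult_left_mono) auto
qed

text \<open>A point \<open>x\<close> with \<open>|x| \<le> B\<close> is at distance at least \<open>(T - B) + jh\<close> from the \<open>j\<close>-th centre beyond the boundary \<open>T = Nh\<close>.
Splitting the square leaves the factor \<open>exp (- 2\<epsilon>\<^sup>2(T - B)\<^sup>2)\<close> and a Gaussian sum, which \<open>e\<^bsup>-2u\<^esup> \<le> 1/(1+u)\<close> and
\<open>arctan_step\<close> bound without assuming that \<open>\<epsilon>h\<close> is small.\<close>

lemma gaussian_tail_sum:
  fixes \<epsilon> h T B x :: real and N :: nat
  assumes e: "\<epsilon> > 0" and h: "h > 0" and T: "real N * h = T" and x: "\<bar>x\<bar> \<le> B" and B: "B \<le> T"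
  shows "(\<Sum>n\<in>{-int (N + j)..int (N + j)} - {-int N..int N}. \<epsilon> * exp (- (2 * \<epsilon>\<^sup>2 * (x - of_int n * h)\<^sup>2)))
         \<le> pi / h * exp (- (2 * \<epsilon>\<^sup>2 * (T - B)\<^sup>2))"
proof -
  define E where "E = exp (- (2 * \<epsilon>\<^sup>2 * (T - B)\<^sup>2))"
  define f where "f = (\<lambda>n::int. \<epsilon> * exp (- (2 * \<epsilon>\<^sup>2 * (x - of_int n * h)\<^sup>2)))"
  have cell: "f n \<le> E / h * (arctan (\<epsilon> * h * (real j + 1)) - arctan (\<epsilon> * h * real j))"
    if n: "\<bar>n\<bar> = int (N + Suc j)" for n j
  proof -
    have "\<bar>real_of_int n\<bar> = real N + (real j + 1)" using n by linarith
    then have "\<bar>of_int n * h\<bar> = T + (real j + 1) * h" using h T by (simp add: abs_mult algebra_simps)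
    then have ge: "(T - B) + (real j + 1) * h \<le> \<bar>x - of_int n * h\<bar>" using x by linarith
    have pos: "0 \<le> (T - B)" "0 \<le> (real j + 1) * h" using B h by auto
    have "(T - B)\<^sup>2 + ((real j + 1) * h)\<^sup>2 \<le> ((T - B) + (real j + 1) * h)\<^sup>2"
    proof -
      have "u\<^sup>2 + w\<^sup>2 \<le> (u + w)\<^sup>2" if "0 \<le> u" "0 \<le> w" for u w :: real
        using that by (simp add: power2_sum)
      then show ?thesis using pos .
    qed
    also have "\<dots> \<le> \<bar>x - of_int n * h\<bar>\<^sup>2" using ge pos by (intro power_mono) auto
    finally have "2 * \<epsilon>\<^sup>2 * ((T - B)\<^sup>2 + ((real j + 1) * h)\<^sup>2) \<le> 2 * \<epsilon>\<^sup>2 * (x - of_int n * h)\<^sup>2"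
      by (intro mult_left_mono) auto
    then have "exp (- (2 * \<epsilon>\<^sup>2 * (x - of_int n * h)\<^sup>2)) \<le> exp (- (2 * \<epsilon>\<^sup>2 * (T - B)\<^sup>2) + - (2 * (\<epsilon> * h * (real j + 1))\<^sup>2))"
    proof -
      have "2 * \<epsilon>\<^sup>2 * ((T - B)\<^sup>2 + ((real j + 1) * h)\<^sup>2) = 2 * \<epsilon>\<^sup>2 * (T - B)\<^sup>2 + 2 * (\<epsilon> * h * (real j + 1))\<^sup>2"
        unfolding distrib_left[of "2 * \<epsilon>\<^sup>2"] power_mult_distrib by simp
      then show ?thesis
        using \<open>2 * \<epsilon>\<^sup>2 * ((T - B)\<^sup>2 + ((real j + 1) * h)\<^sup>2) \<le> _\<close> by simp
    qed
    also have "\<dots> = E * exp (- (2 * (\<epsilon> * h * (real j + 1))\<^sup>2))" unfolding exp_add E_def ..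
    also have "\<dots> \<le> E * (1 / (1 + (\<epsilon> * h * (real j + 1))\<^sup>2))"
    proof (rule mult_left_mono)
      have "1 + (\<epsilon> * h * (real j + 1))\<^sup>2 \<le> exp (2 * (\<epsilon> * h * (real j + 1))\<^sup>2)"
        using exp_ge_add_one_self[of "2 * (\<epsilon> * h * (real j + 1))\<^sup>2"] zero_le_power2[of "\<epsilon> * h * (real j + 1)"] by linarith
      moreover have "0 < 1 + (\<epsilon> * h * (real j + 1))\<^sup>2" by (intro add_pos_nonneg) auto
      ultimately show "exp (- (2 * (\<epsilon> * h * (real j + 1))\<^sup>2)) \<le> 1 / (1 + (\<epsilon> * h * (real j + 1))\<^sup>2)"
        unfolding exp_minus inverse_eq_divide by (intro divide_left_mono) auto
    qed (simp add: E_def)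
    finally have "f n \<le> \<epsilon> * (E * (1 / (1 + (\<epsilon> * h * (real j + 1))\<^sup>2)))"
      unfolding f_def by (rule mult_left_mono) (use e in simp)
    also have "\<dots> = E / h * (\<epsilon> * h / (1 + (\<epsilon> * h * (real j + 1))\<^sup>2))" using h by simp
    also have "\<dots> \<le> E / h * (arctan (\<epsilon> * h * (real j + 1)) - arctan (\<epsilon> * h * real j))"
      using arctan_step[of "\<epsilon> * h" "real j"] e h by (intro mult_left_mono) (auto simp: E_def)
    finally show ?thesis .
  qed
  have "(\<Sum>n\<in>{-int (N + j)..int (N + j)} - {-int N..int N}. f n) \<le> 2 * (E / h) * arctan (\<epsilon> * h * real j)" for j
  proof (induction j)
    case 0 then show ?case by simp
  next
    case (Suc j)
    have "{-int (N + Suc j)..int (N + Suc j)} - {-int N..int N}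
          = insert (int (N + Suc j)) (insert (- int (N + Suc j)) ({-int (N + j)..int (N + j)} - {-int N..int N}))"
      by auto
    then have "(\<Sum>n\<in>{-int (N + Suc j)..int (N + Suc j)} - {-int N..int N}. f n)
       = f (int (N + Suc j)) + (f (- int (N + Suc j)) + (\<Sum>n\<in>{-int (N + j)..int (N + j)} - {-int N..int N}. f n))"
      by (simp only:) (subst sum.insert, auto)+
    also have "\<dots> \<le> E / h * (arctan (\<epsilon> * h * (real j + 1)) - arctan (\<epsilon> * h * real j))
       + (E / h * (arctan (\<epsilon> * h * (real j + 1)) - arctan (\<epsilon> * h * real j)) + 2 * (E / h) * arctan (\<epsilon> * h * real j))"
      using Suc by (intro add_mono cell) auto
    also have "\<dots> = 2 * (E / h) * arctan (\<epsilon> * h * real (Suc j))" by (simp add: algebra_simps)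
    finally show ?case .
  qed
  also have "2 * (E / h) * arctan (\<epsilon> * h * real j) \<le> 2 * (E / h) * (pi / 2)"
    using arctan_ubound[of "\<epsilon> * h * real j"] h by (intro mult_left_mono) (auto simp: E_def)
  finally show ?thesis by (simp add: f_def E_def mult_ac)
qed

section \<open>Band-limited functions as sums of Gaussians\<close>

text \<open>The coefficients come from replacing each wave \<open>e\<^bsup>i\<omega>x\<^esup>\<close> in \<open>lowpass W G\<close> by
\<open>(\<epsilon>h/\<surd>\<pi>) e\<^bsup>\<omega>\<^sup>2/(4\<epsilon>\<^sup>2)\<^esup> \<Sum>n. e\<^bsup>i\<omega>nh\<^esup> \<phi>(\<epsilon>(x - nh))\<close>. The factor \<open>\<surd>\<epsilon>\<close> of the synthesis operator leaves
\<open>h\<surd>\<epsilon>\<close>, and \<open>2\<pi>\<close> is the normalisation of the inverse transform.\<close>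

definition frame_coeff :: "real \<Rightarrow> real \<Rightarrow> real \<Rightarrow> (real \<Rightarrow> complex) \<Rightarrow> int \<Rightarrow> complex" where
  "frame_coeff h \<epsilon> W G n =
     of_real (h * sqrt \<epsilon> / (2 * pi * sqrt pi)) *
     ft (\<lambda>\<omega>. indicator {-W..W} \<omega> * G \<omega> * of_real (exp (\<omega>\<^sup>2 / (4 * \<epsilon>\<^sup>2)))) (- (of_int n * h))"

abbreviation frame_sum :: "real \<Rightarrow> real \<Rightarrow> real \<Rightarrow> (real \<Rightarrow> complex) \<Rightarrow> nat \<Rightarrow> real \<Rightarrow> complex" where
  "frame_sum h \<epsilon> W G M x \<equiv>
     (\<Sum>n\<in>{-int M..int M}. frame_coeff h \<epsilon> W G n * of_real (sqrt \<epsilon> * gauss_rbf (\<epsilon> * (x - of_int n * h))))"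

text \<open>Since \<open>W < \<pi>/h\<close>, the numbers \<open>frame_coeff h \<epsilon> W G n\<close> are Fourier coefficients of a function on one period
\<open>[-\<pi>/h, \<pi>/h]\<close> of the grid, and Bessel's inequality applies. The exponential is the square of the largest
weight \<open>e\<^bsup>\<omega>\<^sup>2/(4\<epsilon>\<^sup>2)\<^esup>\<close> on the band.\<close>

lemma frame_coeff_square_sum:
  assumes [measurable]: "G \<in> borel_measurable borel" and G2: "finite_energy G"
    and h: "h > 0" and e: "\<epsilon> > 0" and W: "W \<ge> 0" "W < pi / h" and F: "finite F"
  shows "(\<Sum>n\<in>F. (norm (frame_coeff h \<epsilon> W G n))\<^sup>2)
         \<le> h * \<epsilon> * exp (W\<^sup>2 / (2 * \<epsilon>\<^sup>2)) * energy G"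
proof -
  define H where "H = (\<lambda>\<omega>. indicator {-W..W} \<omega> * G \<omega> * of_real (exp (\<omega>\<^sup>2 / (4 * \<epsilon>\<^sup>2))))"
  have [measurable]: "H \<in> borel_measurable borel" unfolding H_def by measurable
  let ?E = "exp (W\<^sup>2 / (2 * \<epsilon>\<^sup>2))"
  have HG: "(norm (H \<omega>))\<^sup>2 \<le> ?E * (norm (G \<omega>))\<^sup>2" for \<omega>
  proof (cases "\<bar>\<omega>\<bar> \<le> W")
    case True
    then have "\<omega>\<^sup>2 \<le> W\<^sup>2" using W by (simp add: abs_le_square_iff[symmetric])
    then have "\<omega>\<^sup>2 / (2 * \<epsilon>\<^sup>2) \<le> W\<^sup>2 / (2 * \<epsilon>\<^sup>2)" by (rule divide_right_mono) simp
    moreover have "(norm (H \<omega>))\<^sup>2 = exp (\<omega>\<^sup>2 / (2 * \<epsilon>\<^sup>2)) * (norm (G \<omega>))\<^sup>2"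
      using True by (simp add: H_def norm_mult power_mult_distrib abs_le_iff flip: exp_of_nat_mult)
    ultimately show ?thesis by (auto intro!: mult_right_mono)
  next
    case False
    then have "H \<omega> = 0" by (auto simp: H_def indicator_def abs_le_iff)
    then show ?thesis by simp
  qed
  have H2: "finite_energy H"
  proof (rule Bochner_Integration.integrable_bound)
    show "integrable lborel (\<lambda>\<omega>. ?E * (norm (G \<omega>))\<^sup>2)" using G2 by simp
  qed (use HG in auto)
  have "(\<Sum>n\<in>uminus ` F. (norm (ft H (pi * of_int n / (pi / h))))\<^sup>2) \<le> 2 * (pi / h) * energy H"
    by (rule Bessel_inequality[OF _ H2]) (use W h F in \<open>auto simp: H_def indicator_def\<close>)
  also have "(\<Sum>n\<in>uminus ` F. (norm (ft H (pi * of_int n / (pi / h))))\<^sup>2) = (\<Sum>n\<in>F. (norm (ft H (- (of_int n * h))))\<^sup>2)"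
    by (subst sum.reindex) auto
  also have "2 * (pi / h) * energy H \<le> 2 * (pi / h) * (\<integral>x. ?E * (norm (G x))\<^sup>2 \<partial>lborel)"
    using G2 h by (intro mult_left_mono integral_mono H2 HG) auto
  finally have b: "(\<Sum>n\<in>F. (norm (ft H (- (of_int n * h))))\<^sup>2) \<le> 2 * (pi / h) * (?E * energy G)"
    using h by simp
  define I where "I = ?E * energy G"
  have I0: "I \<ge> 0" by (simp add: I_def)
  define c where "c = h * sqrt \<epsilon> / (2 * pi * sqrt pi)"
  have c2: "c\<^sup>2 = h\<^sup>2 * \<epsilon> / (4 * pi\<^sup>2 * pi)" using e by (simp add: c_def power_divide power_mult_distrib)
  have "(\<Sum>n\<in>F. (norm (frame_coeff h \<epsilon> W G n))\<^sup>2) = c\<^sup>2 * (\<Sum>n\<in>F. (norm (ft H (- (of_int n * h))))\<^sup>2)"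
    unfolding frame_coeff_def H_def[symmetric] c_def[symmetric]
    by (simp add: norm_mult power_mult_distrib sum_distrib_left)
  also have "\<dots> \<le> c\<^sup>2 * (2 * (pi / h) * I)" using b unfolding I_def by (intro mult_left_mono) auto
  also have "\<dots> = h * \<epsilon> * I / (2 * pi\<^sup>2)" unfolding c2 using h by (simp add: field_simps power2_eq_square)
  also have "\<dots> \<le> h * \<epsilon> * I / 1"
  proof (rule divide_left_mono)
    have "1 * 1 \<le> pi * pi" using pi_gt3 by (intro mult_mono) auto
    then show "1 \<le> 2 * pi\<^sup>2" by (simp add: power2_eq_square)
  qed (use h e I0 in auto)
  finally show ?thesis by (simp add: I_def mult.assoc)
qed

lemma sum_uminus_symmetric:
  fixes f :: "int \<Rightarrow> 'a::comm_monoid_add"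
  shows "(\<Sum>n\<in>{-int M..int M}. f (- n)) = (\<Sum>n\<in>{-int M..int M}. f n)"
  by (rule sum.reindex_bij_witness[of _ uminus uminus]) auto

text \<open>Exchanging sum and integral, the sum of Gaussians is the inverse Fourier integral of \<open>G\<close> on the band with each wave
multiplied by \<open>Pinf \<omega> / K \<omega>\<close>, the grid sum of \<open>gwave\<close> divided by its main term. By \<open>gaussian_quadrature\<close> this ratio is
close to 1 uniformly in \<open>\<omega>\<close>.\<close>

lemma frame_expansion:
  assumes [measurable]: "G \<in> borel_measurable borel" and G2: "finite_energy G"
    and h: "h > 0" and e: "\<epsilon> > 0" and \<theta>: "0 \<le> \<theta>" "\<theta> \<le> 1" and eh: "4 * (\<epsilon> * h)\<^sup>2 \<le> pi\<^sup>2"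
    and W: "W = pi * \<theta> / h"
  obtains S where
    "(\<lambda>M. frame_sum h \<epsilon> W G M x) \<longlonglongrightarrow> S"
    "norm (S - lowpass W G x)
       \<le> 3 * exp (- (pi\<^sup>2 / (\<epsilon> * h)\<^sup>2 * (1 - \<theta>))) / (2 * pi) * (\<integral>\<omega>. indicator {-W..W} \<omega> * norm (G \<omega>) \<partial>lborel)"
proof -
  define a where "a = (\<epsilon> * h)\<^sup>2"
  have a: "a > 0" "4 * a \<le> pi\<^sup>2" using e h eh by (auto simp: a_def)
  define y where "y = x / h"
  define K where "K = (\<lambda>\<omega>. sqrt (pi / a) * exp (- (\<omega> * h)\<^sup>2 / (4 * a)))"
  have K0: "K \<omega> > 0" for \<omega> using a by (simp add: K_def)
  define g where "g = (\<lambda>\<omega>. indicator {-W..W} \<omega> * G \<omega> * cis (\<omega> * x) / (2 * pi))"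
  have [measurable]: "g \<in> borel_measurable borel" unfolding g_def by measurable
  have intG: "integrable lborel (\<lambda>\<omega>. indicator {-W..W} \<omega> * G \<omega>)"
    by (rule integrable_indicator_of_square[OF _ G2]) simp
  have ng: "norm (g \<omega>) = norm (indicator {-W..W} \<omega> * G \<omega>) / (2 * pi)" for \<omega>
    by (simp add: g_def norm_mult norm_divide)
  have intg: "integrable lborel g"
  proof (rule Bochner_Integration.integrable_bound)
    show "integrable lborel (\<lambda>\<omega>. indicator {-W..W} \<omega> * G \<omega> / (2 * pi))" using intG by simp
  qed (auto simp: ng norm_divide)
  define P where "P = (\<lambda>M \<omega>. \<Sum>n\<in>{-int M..int M}. gwave a (\<omega> * h) (y + of_int n))"
  define Pinf where "Pinf = (\<lambda>\<omega>. \<Sum>\<^sub>\<infinity>n. gwave a (\<omega> * h) (y + of_int n))"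
  have [measurable]: "P M \<in> borel_measurable borel" for M unfolding P_def gwave_def by measurable
  have Plim: "(\<lambda>M. P M \<omega>) \<longlonglongrightarrow> Pinf \<omega>" for \<omega>
    unfolding P_def Pinf_def by (rule has_sum_int_symmetric_limit[OF gwave_has_sum(1)[OF a(1)]])
  have [measurable]: "Pinf \<in> borel_measurable borel"
    by (rule borel_measurable_LIMSEQ_metric[OF _ Plim]) simp
  have [measurable]: "K \<in> borel_measurable borel" unfolding K_def by measurable
  define B where "B = (\<Sum>\<^sub>\<infinity>n::int. exp (- (a * (y + of_int n)\<^sup>2)))"
  have PB: "norm (P M \<omega>) \<le> B" for M \<omega>
  proof -
    have "norm (P M \<omega>) \<le> (\<Sum>n\<in>{-int M..int M}. exp (- (a * (y + of_int n)\<^sup>2)))"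
      unfolding P_def by (rule sum_norm_le) simp
    also have "\<dots> \<le> B" unfolding B_def
      by (rule finite_sum_le_infsum[OF gwave_has_sum(2)[OF a(1)]]) auto
    finally show ?thesis .
  qed
  have B0: "B \<ge> 0" using order_trans[OF norm_ge_zero PB] .
  have KW: "g \<omega> \<noteq> 0 \<Longrightarrow> 1 / K \<omega> \<le> 1 / K W" for \<omega>
  proof -
    assume "g \<omega> \<noteq> 0"
    then have "\<bar>\<omega>\<bar> \<le> W" by (auto simp: g_def indicator_def split: if_splits)
    then have "\<omega>\<^sup>2 \<le> W\<^sup>2" by (metis abs_ge_self abs_le_square_iff order_trans)
    then have "(\<omega> * h)\<^sup>2 / (4 * a) \<le> (W * h)\<^sup>2 / (4 * a)"
      using a by (intro divide_right_mono) (auto simp: power_mult_distrib intro!: mult_right_mono)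
    then have "K W \<le> K \<omega>" unfolding K_def using a by (intro mult_left_mono) auto
    then show "1 / K \<omega> \<le> 1 / K W" using K0 by (intro divide_left_mono) auto
  qed
  have dom: "norm (g \<omega> * (of_real (1 / K \<omega>) * p)) \<le> norm (g \<omega>) * (1 / K W * b)" if "norm p \<le> b" for \<omega> p b
  proof (cases "g \<omega> = 0")
    case False
    have "norm (complex_of_real (1 / K \<omega>) * p) \<le> 1 / K W * b"
      unfolding norm_mult norm_of_real using KW[OF False] that K0[of \<omega>] K0[of W]
      by (intro mult_mono) (auto simp: abs_of_pos)
    then show ?thesis unfolding norm_mult[of "g \<omega>"] by (intro mult_left_mono) auto
  qed simp
  have domint: "integrable lborel (\<lambda>\<omega>. norm (g \<omega>) * (1 / K W * B))"
    using intg by (intro integrable_mult_left integrable_norm)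
  have intP: "integrable lborel (\<lambda>\<omega>. g \<omega> * (of_real (1 / K \<omega>) * P M \<omega>))" for M
    by (rule integrable_norm_le[OF domint _ dom[OF PB]]) measurable
  have PinfB: "norm (Pinf \<omega>) \<le> B" for \<omega>
    by (rule LIMSEQ_le_const2[OF tendsto_norm[OF Plim]]) (use PB in blast)
  have intPinf: "integrable lborel (\<lambda>\<omega>. g \<omega> * (of_real (1 / K \<omega>) * Pinf \<omega>))"
    by (rule integrable_norm_le[OF domint _ dom[OF PinfB]]) measurable
  define S where "S = (\<integral>\<omega>. g \<omega> * (of_real (1 / K \<omega>) * Pinf \<omega>) \<partial>lborel)"
  have lim: "(\<lambda>M. \<integral>\<omega>. g \<omega> * (of_real (1 / K \<omega>) * P M \<omega>) \<partial>lborel) \<longlonglongrightarrow> S"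
    unfolding S_def
  proof (rule integral_dominated_convergence[OF _ _ domint])
    show "AE \<omega> in lborel. (\<lambda>M. g \<omega> * (of_real (1 / K \<omega>) * P M \<omega>)) \<longlonglongrightarrow> g \<omega> * (of_real (1 / K \<omega>) * Pinf \<omega>)"
      by (intro AE_I2 tendsto_mult tendsto_const Plim)
    show "AE \<omega> in lborel. norm (g \<omega> * (of_real (1 / K \<omega>) * P M \<omega>)) \<le> norm (g \<omega>) * (1 / K W * B)" for M
      by (intro AE_I2 dom PB)
  qed measurable
  have synth: "frame_sum h \<epsilon> W G M x
        = (\<integral>\<omega>. g \<omega> * (of_real (1 / K \<omega>) * P M \<omega>) \<partial>lborel)" for M
  proof -
    have pt: "g \<omega> * (of_real (1 / K \<omega>) * gwave a (\<omega> * h) (y - of_int n))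
        = of_real (h * \<epsilon> / (2 * pi * sqrt pi) * gauss_rbf (\<epsilon> * (x - of_int n * h)))
          * (indicator {-W..W} \<omega> * G \<omega> * of_real (exp (\<omega>\<^sup>2 / (4 * \<epsilon>\<^sup>2))) * cis (- (- (of_int n * h) * \<omega>)))" for \<omega> n
    proof -
      have "a * (y - of_int n)\<^sup>2 = (\<epsilon> * (x - of_int n * h))\<^sup>2"
      proof -
        have "x - of_int n * h = h * (y - of_int n)" using h by (simp add: y_def right_diff_distrib)
        then show ?thesis by (simp add: a_def power_mult_distrib)
      qed
      then have e1: "exp (- (a * (y - of_int n)\<^sup>2)) = gauss_rbf (\<epsilon> * (x - of_int n * h))"
        by (simp add: gauss_rbf_def)
      have e2: "cis (\<omega> * x) * cis (- (\<omega> * h * (y - of_int n))) = cis (- (- (of_int n * h) * \<omega>))"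
        using h by (simp add: cis_mult y_def right_diff_distrib mult_ac)
      have e3: "1 / K \<omega> = \<epsilon> * h / sqrt pi * exp (\<omega>\<^sup>2 / (4 * \<epsilon>\<^sup>2))"
      proof -
        have "(\<omega> * h)\<^sup>2 / (4 * a) = \<omega>\<^sup>2 / (4 * \<epsilon>\<^sup>2)" using h by (simp add: a_def power_mult_distrib)
        moreover have "sqrt (pi / a) = sqrt pi / (\<epsilon> * h)" using e h by (simp add: a_def real_sqrt_divide)
        ultimately show ?thesis by (simp add: K_def exp_minus field_simps)
      qed
      have "g \<omega> * (of_real (1 / K \<omega>) * gwave a (\<omega> * h) (y - of_int n))
          = of_real (1 / K \<omega> * exp (- (a * (y - of_int n)\<^sup>2)) / (2 * pi)) * (indicator {-W..W} \<omega> * G \<omega>)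
            * (cis (\<omega> * x) * cis (- (\<omega> * h * (y - of_int n))))"
        by (simp add: g_def gwave_def mult_ac)
      then show ?thesis unfolding e1 e2 e3 by (simp add: mult_ac)
    qed
    have sq: "complex_of_real (h * sqrt \<epsilon> / (2 * pi * sqrt pi)) * A * of_real (sqrt \<epsilon> * c)
        = of_real (h * \<epsilon> / (2 * pi * sqrt pi) * c) * A" for A c
    proof -
      have "h * sqrt \<epsilon> / (2 * pi * sqrt pi) * (sqrt \<epsilon> * c) = h * (sqrt \<epsilon> * sqrt \<epsilon>) / (2 * pi * sqrt pi) * c"
        by simp
      also have "sqrt \<epsilon> * sqrt \<epsilon> = \<epsilon>" using e by simp
      finally have "complex_of_real (h * sqrt \<epsilon> / (2 * pi * sqrt pi)) * of_real (sqrt \<epsilon> * c)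
        = of_real (h * \<epsilon> / (2 * pi * sqrt pi) * c)" by (simp only: of_real_mult[symmetric])
      then show ?thesis by (simp only: mult.assoc mult.left_commute mult.commute)
    qed
    have int_n: "integrable lborel (\<lambda>\<omega>. g \<omega> * (of_real (1 / K \<omega>) * gwave a (\<omega> * h) (y - of_int n)))" for n :: int
    proof (rule integrable_norm_le[OF _ _ dom])
      show "integrable lborel (\<lambda>\<omega>. norm (g \<omega>) * (1 / K W * 1))"
        using intg by (intro integrable_mult_left integrable_norm)
      show "norm (gwave a (\<omega> * h) (y - of_int n)) \<le> 1" for \<omega> using a by simp
    qed (simp add: gwave_def)
    have "frame_sum h \<epsilon> W G M x
       = (\<Sum>n\<in>{-int M..int M}. \<integral>\<omega>. g \<omega> * (of_real (1 / K \<omega>) * gwave a (\<omega> * h) (y - of_int n)) \<partial>lborel)"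
    proof (intro sum.cong refl)
      fix n
      show "frame_coeff h \<epsilon> W G n * of_real (sqrt \<epsilon> * gauss_rbf (\<epsilon> * (x - of_int n * h)))
            = (\<integral>\<omega>. g \<omega> * (of_real (1 / K \<omega>) * gwave a (\<omega> * h) (y - of_int n)) \<partial>lborel)"
        unfolding pt integral_mult_right_zero frame_coeff_def ft_def[symmetric] by (rule sq)
    qed
    also have "\<dots> = (\<integral>\<omega>. (\<Sum>n\<in>{-int M..int M}. g \<omega> * (of_real (1 / K \<omega>) * gwave a (\<omega> * h) (y - of_int n))) \<partial>lborel)"
      by (rule Bochner_Integration.integral_sum[OF int_n, symmetric])
    also have "\<dots> = (\<integral>\<omega>. g \<omega> * (of_real (1 / K \<omega>) * P M \<omega>) \<partial>lborel)"
    proof -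
      have "(\<Sum>n\<in>{-int M..int M}. gwave a (\<omega> * h) (y - of_int n)) = P M \<omega>" for \<omega>
        unfolding P_def using sum_uminus_symmetric[of "\<lambda>n. gwave a (\<omega> * h) (y + of_int n)" M] by simp
      then show ?thesis by (simp only: sum_distrib_left[symmetric])
    qed
    finally show ?thesis .
  qed
  have lp: "lowpass W G x = (\<integral>\<omega>. g \<omega> \<partial>lborel)"
    unfolding lowpass_def g_def by simp
  let ?q = "3 * exp (- (pi\<^sup>2 / (\<epsilon> * h)\<^sup>2 * (1 - \<theta>)))"
  have "norm (S - lowpass W G x) = norm (\<integral>\<omega>. g \<omega> * (of_real (1 / K \<omega>) * Pinf \<omega> - 1) \<partial>lborel)"
    unfolding S_def lp using intPinf intg by (subst Bochner_Integration.integral_diff[symmetric]) (auto simp: algebra_simps)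
  also have "\<dots> \<le> (\<integral>\<omega>. norm (g \<omega> * (of_real (1 / K \<omega>) * Pinf \<omega> - 1)) \<partial>lborel)"
    by (rule integral_norm_bound)
  also have "\<dots> \<le> (\<integral>\<omega>. norm (g \<omega>) * ?q \<partial>lborel)"
  proof (rule integral_mono)
    have "integrable lborel (\<lambda>\<omega>. g \<omega> * (of_real (1 / K \<omega>) * Pinf \<omega>) - g \<omega>)" using intPinf intg by auto
    then show "integrable lborel (\<lambda>\<omega>. norm (g \<omega> * (of_real (1 / K \<omega>) * Pinf \<omega> - 1)))"
      by (intro integrable_norm) (simp add: right_diff_distrib)
    show "integrable lborel (\<lambda>\<omega>. norm (g \<omega>) * ?q)" using intg by (intro integrable_mult_left integrable_norm)
    fix \<omega>
    show "norm (g \<omega> * (of_real (1 / K \<omega>) * Pinf \<omega> - 1)) \<le> norm (g \<omega>) * ?q"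
    proof (cases "g \<omega> = 0")
      case False
      then have "\<bar>\<omega>\<bar> \<le> W" by (auto simp: g_def indicator_def split: if_splits)
      then have "\<bar>\<omega> * h\<bar> \<le> pi * \<theta>" using h unfolding W by (simp add: abs_mult field_simps)
      from gaussian_quadrature[OF a this \<theta>, of y]
      have "norm (Pinf \<omega> - of_real (K \<omega>)) \<le> K \<omega> * ?q" by (simp add: Pinf_def K_def a_def)
      then have "norm (of_real (1 / K \<omega>) * (Pinf \<omega> - of_real (K \<omega>))) \<le> ?q"
        using K0[of \<omega>] by (simp add: norm_mult norm_divide field_simps)
      moreover have "of_real (1 / K \<omega>) * (Pinf \<omega> - of_real (K \<omega>)) = of_real (1 / K \<omega>) * Pinf \<omega> - 1"
        using K0[of \<omega>] by (simp add: right_diff_distrib)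
      ultimately have "norm (of_real (1 / K \<omega>) * Pinf \<omega> - 1) \<le> ?q" by simp
      then show ?thesis unfolding norm_mult[of "g \<omega>"] by (intro mult_left_mono) auto
    qed simp
  qed
  also have "\<dots> = ?q / (2 * pi) * (\<integral>\<omega>. indicator {-W..W} \<omega> * norm (G \<omega>) \<partial>lborel)"
  proof -
    have "(\<lambda>\<omega>. norm (g \<omega>) * ?q) = (\<lambda>\<omega>. ?q / (2 * pi) * (indicator {-W..W} \<omega> * norm (G \<omega>)))"
      by (auto simp: ng norm_mult indicator_def)
    then show ?thesis by (simp only: integral_mult_right_zero)
  qed
  finally show ?thesis using that[of S] lim unfolding synth by blast
qed

text \<open>The series over all of \<open>\<int>\<close> is cut to \<open>|n| \<le> N\<close>: the Cauchy-Schwarz inequality separates the coefficients from the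
Gaussians centred beyond \<open>T\<close>, which \<open>gaussian_tail_sum\<close> controls.\<close>

lemma frame_approximation:
  fixes x h \<epsilon> T B \<theta> :: real and N :: nat
  assumes G[measurable]: "G \<in> borel_measurable borel" and G2: "finite_energy G"
    and h: "h > 0" and e: "\<epsilon> > 0" and \<theta>: "0 \<le> \<theta>" "\<theta> < 1" and eh: "4 * (\<epsilon> * h)\<^sup>2 \<le> pi\<^sup>2"
    and W: "W = pi * \<theta> / h" and T: "real N * h = T" and x: "\<bar>x\<bar> \<le> B" and B: "B \<le> T"
    and Z: "\<And>F. finite F \<Longrightarrow> (\<Sum>n\<in>F. (norm (frame_coeff h \<epsilon> W G n))\<^sup>2) \<le> Z\<^sup>2" "Z \<ge> 0"
  shows "norm (lowpass W G x - frame_sum h \<epsilon> W G N x)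
     \<le> 3 * exp (- (pi\<^sup>2 / (\<epsilon> * h)\<^sup>2 * (1 - \<theta>))) / (2 * pi) * (\<integral>\<omega>. indicator {-W..W} \<omega> * norm (G \<omega>) \<partial>lborel)
       + Z * sqrt (pi / h * exp (- (2 * \<epsilon>\<^sup>2 * (T - B)\<^sup>2)))"
proof -
  define z where "z = frame_coeff h \<epsilon> W G"
  define \<gamma> where "\<gamma> = (\<lambda>n::int. sqrt \<epsilon> * gauss_rbf (\<epsilon> * (x - of_int n * h)))"
  define \<Sigma> where "\<Sigma> = (\<lambda>M. \<Sum>n\<in>{-int M..int M}. z n * of_real (\<gamma> n))"
  let ?a = "3 * exp (- (pi\<^sup>2 / (\<epsilon> * h)\<^sup>2 * (1 - \<theta>))) / (2 * pi) * (\<integral>\<omega>. indicator {-W..W} \<omega> * norm (G \<omega>) \<partial>lborel)"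
  let ?t = "sqrt (pi / h * exp (- (2 * \<epsilon>\<^sup>2 * (T - B)\<^sup>2)))"
  obtain S where S: "\<Sigma> \<longlonglongrightarrow> S" and Sb: "norm (S - lowpass W G x) \<le> ?a"
    using frame_expansion[OF G G2 h e \<theta>(1) less_imp_le[OF \<theta>(2)] eh W, of x] unfolding \<Sigma>_def z_def \<gamma>_def by blast
  have \<gamma>2: "(\<gamma> n)\<^sup>2 = \<epsilon> * exp (- (2 * \<epsilon>\<^sup>2 * (x - of_int n * h)\<^sup>2))" for n
    using e by (simp add: \<gamma>_def gauss_rbf_def power_mult_distrib flip: exp_of_nat_mult)
  have tail: "norm (\<Sigma> M - \<Sigma> N) \<le> Z * ?t" if M: "M \<ge> N" for M
  proof -
    obtain j where j: "M = N + j" using M le_iff_add by blast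
    let ?J = "{-int M..int M} - {-int N..int N}"
    have "\<Sigma> M - \<Sigma> N = (\<Sum>n\<in>?J. z n * of_real (\<gamma> n))"
      unfolding \<Sigma>_def using M by (subst sum_diff) auto
    also have "norm \<dots> \<le> (\<Sum>n\<in>?J. \<bar>norm (z n)\<bar> * \<bar>\<gamma> n\<bar>)"
      by (rule sum_norm_le) (simp add: norm_mult)
    also have "\<dots> \<le> L2_set (\<lambda>n. norm (z n)) ?J * L2_set \<gamma> ?J"
      by (rule L2_set_mult_ineq)
    also have "\<dots> \<le> Z * ?t"
    proof (rule mult_mono)
      show "L2_set (\<lambda>n. norm (z n)) ?J \<le> Z"
        unfolding L2_set_def z_def using Z(1)[of ?J] Z(2) by (simp add: real_le_lsqrt sum_nonneg)
      have "(\<Sum>n\<in>?J. (\<gamma> n)\<^sup>2) \<le> pi / h * exp (- (2 * \<epsilon>\<^sup>2 * (T - B)\<^sup>2))"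
        unfolding \<gamma>2 j by (rule gaussian_tail_sum[OF e h T x B])
      then show "L2_set \<gamma> ?J \<le> ?t" unfolding L2_set_def by (rule real_sqrt_le_mono)
    qed (use Z(2) in auto)
    finally show ?thesis .
  qed
  have "norm (lowpass W G x - \<Sigma> N) \<le> norm (S - lowpass W G x) + Z * ?t"
  proof (rule LIMSEQ_le_const)
    show "(\<lambda>M. norm (\<Sigma> M - lowpass W G x) + Z * ?t) \<longlonglongrightarrow> norm (S - lowpass W G x) + Z * ?t"
      by (intro tendsto_intros S)
    have "norm (lowpass W G x - \<Sigma> N) \<le> norm (\<Sigma> M - lowpass W G x) + Z * ?t" if "M \<ge> N" for M
    proof -
      have "lowpass W G x - \<Sigma> N = (\<Sigma> M - \<Sigma> N) - (\<Sigma> M - lowpass W G x)" by simp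
      then have "norm (lowpass W G x - \<Sigma> N) \<le> norm (\<Sigma> M - \<Sigma> N) + norm (\<Sigma> M - lowpass W G x)"
        by (metis norm_triangle_ineq4)
      then show ?thesis using tail[OF that] by linarith
    qed
    then show "\<exists>N0. \<forall>M\<ge>N0. norm (lowpass W G x - \<Sigma> N) \<le> norm (\<Sigma> M - lowpass W G x) + Z * ?t" by blast
  qed
  then have "norm (lowpass W G x - \<Sigma> N) \<le> ?a + Z * ?t" using Sb by linarith
  then show ?thesis unfolding \<Sigma>_def z_def \<gamma>_def .
qed

section \<open>Borel representatives and Sobolev norms\<close>

text \<open>Elements of \<open>L\<^sup>2\<close> are only Lebesgue measurable, while Fubini's theorem and the transform above want Borel functions.
Each function is therefore replaced by a Borel function that equals it almost everywhere.\<close>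

lemma AE_lborel_imp_lebesgue: "AE x in lborel. P x \<Longrightarrow> AE x in lebesgue. P x"
  by (rule AE_completion)

lemma borel_imp_lebesgue_measurable:
  fixes f :: "real \<Rightarrow> 'b::topological_space"
  assumes "f \<in> borel_measurable borel"
  shows "f \<in> borel_measurable lebesgue"
  by (rule measurable_completion) (use assms in simp)

lemma borel_version:
  fixes g :: "real \<Rightarrow> complex"
  assumes g[measurable]: "g \<in> borel_measurable lebesgue"
  obtains g' where "g' \<in> borel_measurable borel" "AE x in lebesgue. g x = g' x"
proof -
  have "(\<lambda>x. Re (g x)) \<in> borel_measurable lebesgue" "(\<lambda>x. Im (g x)) \<in> borel_measurable lebesgue"
    by measurable
  from this[THEN completion_ex_borel_measurable_real]
  obtain u v where [measurable]: "u \<in> borel_measurable lborel" "v \<in> borel_measurable lborel"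
    and uv: "AE x in lborel. Re (g x) = u x" "AE x in lborel. Im (g x) = v x" by blast
  have "AE x in lebesgue. g x = Complex (u x) (v x)"
    using AE_lborel_imp_lebesgue[OF uv(1)] AE_lborel_imp_lebesgue[OF uv(2)]
    by eventually_elim (simp add: complex_eq_iff)
  moreover have "(\<lambda>x. Complex (u x) (v x)) \<in> borel_measurable borel"
    by (subst borel_measurable_complex_iff) simp
  ultimately show ?thesis using that by blast
qed

lemma fourier_trunc_cong_AE:
  assumes g[measurable]: "g \<in> borel_measurable lebesgue" and g'[measurable]: "g' \<in> borel_measurable lebesgue"
    and ae: "AE x in lebesgue. g x = g' x"
  shows "fourier_trunc R g = fourier_trunc R g'"
proof
  fix \<omega>
  have [measurable]: "(\<lambda>x::real. exp (- \<i> * of_real (\<omega> * x))) \<in> borel_measurable lebesgue"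
    by (rule borel_imp_lebesgue_measurable) measurable
  have [measurable]: "(\<lambda>x::real. indicator {-R..R} x :: real) \<in> borel_measurable lebesgue"
    by (rule borel_imp_lebesgue_measurable) measurable
  have "(\<integral>x. indicator {-R..R} x *\<^sub>R (g x * exp (- \<i> * of_real (\<omega> * x))) \<partial>lebesgue)
      = (\<integral>x. indicator {-R..R} x *\<^sub>R (g' x * exp (- \<i> * of_real (\<omega> * x))) \<partial>lebesgue)"
  proof (rule integral_cong_AE)
    show "AE x in lebesgue. indicator {-R..R} x *\<^sub>R (g x * exp (- \<i> * of_real (\<omega> * x)))
        = indicator {-R..R} x *\<^sub>R (g' x * exp (- \<i> * of_real (\<omega> * x)))"
      using ae by eventually_elim simp
  qed measurable
  moreover have "fourier_trunc R p \<omega> = (\<integral>x. indicator {-R..R} x *\<^sub>R (p x * exp (- \<i> * of_real (\<omega> * x))) \<partial>lebesgue)" for p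
    unfolding fourier_trunc_def by (subst integral_restrict_space) auto
  ultimately show "fourier_trunc R g \<omega> = fourier_trunc R g' \<omega>" by (simp only:)
qed

lemma has_fourier_cong_AE:
  assumes FG: "has_fourier g G"
    and g'[measurable]: "g' \<in> borel_measurable borel" and G'[measurable]: "G' \<in> borel_measurable borel"
    and aeg: "AE x in lebesgue. g x = g' x" and aeG: "AE x in lebesgue. G x = G' x"
  shows "has_fourier g' G'"
proof -
  have [measurable]: "g' \<in> borel_measurable lebesgue" "G' \<in> borel_measurable lebesgue"
    by (rule borel_imp_lebesgue_measurable, fact)+
  have g: "g \<in> borel_measurable lebesgue" "integrable lebesgue (\<lambda>x. (norm (g x))\<^sup>2)"
    and G: "G \<in> borel_measurable lebesgue" "integrable lebesgue (\<lambda>x. (norm (G x))\<^sup>2)"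
    using FG unfolding has_fourier_def square_integrable_on_def lebesgue_on_UNIV_eq by blast+
  note [measurable] = g(1) G(1)
  have ig: "integrable lebesgue (\<lambda>x. (norm (g' x))\<^sup>2)"
  proof (rule integrable_cong_AE_imp[OF g(2)])
    show "AE x in lebesgue. (norm (g x))\<^sup>2 = (norm (g' x))\<^sup>2" using aeg by eventually_elim simp
  qed measurable
  have iG: "integrable lebesgue (\<lambda>x. (norm (G' x))\<^sup>2)"
  proof (rule integrable_cong_AE_imp[OF G(2)])
    show "AE x in lebesgue. (norm (G x))\<^sup>2 = (norm (G' x))\<^sup>2" using aeG by eventually_elim simp
  qed measurable
  have E: "(\<integral>\<^sup>+\<omega>. ennreal ((norm (fourier_trunc R g \<omega> - G \<omega>))\<^sup>2) \<partial>lebesgue)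
     = (\<integral>\<^sup>+\<omega>. ennreal ((norm (fourier_trunc R g' \<omega> - G' \<omega>))\<^sup>2) \<partial>lebesgue)" for R
  proof (rule nn_integral_cong_AE)
    have e: "fourier_trunc R g = fourier_trunc R g'" by (rule fourier_trunc_cong_AE[OF g(1) _ aeg]) measurable
    show "AE \<omega> in lebesgue. ennreal ((norm (fourier_trunc R g \<omega> - G \<omega>))\<^sup>2) = ennreal ((norm (fourier_trunc R g' \<omega> - G' \<omega>))\<^sup>2)"
      unfolding e using aeG by eventually_elim simp
  qed
  show ?thesis
    unfolding has_fourier_def square_integrable_on_def lebesgue_on_UNIV_eq
  proof (intro conjI ig iG)
    show "((\<lambda>R. \<integral>\<^sup>+\<omega>. ennreal ((norm (fourier_trunc R g' \<omega> - G' \<omega>))\<^sup>2) \<partial>lebesgue) \<longlongrightarrow> 0) at_top"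
      using FG unfolding has_fourier_def E by (elim conjE)
  qed fact+
qed

text \<open>The Sobolev norm on the line refers to a transform chosen by \<open>SOME\<close>, whereas membership in the Sobolev space
provides some transform with finite weighted energy. Uniqueness of the \<open>L\<^sup>2\<close> limit identifies the two.\<close>

lemma has_fourier_unique:
  assumes [measurable]: "g \<in> borel_measurable borel" "G \<in> borel_measurable borel" "H \<in> borel_measurable borel"
    and FG: "has_fourier g G" and FH: "has_fourier g H"
  shows "AE \<omega> in lborel. G \<omega> = H \<omega>"
proof -
  let ?p = "\<lambda>R. ft (\<lambda>x. indicator {-R..R} x * g x)"
  let ?e = "\<lambda>G R. \<integral>\<^sup>+\<omega>. ennreal ((norm (?p R \<omega> - G \<omega>))\<^sup>2) \<partial>lborel"
  have eG: "(?e G \<longlongrightarrow> 0) at_top" and eH: "(?e H \<longlongrightarrow> 0) at_top"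
    using FG FH by (simp_all add: has_fourier_def fourier_trunc_eq_ft nn_integral_completion)
  have le: "(\<integral>\<^sup>+\<omega>. ennreal ((norm (G \<omega> - H \<omega>))\<^sup>2) \<partial>lborel) \<le> 2 * ?e G R + 2 * ?e H R" for R
  proof -
    have "(\<integral>\<^sup>+\<omega>. ennreal ((norm (G \<omega> - H \<omega>))\<^sup>2) \<partial>lborel)
        \<le> (\<integral>\<^sup>+\<omega>. 2 * ennreal ((norm (?p R \<omega> - G \<omega>))\<^sup>2) + 2 * ennreal ((norm (?p R \<omega> - H \<omega>))\<^sup>2) \<partial>lborel)"
    proof (rule nn_integral_mono)
      fix \<omega>
      let ?a = "norm (?p R \<omega> - G \<omega>)" and ?b = "norm (?p R \<omega> - H \<omega>)"
      have "norm (G \<omega> - H \<omega>) \<le> ?a + ?b"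
        using norm_triangle_ineq4[of "?p R \<omega> - H \<omega>" "?p R \<omega> - G \<omega>"] by simp
      then have "(norm (G \<omega> - H \<omega>))\<^sup>2 \<le> (?a + ?b)\<^sup>2" by (rule power_mono) simp
      also have "\<dots> \<le> 2 * ?a\<^sup>2 + 2 * ?b\<^sup>2"
        using zero_le_power2[of "?a - ?b"] by (simp add: power2_sum power2_diff)
      finally have "ennreal ((norm (G \<omega> - H \<omega>))\<^sup>2) \<le> ennreal (2 * ?a\<^sup>2 + 2 * ?b\<^sup>2)" by (rule ennreal_leI)
      then show "ennreal ((norm (G \<omega> - H \<omega>))\<^sup>2) \<le> 2 * ennreal (?a\<^sup>2) + 2 * ennreal (?b\<^sup>2)"
        by (simp add: ennreal_plus ennreal_mult)
    qed
    also have "\<dots> = 2 * ?e G R + 2 * ?e H R"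
      by (subst nn_integral_add) (auto simp: nn_integral_cmult)
    finally show ?thesis .
  qed
  have "((\<lambda>R. (?e G R + ?e G R) + (?e H R + ?e H R)) \<longlongrightarrow> (0 + 0) + (0 + 0)) at_top"
    by (intro tendsto_add eG eH)
  then have "(\<integral>\<^sup>+\<omega>. ennreal ((norm (G \<omega> - H \<omega>))\<^sup>2) \<partial>lborel) \<le> (0 + 0) + (0 + 0)"
  proof (rule tendsto_lowerbound)
    show "\<forall>\<^sub>F R in at_top. (\<integral>\<^sup>+\<omega>. ennreal ((norm (G \<omega> - H \<omega>))\<^sup>2) \<partial>lborel) \<le> (?e G R + ?e G R) + (?e H R + ?e H R)"
      using le unfolding mult_2 by (intro always_eventually allI)
  qed (rule trivial_limit_at_top_linorder)
  then have "(\<integral>\<^sup>+\<omega>. ennreal ((norm (G \<omega> - H \<omega>))\<^sup>2) \<partial>lborel) = 0" by simp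
  then show ?thesis by (subst (asm) nn_integral_0_iff_AE) auto
qed

lemma sobolev_line_borel:
  assumes "g \<in> sobolev_line k"
  obtains g' G where "g' \<in> borel_measurable borel" "G \<in> borel_measurable borel"
    "AE x in lebesgue. g x = g' x" "has_fourier g' G"
    "finite_sobolev_energy k G"
    "sobolev_line_norm k g = sqrt (sobolev_energy k G)"
proof -
  obtain G1 where G1: "has_fourier g G1" "integrable lebesgue (\<lambda>\<omega>. (1 + \<bar>\<omega>\<bar>) ^ (2 * k) * (norm (G1 \<omega>))\<^sup>2)"
    using assms by (auto simp: sobolev_line_def)
  define G0 where "G0 = fourier g"
  have G0: "has_fourier g G0" unfolding G0_def fourier_def by (rule someI[of "has_fourier g", OF G1(1)])
  have m: "g \<in> borel_measurable lebesgue" "G0 \<in> borel_measurable lebesgue" "G1 \<in> borel_measurable lebesgue"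
    using G0 G1(1) unfolding has_fourier_def square_integrable_on_def lebesgue_on_UNIV_eq by blast+
  obtain g' where g': "g' \<in> borel_measurable borel" "AE x in lebesgue. g x = g' x"
    using borel_version[OF m(1)] by blast
  obtain H0 where H0: "H0 \<in> borel_measurable borel" "AE x in lebesgue. G0 x = H0 x"
    using borel_version[OF m(2)] by blast
  obtain H1 where H1: "H1 \<in> borel_measurable borel" "AE x in lebesgue. G1 x = H1 x"
    using borel_version[OF m(3)] by blast
  note [measurable] = g'(1) H0(1) H1(1)
  have F: "has_fourier g' H0" "has_fourier g' H1"
    using has_fourier_cong_AE[OF G0 g'(1) H0(1) g'(2) H0(2)] has_fourier_cong_AE[OF G1(1) g'(1) H1(1) g'(2) H1(2)] by auto
  have eq: "AE x in lborel. H0 x = H1 x"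
    by (rule has_fourier_unique[OF _ _ _ F]) auto
  let ?w = "\<lambda>G \<omega>. (1 + \<bar>\<omega>\<bar>) ^ (2 * k) * (norm (G \<omega>))\<^sup>2 :: real"
  have w1: "?w H1 \<in> borel_measurable borel" and w0: "?w H0 \<in> borel_measurable borel" by measurable
  have wm: "(\<lambda>\<omega>::real. (1 + \<bar>\<omega>\<bar>) ^ (2 * k)) \<in> borel_measurable lebesgue"
    by (rule borel_imp_lebesgue_measurable) measurable
  have "integrable lebesgue (?w H1)"
  proof (rule integrable_cong_AE_imp[OF G1(2) borel_imp_lebesgue_measurable[OF w1]])
    show "AE \<omega> in lebesgue. ?w G1 \<omega> = ?w H1 \<omega>" using H1(2) by eventually_elim simp
  qed
  then have i1: "integrable lborel (?w H1)"
    using w1 by (subst (asm) integrable_completion) auto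
  have "integral\<^sup>L lebesgue (?w G0) = integral\<^sup>L lebesgue (?w H0)"
  proof (rule integral_cong_AE)
    note [measurable] = m(2) wm
    show "?w G0 \<in> borel_measurable lebesgue" by measurable
    show "?w H0 \<in> borel_measurable lebesgue" by (rule borel_imp_lebesgue_measurable[OF w0])
    show "AE \<omega> in lebesgue. ?w G0 \<omega> = ?w H0 \<omega>" using H0(2) by eventually_elim simp
  qed
  also have "\<dots> = integral\<^sup>L lborel (?w H0)" by (rule integral_completion) (use w0 in simp)
  also have "\<dots> = integral\<^sup>L lborel (?w H1)"
  proof (rule integral_cong_AE)
    show "AE \<omega> in lborel. ?w H0 \<omega> = ?w H1 \<omega>" using eq by eventually_elim simp
  qed measurable
  finally have "sobolev_line_norm k g = sqrt (integral\<^sup>L lborel (?w H1))"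
    by (simp add: sobolev_line_norm_def G0_def)
  then show ?thesis using that[OF g'(1) H1(1) g'(2) F(2) i1] by blast
qed

lemma L2norm_on_eq_lborel:
  assumes S: "S \<in> sets borel" and f[measurable]: "f \<in> borel_measurable (lebesgue_on S)"
    and g[measurable]: "g \<in> borel_measurable borel" and ae: "AE x in lebesgue_on S. f x = g x"
  shows "L2norm_on S f = sqrt (\<integral>x. indicator S x * (norm (g x))\<^sup>2 \<partial>lborel)"
proof -
  have [measurable]: "g \<in> borel_measurable (lebesgue_on S)"
    by (rule measurable_restrict_space1[OF borel_imp_lebesgue_measurable[OF g]])
  have [measurable]: "S \<in> sets borel" by fact
  have "integral\<^sup>L (lebesgue_on S) (\<lambda>x. (norm (f x))\<^sup>2) = integral\<^sup>L (lebesgue_on S) (\<lambda>x. (norm (g x))\<^sup>2)"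
  proof (rule integral_cong_AE)
    show "AE x in lebesgue_on S. (norm (f x))\<^sup>2 = (norm (g x))\<^sup>2" using ae by eventually_elim simp
  qed measurable
  also have "\<dots> = (\<integral>x. indicator S x *\<^sub>R (norm (g x))\<^sup>2 \<partial>lebesgue)"
    by (subst integral_restrict_space) (use S in auto)
  also have "\<dots> = (\<integral>x. indicator S x *\<^sub>R (norm (g x))\<^sup>2 \<partial>lborel)"
    by (rule integral_completion) measurable
  finally show ?thesis unfolding L2norm_on_def by simp
qed

lemma approx_error_le:
  assumes "\<tau> \<ge> 0"
  shows "approx_error S T \<epsilon> N \<tau> f
    \<le> L2norm_on S (\<lambda>x. f x - synthesis T N \<epsilon> z x) + \<tau> * L2_set (\<lambda>n. norm (z n)) {- int N..int N}"
  unfolding approx_error_def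
proof (rule cINF_lower)
  have "0 \<le> L2norm_on S h" for h
    unfolding L2norm_on_def by (intro real_sqrt_ge_zero Bochner_Integration.integral_nonneg zero_le_power2)
  then have "0 \<le> L2norm_on S h + \<tau> * L2_set w {- int N..int N}" for h w
    using assms by (intro add_nonneg_nonneg mult_nonneg_nonneg L2_set_nonneg)
  then show "bdd_below (range (\<lambda>z. L2norm_on S (\<lambda>x. f x - synthesis T N \<epsilon> z x) + \<tau> * L2_set (\<lambda>n. norm (z n)) {- int N..int N}))"
    by (rule bdd_belowI2)
qed (rule UNIV_I)

text \<open>The Cauchy-Schwarz inequality against \<open>(1+|\<omega>|)\<^sup>-\<^sup>k\<close>, whose square is at most \<open>1/(1+\<omega>\<^sup>2)\<close> because \<open>k \<ge> 1\<close>. The bound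
does not depend on \<open>W\<close>, which is what allows the aliasing error to be estimated uniformly in \<open>x\<close>.\<close>

lemma integral_low_frequencies_le:
  fixes G :: "real \<Rightarrow> complex"
  assumes [measurable]: "G \<in> borel_measurable borel" and k: "k \<ge> 1" and W: "W \<ge> 0"
    and int: "finite_sobolev_energy k G"
  shows "(\<integral>\<omega>. indicator {-W..W} \<omega> * norm (G \<omega>) \<partial>lborel)
     \<le> sqrt pi * sqrt (sobolev_energy k G)"
proof -
  define u where "u = (\<lambda>\<omega>. of_real ((1 + \<bar>\<omega>\<bar>) ^ k) * G \<omega>)"
  define v where "v = (\<lambda>\<omega>. complex_of_real (indicator {-W..W} \<omega> / (1 + \<bar>\<omega>\<bar>) ^ k))"
  have [measurable]: "u \<in> borel_measurable borel" "v \<in> borel_measurable borel"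
    unfolding u_def v_def by measurable
  have u2: "(norm (u \<omega>))\<^sup>2 = (1 + \<bar>\<omega>\<bar>) ^ (2 * k) * (norm (G \<omega>))\<^sup>2" for \<omega>
    unfolding u_def norm_mult norm_of_real by (simp add: power_mult_distrib power_mult[symmetric] mult.commute)
  have at: "has_bochner_integral lborel (\<lambda>x. inverse (1 + x\<^sup>2) * indicator {-W..W} x) (arctan W - arctan (-W))"
  proof (rule has_bochner_integral_FTC_Icc_nonneg)
    show "DERIV arctan x :> inverse (1 + x\<^sup>2)" for x by (rule DERIV_arctan)
  qed (use W in simp_all)
  have vle: "(norm (v \<omega>))\<^sup>2 \<le> inverse (1 + \<omega>\<^sup>2) * indicator {-W..W} \<omega>" for \<omega>
  proof (cases "\<omega> \<in> {-W..W}")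
    case True
    have "1 + \<omega>\<^sup>2 \<le> (1 + \<bar>\<omega>\<bar>)\<^sup>2" by (simp add: power2_sum)
    also have "\<dots> \<le> (1 + \<bar>\<omega>\<bar>) ^ (2 * k)" using k by (intro power_increasing) auto
    finally have "inverse ((1 + \<bar>\<omega>\<bar>) ^ (2 * k)) \<le> inverse (1 + \<omega>\<^sup>2)"
      by (intro le_imp_inverse_le) (auto intro: add_pos_nonneg)
    moreover have "(norm (v \<omega>))\<^sup>2 = inverse ((1 + \<bar>\<omega>\<bar>) ^ (2 * k))"
      using True unfolding v_def norm_of_real
      by (simp add: power_divide power_mult[symmetric] mult.commute inverse_eq_divide)
    ultimately show ?thesis using True by simp
  qed (simp add: v_def)
  have iv: "finite_energy v"
  proof (rule Bochner_Integration.integrable_bound[OF integrable.intros[OF at]])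
    show "AE \<omega> in lborel. norm ((norm (v \<omega>))\<^sup>2) \<le> norm (inverse (1 + \<omega>\<^sup>2) * indicator {-W..W} \<omega>)"
      unfolding real_norm_def abs_power2 by (rule AE_I2, rule order_trans[OF vle abs_ge_self])
  qed measurable
  have "energy v \<le> arctan W - arctan (-W)"
    unfolding has_bochner_integral_integral_eq[OF at, symmetric]
    by (rule integral_mono[OF iv integrable.intros[OF at] vle])
  also have "\<dots> \<le> pi" using arctan_ubound[of W] by (simp add: arctan_minus)
  finally have v2: "sqrt (energy v) \<le> sqrt pi" by (rule real_sqrt_le_mono)
  have "norm (u \<omega>) * norm (v \<omega>) = indicator {-W..W} \<omega> * norm (G \<omega>)" for \<omega>
    unfolding u_def v_def norm_mult norm_of_real
    by (auto simp: indicator_def abs_of_nonneg)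
  then have "(\<integral>\<omega>. indicator {-W..W} \<omega> * norm (G \<omega>) \<partial>lborel) = (\<integral>\<omega>. norm (u \<omega>) * norm (v \<omega>) \<partial>lborel)" by simp
  also have "\<dots> \<le> sqrt (energy u) * sqrt (energy v)"
    by (rule Cauchy_Schwarz_integral) (use int iv in \<open>auto simp: u2\<close>)
  also have "\<dots> \<le> sqrt (energy u) * sqrt pi"
    using v2 by (intro mult_left_mono) auto
  finally show ?thesis by (simp add: u2 mult.commute)
qed

lemma integral_high_frequencies_le:
  fixes G :: "real \<Rightarrow> complex"
  assumes [measurable]: "G \<in> borel_measurable borel" and W: "W > 0"
    and int: "finite_sobolev_energy k G"
  shows "(\<integral>\<omega>. (if \<bar>\<omega>\<bar> \<le> W then 0 else (norm (G \<omega>))\<^sup>2) \<partial>lborel)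
     \<le> sobolev_energy k G / W ^ (2 * k)"
proof -
  have le: "(if \<bar>\<omega>\<bar> \<le> W then 0 else (norm (G \<omega>))\<^sup>2) \<le> ((1 + \<bar>\<omega>\<bar>) ^ (2 * k) * (norm (G \<omega>))\<^sup>2) / W ^ (2 * k)" for \<omega>
  proof (cases "\<bar>\<omega>\<bar> \<le> W")
    case False
    then have "W ^ (2 * k) \<le> (1 + \<bar>\<omega>\<bar>) ^ (2 * k)" using W by (intro power_mono) auto
    then have "W ^ (2 * k) * (norm (G \<omega>))\<^sup>2 \<le> (1 + \<bar>\<omega>\<bar>) ^ (2 * k) * (norm (G \<omega>))\<^sup>2"
      by (rule mult_right_mono) simp
    then show ?thesis using False W by (simp add: field_simps)
  qed (use W in auto)
  have i: "integrable lborel (\<lambda>\<omega>. ((1 + \<bar>\<omega>\<bar>) ^ (2 * k) * (norm (G \<omega>))\<^sup>2) / W ^ (2 * k))"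
    using int by simp
  have "(\<integral>\<omega>. (if \<bar>\<omega>\<bar> \<le> W then 0 else (norm (G \<omega>))\<^sup>2) \<partial>lborel)
     \<le> (\<integral>\<omega>. ((1 + \<bar>\<omega>\<bar>) ^ (2 * k) * (norm (G \<omega>))\<^sup>2) / W ^ (2 * k) \<partial>lborel)"
  proof (rule integral_mono[OF _ i le])
    show "integrable lborel (\<lambda>\<omega>. if \<bar>\<omega>\<bar> \<le> W then 0 else (norm (G \<omega>))\<^sup>2)"
    proof (rule integrable_norm_le[OF i _ order_trans[OF eq_refl le]])
      show "norm (if \<bar>\<omega>\<bar> \<le> W then 0 else (norm (G \<omega>))\<^sup>2) = (if \<bar>\<omega>\<bar> \<le> W then 0 else (norm (G \<omega>))\<^sup>2)" for \<omega>
        by simp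
    qed measurable
  qed
  then show ?thesis by simp
qed

section \<open>The error of the regularised approximation\<close>

lemma L2_local_le_weighted:
  fixes g G :: "real \<Rightarrow> complex"
  assumes [measurable]: "g \<in> borel_measurable borel" "G \<in> borel_measurable borel"
    and FG: "has_fourier g G" and B: "B > 0"
    and int: "finite_sobolev_energy k G"
  shows "energy G \<le> sobolev_energy k G"
    and "(\<integral>x. indicator {-B..B} x * (norm (g x))\<^sup>2 \<partial>lborel) \<le> sobolev_energy k G"
    and "integrable lborel (\<lambda>x. indicator {-B..B} x * (norm (g x))\<^sup>2)"
proof -
  have G2: "finite_energy G"
    using FG by (simp add: has_fourier_def square_integrable_on_UNIV_borel)
  have "(norm (G \<omega>))\<^sup>2 \<le> (1 + \<bar>\<omega>\<bar>) ^ (2 * k) * (norm (G \<omega>))\<^sup>2" for \<omega>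
    using mult_right_mono[of 1 "(1 + \<bar>\<omega>\<bar>) ^ (2 * k)" "(norm (G \<omega>))\<^sup>2"] by simp
  then show 1: "energy G \<le> sobolev_energy k G"
    by (rule integral_mono[OF G2 int])
  \<comment> \<open>with an empty band, \<open>lowpass_error\<close> compares \<open>g\<close> with 0\<close>
  have lp: "lowpass (-1) G x = 0" for x by (simp add: lowpass_def)
  have n: "\<not> \<bar>\<omega>\<bar> \<le> (-1::real)" for \<omega> by simp
  have "(\<integral>x. indicator {-B..B} x * (norm (g x))\<^sup>2 \<partial>lborel) \<le> energy G / (2 * pi)"
    using lowpass_error(1)[OF _ _ FG B, of "-1"] unfolding lp if_not_P[OF n] by simp
  also have "\<dots> \<le> energy G / 1"
    using pi_gt3 by (intro divide_left_mono) auto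
  finally show "(\<integral>x. indicator {-B..B} x * (norm (g x))\<^sup>2 \<partial>lborel) \<le> sobolev_energy k G"
    using 1 by simp
  show "integrable lborel (\<lambda>x. indicator {-B..B} x * (norm (g x))\<^sup>2)"
    using lowpass_error(2)[OF _ _ FG B, of "-1"] unfolding lp by simp
qed

lemma synthesis_measurable [measurable]: "synthesis T N \<epsilon> z \<in> borel_measurable borel"
  unfolding synthesis_def gauss_rbf_def by measurable

lemma approx_error_le_of_extension:
  fixes \<Omega> :: "real set" and f g :: "real \<Rightarrow> complex"
  assumes \<Omega>: "\<Omega> \<in> sets borel" "\<And>x. x \<in> \<Omega> \<Longrightarrow> \<bar>x\<bar> \<le> B" and \<tau>: "\<tau> \<ge> 0"
    and fm: "f \<in> borel_measurable (lebesgue_on \<Omega>)" and [measurable]: "g \<in> borel_measurable borel"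
    and fg: "AE x in lebesgue_on \<Omega>. f x = g x"
    and int: "integrable lborel (\<lambda>x. indicator {-B..B} x * (norm (g x - synthesis T N \<epsilon> z x))\<^sup>2)"
  shows "approx_error \<Omega> T \<epsilon> N \<tau> f
    \<le> sqrt (\<integral>x. indicator {-B..B} x * (norm (g x - synthesis T N \<epsilon> z x))\<^sup>2 \<partial>lborel)
      + \<tau> * L2_set (\<lambda>n. norm (z n)) {- int N..int N}"
proof -
  note [measurable] = \<Omega>(1) fm
  have [measurable]: "synthesis T N \<epsilon> z \<in> borel_measurable (lebesgue_on \<Omega>)"
    by (rule measurable_restrict_space1[OF borel_imp_lebesgue_measurable]) measurable
  have le: "indicator \<Omega> x * (norm (g x - synthesis T N \<epsilon> z x))\<^sup>2
      \<le> indicator {-B..B} x * (norm (g x - synthesis T N \<epsilon> z x))\<^sup>2" for x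
    using \<Omega>(2)[of x] by (auto simp: indicator_def abs_le_iff)
  have "L2norm_on \<Omega> (\<lambda>x. f x - synthesis T N \<epsilon> z x)
      = sqrt (\<integral>x. indicator \<Omega> x * (norm (g x - synthesis T N \<epsilon> z x))\<^sup>2 \<partial>lborel)"
  proof (rule L2norm_on_eq_lborel[OF \<Omega>(1)])
    show "AE x in lebesgue_on \<Omega>. f x - synthesis T N \<epsilon> z x = g x - synthesis T N \<epsilon> z x"
      using fg by eventually_elim simp
  qed measurable
  also have "\<dots> \<le> sqrt (\<integral>x. indicator {-B..B} x * (norm (g x - synthesis T N \<epsilon> z x))\<^sup>2 \<partial>lborel)"
  proof (rule real_sqrt_le_mono, rule integral_mono[OF _ int le])
    show "integrable lborel (\<lambda>x. indicator \<Omega> x * (norm (g x - synthesis T N \<epsilon> z x))\<^sup>2)"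
    proof (rule Bochner_Integration.integrable_bound[OF int])
      show "AE x in lborel. norm (indicator \<Omega> x * (norm (g x - synthesis T N \<epsilon> z x))\<^sup>2)
          \<le> norm (indicator {-B..B} x * (norm (g x - synthesis T N \<epsilon> z x))\<^sup>2)"
        using le by (intro AE_I2) (simp add: abs_mult)
    qed measurable
  qed
  finally show ?thesis using approx_error_le[OF \<tau>, of \<Omega> T \<epsilon> N f z] by linarith
qed

abbreviation error_factor :: "nat \<Rightarrow> real \<Rightarrow> real \<Rightarrow> nat \<Rightarrow> real \<Rightarrow> real" where
  "error_factor k T \<epsilon> N \<tau> \<equiv> (\<epsilon> * pi / T) powi (- int k)
     + (exp (- (pi\<^sup>2 * (real N)\<^sup>2 / (4 * \<epsilon>\<^sup>2 * T\<^sup>2))) + sqrt (\<epsilon> * T / real N) * \<tau>) * exp (pi\<^sup>2 / (4 * T\<^sup>2))"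

text \<open>The estimate for arbitrary \<open>\<epsilon>\<close>, in terms of an extension \<open>g\<close> with transform \<open>G\<close>. The constant is independent of
\<open>T\<close>, \<open>N\<close>, \<open>\<tau>\<close> and \<open>\<epsilon>\<close>; it depends on the domain through \<open>B\<close>, because an error that is bounded uniformly on
\<open>[-B, B]\<close> has \<open>L\<^sup>2\<close> norm at most \<open>\<surd>(2B)\<close> times that bound.\<close>

theorem gaussian_frame_error:
  fixes \<Omega> :: "real set" and f g G :: "real \<Rightarrow> complex" and N k :: nat
  assumes \<Omega>: "\<Omega> \<in> sets borel" "\<And>x. x \<in> \<Omega> \<Longrightarrow> \<bar>x\<bar> \<le> B"
    and B: "0 < B" "B < T" and N: "N \<ge> 1" and e: "\<epsilon> > 0" and \<tau>: "\<tau> > 0" and k: "k \<ge> 1"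
    and fm: "f \<in> borel_measurable (lebesgue_on \<Omega>)"
    and gm[measurable]: "g \<in> borel_measurable borel" and Gm[measurable]: "G \<in> borel_measurable borel"
    and fg: "AE x in lebesgue_on \<Omega>. f x = g x" and FG: "has_fourier g G"
    and int: "finite_sobolev_energy k G"
    and tail: "exp (- (2 * \<epsilon>\<^sup>2 * (T - B)\<^sup>2)) * (sqrt (2 * pi) * B * real N / T) \<le> \<tau>\<^sup>2"
  shows "approx_error \<Omega> T \<epsilon> N \<tau> f
    \<le> (5 + 2 * sqrt B) * error_factor k T \<epsilon> N \<tau> * sqrt (sobolev_energy k G)"
proof -
  define S where "S = sqrt (sobolev_energy k G)"
  define Y where "Y = pi\<^sup>2 * (real N)\<^sup>2 / (4 * \<epsilon>\<^sup>2 * T\<^sup>2)"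
  define X where "X = pi\<^sup>2 / (4 * T\<^sup>2)"
  define W where "W = \<epsilon> * pi / T"
  define h where "h = T / real N"
  define C where "C = 5 + 2 * sqrt B"
  have T: "T > 0" using B by linarith
  have h: "h > 0" using T N by (simp add: h_def)
  have Nh: "real N * h = T" using N by (simp add: h_def)
  have W: "W > 0" using e T by (simp add: W_def)
  have S0: "S \<ge> 0" unfolding S_def by (intro real_sqrt_ge_zero Bochner_Integration.integral_nonneg) simp
  have S2: "sobolev_energy k G = S\<^sup>2"
    unfolding S_def by (subst real_sqrt_pow2) (auto intro!: Bochner_Integration.integral_nonneg)
  have C5: "C \<ge> 5" using B by (simp add: C_def)
  have X0: "X \<ge> 0" by (simp add: X_def)
  note loc = L2_local_le_weighted[OF gm Gm FG B(1) int, unfolded S2]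
  have G2: "finite_energy G"
    using FG by (simp add: has_fourier_def square_integrable_on_UNIV_borel)
  let ?E = "inverse (W ^ k) + (exp (- Y) + sqrt (\<epsilon> * T / real N) * \<tau>) * exp X"
  have "approx_error \<Omega> T \<epsilon> N \<tau> f \<le> C * ?E * S"
  proof (cases "real N \<le> \<epsilon> \<or> pi\<^sup>2 < 4 * (\<epsilon> * h)\<^sup>2")
    case True
    have z0: "synthesis T N \<epsilon> (\<lambda>_. 0) x = 0" for x by (simp add: synthesis_def)
    have int0: "integrable lborel (\<lambda>x. indicator {-B..B} x * (norm (g x - synthesis T N \<epsilon> (\<lambda>_. 0) x))\<^sup>2)"
      unfolding z0 diff_zero by (rule loc(3))
    have "approx_error \<Omega> T \<epsilon> N \<tau> f
      \<le> sqrt (\<integral>x. indicator {-B..B} x * (norm (g x - synthesis T N \<epsilon> (\<lambda>_. 0) x))\<^sup>2 \<partial>lborel)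
        + \<tau> * L2_set (\<lambda>n. norm (0::complex)) {- int N..int N}"
      by (rule approx_error_le_of_extension[OF \<Omega> less_imp_le[OF \<tau>] fm gm fg int0])
    also have "\<dots> = sqrt (\<integral>x. indicator {-B..B} x * (norm (g x))\<^sup>2 \<partial>lborel)"
      unfolding z0 by (simp add: L2_set_def)
    also have "\<dots> \<le> sqrt (S\<^sup>2)" using loc(2) by (rule real_sqrt_le_mono)
    also have "\<dots> = S" using S0 by simp
    finally have triv: "approx_error \<Omega> T \<epsilon> N \<tau> f \<le> S" .
    \<comment> \<open>in this regime the right-hand side is at least \<open>S\<close>, and \<open>z = 0\<close> suffices\<close>
    have "1/4 \<le> exp (- Y) * exp X"
      using True
    proof
      assume Ne: "real N \<le> \<epsilon>"
      have "Y \<le> X"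
      proof -
        have "(real N)\<^sup>2 \<le> \<epsilon>\<^sup>2" using Ne by (intro power_mono) auto
        then have "pi\<^sup>2 * (real N)\<^sup>2 \<le> pi\<^sup>2 * \<epsilon>\<^sup>2" by (intro mult_left_mono) auto
        then have "Y \<le> pi\<^sup>2 * \<epsilon>\<^sup>2 / (4 * \<epsilon>\<^sup>2 * T\<^sup>2)" unfolding Y_def by (rule divide_right_mono) simp
        also have "\<dots> = X" using e by (simp add: X_def)
        finally show ?thesis .
      qed
      then have "1 \<le> exp (- Y + X)" by simp
      then show ?thesis unfolding exp_add by linarith
    next
      assume "pi\<^sup>2 < 4 * (\<epsilon> * h)\<^sup>2"
      then have "Y \<le> 1" using e T N unfolding Y_def h_def
        by (simp add: power_mult_distrib power_divide field_simps)
      then have "exp (- 1) \<le> exp (- Y)" by simp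
      moreover have "1/4 \<le> exp (- 1 :: real)" using exp_le by (simp add: exp_minus field_simps)
      ultimately have "1/4 \<le> exp (- Y)" by linarith
      moreover have "1 \<le> exp X" using X0 by simp
      ultimately have "1/4 * 1 \<le> exp (- Y) * exp X" by (rule mult_mono) auto
      then show ?thesis by simp
    qed
    moreover have "0 \<le> inverse (W ^ k)" using W by simp
    moreover have "0 \<le> sqrt (\<epsilon> * T / real N) * \<tau> * exp X" using e T \<tau> by (intro mult_nonneg_nonneg) auto
    ultimately have "1/4 \<le> ?E" unfolding distrib_right by linarith
    then have "5 * (1/4) \<le> C * ?E" using C5 by (intro mult_mono) auto
    then have "1 * S \<le> C * ?E * S" using S0 by (intro mult_right_mono) auto
    then show ?thesis using triv by simp
  next
    case False
    then have Ne: "\<epsilon> < real N" and eh: "4 * (\<epsilon> * h)\<^sup>2 \<le> pi\<^sup>2" by auto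
    define \<theta> where "\<theta> = \<epsilon> / real N"
    have \<theta>: "0 \<le> \<theta>" "\<theta> < 1" using e Ne by (auto simp: \<theta>_def)
    have W\<theta>: "W = pi * \<theta> / h" using N T by (simp add: W_def \<theta>_def h_def field_simps)
    have Wh: "W < pi / h" using \<theta> h by (simp add: W\<theta> divide_strict_right_mono)
    have X2: "W\<^sup>2 / (2 * \<epsilon>\<^sup>2) = 2 * X" using e T by (simp add: W_def X_def power_mult_distrib power_divide field_simps)
    define z where "z = frame_coeff h \<epsilon> W G"
    define Z where "Z = sqrt (\<epsilon> * T / real N) * exp X * S"
    have Z0: "Z \<ge> 0" using e T S0 by (simp add: Z_def)
    have Z2: "(\<Sum>n\<in>F. (norm (frame_coeff h \<epsilon> W G n))\<^sup>2) \<le> Z\<^sup>2" if "finite F" for F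
    proof -
      have "(\<Sum>n\<in>F. (norm (frame_coeff h \<epsilon> W G n))\<^sup>2) \<le> h * \<epsilon> * exp (2 * X) * energy G"
        using frame_coeff_square_sum[OF Gm G2 h e less_imp_le[OF W] Wh that] unfolding X2 .
      also have "\<dots> \<le> h * \<epsilon> * exp (2 * X) * S\<^sup>2" using loc(1) h e by (intro mult_left_mono) auto
      also have "\<dots> = Z\<^sup>2"
      proof -
        have "exp (2 * X) = (exp X)\<^sup>2" by (simp add: exp_double)
        moreover have "(sqrt (\<epsilon> * T / real N))\<^sup>2 = h * \<epsilon>" using e T by (simp add: h_def)
        ultimately show ?thesis by (simp add: Z_def power_mult_distrib)
      qed
      finally show ?thesis .
    qed
    define t where "t = sqrt (pi / h * exp (- (2 * \<epsilon>\<^sup>2 * (T - B)\<^sup>2)))"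
    have t0: "t \<ge> 0" using h by (simp add: t_def)
    define D where "D = exp (- Y) * exp X * S + Z * t"
    have D0: "D \<ge> 0" using S0 Z0 t0 by (simp add: D_def)
    have syn: "synthesis T N \<epsilon> z x = frame_sum h \<epsilon> W G N x" for x
      by (simp add: synthesis_def z_def h_def)
    have pt: "norm (lowpass W G x - synthesis T N \<epsilon> z x) \<le> D" if x: "\<bar>x\<bar> \<le> B" for x
    proof -
      let ?I = "\<integral>\<omega>. indicator {-W..W} \<omega> * norm (G \<omega>) \<partial>lborel"
      have I: "?I \<le> sqrt pi * S" unfolding S_def
        by (rule integral_low_frequencies_le[OF Gm k less_imp_le[OF W] int])
      have q: "exp (- (pi\<^sup>2 / (\<epsilon> * h)\<^sup>2 * (1 - \<theta>))) \<le> exp (- Y) * exp X"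
      proof -
        have Y4: "pi\<^sup>2 / (\<epsilon> * h)\<^sup>2 = 4 * Y" using e T N by (simp add: Y_def h_def power_mult_distrib power_divide field_simps)
        have YX: "Y * \<theta>\<^sup>2 = X" using e T N by (simp add: Y_def X_def \<theta>_def power_divide)
        \<comment> \<open>\<open>4(1 - \<theta>) \<ge> 1 - \<theta>\<^sup>2\<close>, multiplied by \<open>Y\<close>\<close>
        have "0 \<le> Y" by (simp add: Y_def)
        moreover have "0 \<le> (1 - \<theta>) * (3 - \<theta>)" using \<theta> by (intro mult_nonneg_nonneg) auto
        ultimately have "0 \<le> Y * ((1 - \<theta>) * (3 - \<theta>))" by (rule mult_nonneg_nonneg)
        also have "\<dots> = 4 * Y * (1 - \<theta>) - Y + Y * \<theta>\<^sup>2" by (simp add: algebra_simps power2_eq_square)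
        finally have "- (4 * Y * (1 - \<theta>)) \<le> - Y + X" unfolding YX by linarith
        then show ?thesis unfolding Y4 exp_add[symmetric] by simp
      qed
      have "norm (lowpass W G x - synthesis T N \<epsilon> z x)
          \<le> 3 * exp (- (pi\<^sup>2 / (\<epsilon> * h)\<^sup>2 * (1 - \<theta>))) / (2 * pi) * ?I + Z * t"
        unfolding syn t_def
        by (rule frame_approximation[OF Gm G2 h e \<theta> eh W\<theta> Nh x less_imp_le[OF B(2)] Z2 Z0])
      also have "3 * exp (- (pi\<^sup>2 / (\<epsilon> * h)\<^sup>2 * (1 - \<theta>))) / (2 * pi) * ?I
          \<le> 3 * (exp (- Y) * exp X) / (2 * pi) * (sqrt pi * S)"
        using q I S0 by (intro mult_mono divide_right_mono mult_left_mono) (auto intro!: Bochner_Integration.integral_nonneg)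
      also have "3 * (exp (- Y) * exp X) / (2 * pi) * (sqrt pi * S) = (3 * sqrt pi / (2 * pi)) * (exp (- Y) * exp X * S)"
        by simp
      also have "\<dots> \<le> 1 * (exp (- Y) * exp X * S)"
      proof (rule mult_right_mono)
        have "3 / 2 \<le> sqrt pi" using pi_gt3 by (intro real_le_rsqrt) (simp add: power2_eq_square)
        then have "3 / 2 * sqrt pi \<le> sqrt pi * sqrt pi" by (intro mult_right_mono) auto
        then show "3 * sqrt pi / (2 * pi) \<le> 1" by simp
      qed (use S0 in simp)
      finally show ?thesis by (simp add: D_def)
    qed
    let ?lp = "\<integral>x. indicator {-B..B} x * (norm (g x - lowpass W G x))\<^sup>2 \<partial>lborel"
    let ?L = "\<integral>x. indicator {-B..B} x * (norm (g x - synthesis T N \<epsilon> z x))\<^sup>2 \<partial>lborel"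
    have lpi: "integrable lborel (\<lambda>x. indicator {-B..B} x * (norm (g x - lowpass W G x))\<^sup>2)"
      by (rule lowpass_error(2)[OF gm Gm FG B(1)])
    have ii: "integrable lborel (\<lambda>x. indicator {-B..B} x * (2 * D\<^sup>2) :: real)"
      by (intro integrable_mult_left integrable_real_indicator) (auto simp: emeasure_lborel_Icc_eq)
    have di: "integrable lborel (\<lambda>x. 2 * (indicator {-B..B} x * (norm (g x - lowpass W G x))\<^sup>2) + indicator {-B..B} x * (2 * D\<^sup>2))"
      using lpi ii by (intro Bochner_Integration.integrable_add integrable_mult_right)
    have le: "indicator {-B..B} x * (norm (g x - synthesis T N \<epsilon> z x))\<^sup>2
        \<le> 2 * (indicator {-B..B} x * (norm (g x - lowpass W G x))\<^sup>2) + indicator {-B..B} x * (2 * D\<^sup>2)" for x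
    proof (cases "\<bar>x\<bar> \<le> B")
      case True
      have "norm (g x - synthesis T N \<epsilon> z x) \<le> norm (g x - lowpass W G x) + norm (lowpass W G x - synthesis T N \<epsilon> z x)"
        using norm_triangle_ineq[of "g x - lowpass W G x" "lowpass W G x - synthesis T N \<epsilon> z x"] by simp
      then have "norm (g x - synthesis T N \<epsilon> z x) \<le> norm (g x - lowpass W G x) + D" using pt[OF True] by linarith
      then have "(norm (g x - synthesis T N \<epsilon> z x))\<^sup>2 \<le> (norm (g x - lowpass W G x) + D)\<^sup>2" by (rule power_mono) simp
      also have "\<dots> \<le> 2 * (norm (g x - lowpass W G x))\<^sup>2 + 2 * D\<^sup>2"
        using zero_le_power2[of "norm (g x - lowpass W G x) - D"] by (simp add: power2_sum power2_diff)
      finally show ?thesis using True by (auto simp: indicator_def abs_le_iff)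
    next
      case False
      then show ?thesis by (auto simp: indicator_def abs_le_iff)
    qed
    have Li: "integrable lborel (\<lambda>x. indicator {-B..B} x * (norm (g x - synthesis T N \<epsilon> z x))\<^sup>2)"
    proof (rule integrable_norm_le[OF di _ order_trans[OF eq_refl le]])
      show "norm (indicator {-B..B} x * (norm (g x - synthesis T N \<epsilon> z x))\<^sup>2) = indicator {-B..B} x * (norm (g x - synthesis T N \<epsilon> z x))\<^sup>2" for x
        by simp
    qed measurable
    have "?L \<le> (\<integral>x. 2 * (indicator {-B..B} x * (norm (g x - lowpass W G x))\<^sup>2) + indicator {-B..B} x * (2 * D\<^sup>2) \<partial>lborel)"
      by (rule integral_mono[OF Li di le])
    also have "\<dots> = 2 * ?lp + 4 * B * D\<^sup>2"
      using B by (subst Bochner_Integration.integral_add[OF integrable_mult_right[OF lpi] ii]) simp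
    also have "\<dots> \<le> (S * inverse (W ^ k))\<^sup>2 + (2 * sqrt B * D)\<^sup>2"
    proof (rule add_mono)
      have "?lp \<le> (\<integral>\<omega>. (if \<bar>\<omega>\<bar> \<le> W then 0 else (norm (G \<omega>))\<^sup>2) \<partial>lborel) / (2 * pi)"
        by (rule lowpass_error(1)[OF gm Gm FG B(1)])
      also have "\<dots> \<le> S\<^sup>2 / W ^ (2 * k) / (2 * pi)"
        using integral_high_frequencies_le[OF Gm W int] unfolding S2 by (rule divide_right_mono) simp
      also have "\<dots> \<le> S\<^sup>2 / W ^ (2 * k) / 2"
        using pi_gt3 W by (intro divide_left_mono) auto
      finally have "2 * ?lp \<le> S\<^sup>2 / W ^ (2 * k)" by simp
      also have "\<dots> = (S * inverse (W ^ k))\<^sup>2"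
        by (simp add: power_mult_distrib divide_inverse power_mult[symmetric] mult.commute power_inverse[symmetric])
      finally show "2 * ?lp \<le> (S * inverse (W ^ k))\<^sup>2" .
      show "4 * B * D\<^sup>2 \<le> (2 * sqrt B * D)\<^sup>2" using B by (simp add: power_mult_distrib)
    qed
    finally have "sqrt ?L \<le> sqrt ((S * inverse (W ^ k))\<^sup>2 + (2 * sqrt B * D)\<^sup>2)" by (rule real_sqrt_le_mono)
    also have "\<dots> \<le> S * inverse (W ^ k) + 2 * sqrt B * D"
      using S0 W B D0 by (intro sqrt_sum_squares_le_sum) auto
    finally have L: "sqrt ?L \<le> S * inverse (W ^ k) + 2 * sqrt B * D" .
    \<comment> \<open>the discarded Gaussians cost no more than the penalty on the coefficients\<close>
    have Bt: "2 * sqrt B * t \<le> 4 * \<tau>"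
    proof -
      let ?e = "exp (- (2 * \<epsilon>\<^sup>2 * (T - B)\<^sup>2))"
      have "4 * B * (pi / h * ?e) = 4 * (sqrt (2 * pi) / 2) * (?e * (sqrt (2 * pi) * B * real N / T))"
      proof -
        have "4 * (r / 2) * (e * (r * B * real N / T)) = 4 * ((r * r) / 2) * (e * (B * real N / T))" for r e :: real
          by simp
        from this[of "sqrt (2 * pi)" ?e]
        have "4 * (sqrt (2 * pi) / 2) * (?e * (sqrt (2 * pi) * B * real N / T)) = 4 * (2 * pi / 2) * (?e * (B * real N / T))"
          by simp
        then show ?thesis using T by (simp add: h_def mult_ac)
      qed
      also have "\<dots> \<le> 4 * (sqrt (2 * pi) / 2) * \<tau>\<^sup>2" using tail by (intro mult_left_mono) auto
      also have "\<dots> \<le> 4 * (4 / 2) * \<tau>\<^sup>2"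
      proof -
        have "sqrt (2 * pi) \<le> 4" using pi_less_4 by (intro real_le_lsqrt) auto
        then show ?thesis by (intro mult_right_mono mult_left_mono divide_right_mono) auto
      qed
      also have "\<dots> \<le> (4 * \<tau>)\<^sup>2" by (simp add: power_mult_distrib)
      finally have "sqrt (4 * B * (pi / h * ?e)) \<le> sqrt ((4 * \<tau>)\<^sup>2)" by (rule real_sqrt_le_mono)
      moreover have "sqrt (4 * B * (pi / h * ?e)) = 2 * sqrt B * t"
        unfolding t_def real_sqrt_mult[of "4 * B"] real_sqrt_mult[of 4] by simp
      moreover have "sqrt ((4 * \<tau>)\<^sup>2) = 4 * \<tau>" unfolding real_sqrt_abs using \<tau> by simp
      ultimately show ?thesis by linarith
    qed
    have zZ: "L2_set (\<lambda>n. norm (z n)) {- int N..int N} \<le> Z"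
      unfolding L2_set_def z_def using Z2[of "{- int N..int N}"] Z0 by (simp add: real_le_lsqrt sum_nonneg)
    have "approx_error \<Omega> T \<epsilon> N \<tau> f \<le> sqrt ?L + \<tau> * L2_set (\<lambda>n. norm (z n)) {- int N..int N}"
      by (rule approx_error_le_of_extension[OF \<Omega> less_imp_le[OF \<tau>] fm gm fg Li])
    also have "\<dots> \<le> S * inverse (W ^ k) + 2 * sqrt B * D + \<tau> * Z"
      using L zZ \<tau> by (intro add_mono mult_left_mono) auto
    finally have 1: "approx_error \<Omega> T \<epsilon> N \<tau> f \<le> S * inverse (W ^ k) + 2 * sqrt B * D + \<tau> * Z" .
    have "(2 * sqrt B * t) * Z \<le> (4 * \<tau>) * Z" using Bt Z0 by (rule mult_right_mono)
    moreover have "2 * sqrt B * D = 2 * sqrt B * (exp (- Y) * exp X * S) + (2 * sqrt B * t) * Z"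
      by (simp add: D_def algebra_simps)
    moreover have "(4 * \<tau>) * Z + \<tau> * Z = 5 * (\<tau> * Z)" by simp
    ultimately have *: "approx_error \<Omega> T \<epsilon> N \<tau> f \<le> S * inverse (W ^ k) + 2 * sqrt B * (exp (- Y) * exp X * S) + 5 * (\<tau> * Z)"
      using 1 by linarith
    have "S * inverse (W ^ k) \<le> C * (S * inverse (W ^ k))"
      using mult_right_mono[of 1 C "S * inverse (W ^ k)"] C5 S0 W by simp
    moreover have "2 * sqrt B * (exp (- Y) * exp X * S) \<le> C * (exp (- Y) * exp X * S)"
      unfolding C_def using S0 by (intro mult_right_mono) auto
    moreover have "5 * (\<tau> * Z) \<le> C * (\<tau> * Z)" using C5 \<tau> Z0 by (intro mult_right_mono) auto
    ultimately have "approx_error \<Omega> T \<epsilon> N \<tau> f \<le> C * (S * inverse (W ^ k)) + C * (exp (- Y) * exp X * S) + C * (\<tau> * Z)"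
      using * by linarith
    also have "\<dots> = C * ?E * S" by (simp add: Z_def algebra_simps)
    finally show ?thesis .
  qed
  then show ?thesis
    unfolding C_def W_def Y_def X_def S_def by (simp only: power_int_minus power_int_of_nat)
qed

section \<open>The theorem\<close>

lemma tail_condition:
  assumes B: "0 < B" "B < T" and N: "N \<ge> 1" and \<tau>: "\<tau> > 0" and e: "\<epsilon> > 0"
    and ln0: "ln (sqrt (2 * pi) * B * real N / (T * \<tau>\<^sup>2)) \<ge> 0"
    and le: "\<epsilon> \<ge> 1 / (sqrt 2 * (T - B)) * sqrt (ln (sqrt (2 * pi) * B * real N / (T * \<tau>\<^sup>2)))"
  shows "exp (- (2 * \<epsilon>\<^sup>2 * (T - B)\<^sup>2)) * (sqrt (2 * pi) * B * real N / T) \<le> \<tau>\<^sup>2"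
proof -
  define A where "A = sqrt (2 * pi) * B * real N / (T * \<tau>\<^sup>2)"
  have A: "A > 0" unfolding A_def using B N \<tau> by (intro divide_pos_pos mult_pos_pos) auto
  have d: "sqrt 2 * (T - B) > 0" using B by simp
  have "sqrt (ln A) \<le> \<epsilon> * (sqrt 2 * (T - B))" using le d unfolding A_def[symmetric] by (simp add: field_simps)
  then have "(sqrt (ln A))\<^sup>2 \<le> (\<epsilon> * (sqrt 2 * (T - B)))\<^sup>2" using ln0 unfolding A_def[symmetric] by (intro power_mono) auto
  then have "ln A \<le> 2 * \<epsilon>\<^sup>2 * (T - B)\<^sup>2" using ln0 unfolding A_def[symmetric] by (simp add: power_mult_distrib mult_ac)
  then have "exp (ln A) \<le> exp (2 * \<epsilon>\<^sup>2 * (T - B)\<^sup>2)" by simp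
  then have "A \<le> exp (2 * \<epsilon>\<^sup>2 * (T - B)\<^sup>2)" using A by simp
  then have "exp (- (2 * \<epsilon>\<^sup>2 * (T - B)\<^sup>2)) * A \<le> 1" by (simp add: exp_minus field_simps)
  then have "exp (- (2 * \<epsilon>\<^sup>2 * (T - B)\<^sup>2)) * A * \<tau>\<^sup>2 \<le> 1 * \<tau>\<^sup>2" by (rule mult_right_mono) simp
  moreover have "A * \<tau>\<^sup>2 = sqrt (2 * pi) * B * real N / T" using \<tau> by (simp add: A_def)
  ultimately show ?thesis by (simp add: mult.assoc)
qed

lemma sobolev_norm_nonneg: "sobolev_norm k S f \<ge> 0"
  unfolding sobolev_norm_def by (intro real_sqrt_ge_zero sum_nonneg zero_le_power2)

lemma radius_of_positive_measure:
  assumes op: "open \<Omega>" and pos: "emeasure lebesgue \<Omega> > 0" and bdd: "bdd_above ((\<lambda>x. \<bar>x\<bar>) ` \<Omega>)"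
    and B: "B = (SUP x\<in>\<Omega>. \<bar>x::real\<bar>)"
  shows "B > 0" and "\<And>x. x \<in> \<Omega> \<Longrightarrow> \<bar>x\<bar> \<le> B"
proof -
  show le: "\<bar>x\<bar> \<le> B" if "x \<in> \<Omega>" for x unfolding B using that bdd by (rule cSUP_upper)
  show "B > 0"
  proof (rule ccontr)
    assume "\<not> B > 0"
    have "x = 0" if "x \<in> \<Omega>" for x using le[OF that] \<open>\<not> B > 0\<close> by linarith
    then have "\<Omega> = {} \<or> \<Omega> = {0}" by blast
    then have "\<Omega> = {}" using op not_open_singleton by metis
    then show False using pos by simp
  qed
qed

text \<open>The extension \<open>g\<close> transfers the previous estimate from the line to the domain, and the
bound for the extension enters the constant. Since \<open>B\<close> is
determined by \<open>\<Omega>\<close>, the constant depends on \<open>k\<close> and \<open>\<Omega>\<close> only.\<close>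

theorem approx_error_sobolev:
  fixes \<Omega> :: "real set" and k :: nat and B :: real
  assumes op: "open \<Omega>" and pos: "emeasure lebesgue \<Omega> > 0" and k: "k \<ge> 1"
    and ext: "sobolev_extension k \<Omega>" and B: "B = (SUP x\<in>\<Omega>. \<bar>x\<bar>)"
  obtains C where "C > 0"
    "\<And>T \<tau> \<epsilon> N f. f \<in> sobolev k \<Omega> \<Longrightarrow> T > 0 \<Longrightarrow> \<Omega> \<subseteq> {-T<..<T} \<Longrightarrow> B < T \<Longrightarrow> \<tau> > 0 \<Longrightarrow> \<epsilon> > 0 \<Longrightarrow> N \<ge> 1 \<Longrightarrow>
      ln (sqrt (2 * pi) * B * real N / (T * \<tau>\<^sup>2)) \<ge> 0 \<Longrightarrow>
      \<epsilon> \<ge> 1 / (sqrt 2 * (T - B)) * sqrt (ln (sqrt (2 * pi) * B * real N / (T * \<tau>\<^sup>2))) \<Longrightarrow>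
      approx_error \<Omega> T \<epsilon> N \<tau> f
      \<le> C * error_factor k T \<epsilon> N \<tau> * sobolev_norm k \<Omega> f"
proof -
  obtain Ce where Ce: "\<And>f. f \<in> sobolev k \<Omega> \<Longrightarrow> \<exists>g\<in>sobolev_line k.
        (AE x in lebesgue_on \<Omega>. g x = f x) \<and> sobolev_line_norm k g \<le> Ce * sobolev_norm k \<Omega> f"
    using ext unfolding sobolev_extension_def by blast
  define C0 where "C0 = 5 + 2 * sqrt \<bar>B\<bar>"
  have C0: "C0 > 0" unfolding C0_def by (intro add_pos_nonneg) auto
  define C where "C = C0 * max 1 Ce"
  have "C > 0" unfolding C_def using C0 by (intro mult_pos_pos) auto
  moreover have "approx_error \<Omega> T \<epsilon> N \<tau> f
      \<le> C * error_factor k T \<epsilon> N \<tau> * sobolev_norm k \<Omega> f"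
    if f: "f \<in> sobolev k \<Omega>" and T: "T > 0" "\<Omega> \<subseteq> {-T<..<T}" "B < T" and \<tau>: "\<tau> > 0" and e: "\<epsilon> > 0" and N: "N \<ge> 1"
      and ln0: "ln (sqrt (2 * pi) * B * real N / (T * \<tau>\<^sup>2)) \<ge> 0"
      and le: "\<epsilon> \<ge> 1 / (sqrt 2 * (T - B)) * sqrt (ln (sqrt (2 * pi) * B * real N / (T * \<tau>\<^sup>2)))"
    for T \<tau> \<epsilon> :: real and N :: nat and f
  proof -
    have "bdd_above ((\<lambda>x. \<bar>x\<bar>) ` \<Omega>)"
      using T(2) by (intro bdd_aboveI2[where M=T]) (auto simp: abs_le_iff)
    note R = radius_of_positive_measure[OF op pos this B]
    obtain g where g: "g \<in> sobolev_line k" "AE x in lebesgue_on \<Omega>. g x = f x"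
      and gn: "sobolev_line_norm k g \<le> Ce * sobolev_norm k \<Omega> f" using Ce[OF f] by blast
    obtain g' G where g': "g' \<in> borel_measurable borel" and G: "G \<in> borel_measurable borel"
      and gg: "AE x in lebesgue. g x = g' x" and FG: "has_fourier g' G"
      and int: "finite_sobolev_energy k G"
      and norm: "sobolev_line_norm k g = sqrt (sobolev_energy k G)"
      using sobolev_line_borel[OF g(1)] by blast
    have fm: "f \<in> borel_measurable (lebesgue_on \<Omega>)"
      using f unfolding sobolev_def square_integrable_on_def by blast
    have \<Omega>b: "\<Omega> \<in> sets borel" using op by simp
    have "AE x in lebesgue_on \<Omega>. g x = g' x"
      by (subst AE_restrict_space_iff) (use \<Omega>b gg in \<open>auto elim: eventually_mono\<close>)
    with g(2) have fg: "AE x in lebesgue_on \<Omega>. f x = g' x" by eventually_elim simp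
    let ?E = "error_factor k T \<epsilon> N \<tau>"
    have E0: "?E \<ge> 0" using e T \<tau> by (intro add_nonneg_nonneg mult_nonneg_nonneg zero_le_power_int) auto
    have B0: "\<bar>B\<bar> = B" using R(1) by simp
    have "approx_error \<Omega> T \<epsilon> N \<tau> f \<le> C0 * ?E * sobolev_line_norm k g"
      unfolding norm C0_def B0
      by (rule gaussian_frame_error[OF \<Omega>b R(2) R(1) T(3) N e \<tau> k fm g' G fg FG int
            tail_condition[OF R(1) T(3) N \<tau> e ln0 le]])
    also have "\<dots> \<le> C0 * ?E * (max 1 Ce * sobolev_norm k \<Omega> f)"
    proof (rule mult_left_mono)
      show "sobolev_line_norm k g \<le> max 1 Ce * sobolev_norm k \<Omega> f"
        using gn mult_right_mono[of Ce "max 1 Ce" "sobolev_norm k \<Omega> f"] sobolev_norm_nonneg[of k \<Omega> f] by linarith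
      show "0 \<le> C0 * ?E" using C0 E0 by (intro mult_nonneg_nonneg) auto
    qed
    also have "\<dots> = C * ?E * sobolev_norm k \<Omega> f" by (simp add: C_def)
    finally show ?thesis .
  qed
  ultimately show ?thesis by (rule that)
qed

text \<open>In the three bounds \<open>\<epsilon>\<close> is \<open>cN\<^sup>\<alpha>\<close> or \<open>cN\<close>. For \<open>\<epsilon> = cN\<close> the exponent of \<open>approx_error_sobolev\<close> no longer
depends on \<open>N\<close>: with \<open>y = \<pi>\<^sup>2/(2c\<^sup>2T\<^sup>2)\<close> it is \<open>-y/2\<close>, and \<open>e\<^bsup>-y/2\<^esup> \<le> 1/\<surd>(e\<^sup>y - 1)\<close>. The upper bound on \<open>c\<close> in
the last part says \<open>1/\<surd>(e\<^sup>y - 1) \<le> \<tau>\<close> and, as \<open>\<tau> < 1/2\<close>, also \<open>cT \<le> \<pi>\<close>. The two contributions to the last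
part add up to \<open>3\<tau>\<close>, and this is where the constant \<open>3C\<close> comes from.\<close>

theorem theorem8:
  fixes \<Omega> :: "real set" and k :: nat and B :: real
  assumes "open \<Omega>" and "emeasure lebesgue \<Omega> > 0"
    and "k \<ge> 1"
    and "sobolev_extension k \<Omega>"
    and B: "B = (SUP x\<in>\<Omega>. \<bar>x\<bar>)"
  shows "\<exists>C>0. \<forall>(T::real) (\<tau>::real) (c::real) (N::nat). \<forall>f\<in>sobolev k \<Omega>.
    T > 0 \<and> \<Omega> \<subseteq> {-T<..<T} \<and> B < T \<and> \<tau> > 0 \<and> c > 0 \<and> N \<ge> 1 \<longrightarrow>
    (\<forall>\<alpha>::real. 0 < \<alpha> \<and> \<alpha> < 1 \<and>
        real N powr (1 - \<alpha>) \<ge> sqrt (2 * ln 2) * T / pi \<and>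
        ln (sqrt (2 * pi) * B * real N / (T * \<tau>\<^sup>2)) \<ge> 0 \<and>
        c * real N powr \<alpha> \<ge>
          1 / (sqrt 2 * (T - B)) * sqrt (ln (sqrt (2 * pi) * B * real N / (T * \<tau>\<^sup>2))) \<longrightarrow>
        approx_error \<Omega> T (c * real N powr \<alpha>) N \<tau> f \<le>
          C * ((c * real N powr \<alpha> * pi / T) powi (- int k) +
               (exp (- (pi\<^sup>2 * real N powr (2 * (1 - \<alpha>)) / (4 * c\<^sup>2 * T\<^sup>2))) +
                sqrt (c * T) * \<tau> / real N powr ((1 - \<alpha>) / 2)) * exp (pi\<^sup>2 / (4 * T\<^sup>2)))
            * sobolev_norm k \<Omega> f) \<and>
    (ln (sqrt (2 * pi) * B * real N / (T * \<tau>\<^sup>2)) \<ge> 0 \<and>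
     c * real N \<ge>
       1 / (sqrt 2 * (T - B)) * sqrt (ln (sqrt (2 * pi) * B * real N / (T * \<tau>\<^sup>2))) \<longrightarrow>
        approx_error \<Omega> T (c * real N) N \<tau> f \<le>
          C * ((min c 1 * real N * pi / T) powi (- int k) +
               (1 / sqrt (exp (pi\<^sup>2 / (2 * c\<^sup>2 * T\<^sup>2)) - 1) + sqrt (c * T) * \<tau>)
                 * exp (pi\<^sup>2 / (4 * T\<^sup>2)))
            * sobolev_norm k \<Omega> f \<and>
        (\<tau> < 1 / 2 \<and> c \<le> min 1 (pi / (T * sqrt (2 * ln (1 + 1 / \<tau>\<^sup>2)))) \<longrightarrow>
          approx_error \<Omega> T (c * real N) N \<tau> f \<le>
            C * ((c * real N * pi / T) powi (- int k) + \<tau> * exp (pi\<^sup>2 / (4 * T\<^sup>2)))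
              * sobolev_norm k \<Omega> f))"
proof -
  obtain C where C: "C > 0" and main: "\<And>T \<tau> \<epsilon> N f. f \<in> sobolev k \<Omega> \<Longrightarrow> T > 0 \<Longrightarrow> \<Omega> \<subseteq> {-T<..<T} \<Longrightarrow> B < T \<Longrightarrow> \<tau> > 0 \<Longrightarrow> \<epsilon> > 0 \<Longrightarrow> N \<ge> 1 \<Longrightarrow>
      ln (sqrt (2 * pi) * B * real N / (T * \<tau>\<^sup>2)) \<ge> 0 \<Longrightarrow>
      \<epsilon> \<ge> 1 / (sqrt 2 * (T - B)) * sqrt (ln (sqrt (2 * pi) * B * real N / (T * \<tau>\<^sup>2))) \<Longrightarrow>
      approx_error \<Omega> T \<epsilon> N \<tau> f
      \<le> C * error_factor k T \<epsilon> N \<tau> * sobolev_norm k \<Omega> f"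
    using approx_error_sobolev[OF assms] by blast
  have weaken: "a \<le> (3 * C) * E' * s" if "a \<le> C * E * s" "E \<le> 3 * E'" "s \<ge> 0" for a E E' s :: real
  proof -
    have "C * E * s \<le> C * (3 * E') * s" using that C by (intro mult_right_mono mult_left_mono) auto
    then show ?thesis using that(1) by (simp add: mult_ac)
  qed
  have triple: "E \<le> 3 * F" if "0 \<le> E" "E \<le> F" for E F :: real
    using that by linarith
  show ?thesis
  proof (intro exI[of _ "3 * C"] conjI allI ballI impI)
    show "3 * C > 0" using C by simp
  next
    fix T \<tau> c :: real and N :: nat and f and \<alpha> :: real
    assume f: "f \<in> sobolev k \<Omega>" and h: "T > 0 \<and> \<Omega> \<subseteq> {-T<..<T} \<and> B < T \<and> \<tau> > 0 \<and> c > 0 \<and> N \<ge> 1"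
      and a: "0 < \<alpha> \<and> \<alpha> < 1 \<and>
        real N powr (1 - \<alpha>) \<ge> sqrt (2 * ln 2) * T / pi \<and>
        ln (sqrt (2 * pi) * B * real N / (T * \<tau>\<^sup>2)) \<ge> 0 \<and>
        c * real N powr \<alpha> \<ge>
          1 / (sqrt 2 * (T - B)) * sqrt (ln (sqrt (2 * pi) * B * real N / (T * \<tau>\<^sup>2)))"
    define \<epsilon> where "\<epsilon> = c * real N powr \<alpha>"
    have N: "real N > 0" and e: "\<epsilon> > 0" using h by (auto simp: \<epsilon>_def)
    have e1: "pi\<^sup>2 * (real N)\<^sup>2 / (4 * \<epsilon>\<^sup>2 * T\<^sup>2) = pi\<^sup>2 * real N powr (2 * (1 - \<alpha>)) / (4 * c\<^sup>2 * T\<^sup>2)"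
    proof -
      have "real N powr (2 * (1 - \<alpha>)) = (real N)\<^sup>2 / (real N powr \<alpha>)\<^sup>2"
      proof -
        have "real N powr (2 * (1 - \<alpha>)) = real N powr (2 - (\<alpha> + \<alpha>))" by (simp add: algebra_simps)
        also have "\<dots> = real N powr 2 / (real N powr \<alpha> * real N powr \<alpha>)" by (simp only: powr_diff powr_add)
        also have "real N powr 2 = (real N)\<^sup>2" using N by (simp add: powr_numeral)
        finally show ?thesis by (simp add: power2_eq_square)
      qed
      then show ?thesis by (simp add: \<epsilon>_def power_mult_distrib field_simps)
    qed
    have e2: "sqrt (\<epsilon> * T / real N) * \<tau> = sqrt (c * T) * \<tau> / real N powr ((1 - \<alpha>) / 2)"
    proof -
      have "real N powr ((1 - \<alpha>) / 2) = sqrt (real N powr (1 - \<alpha>))"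
        using N by (simp add: powr_half_sqrt[symmetric] powr_powr)
      moreover have "\<epsilon> * T / real N = c * T / real N powr (1 - \<alpha>)"
        using N by (simp add: \<epsilon>_def powr_diff)
      ultimately show ?thesis by (simp add: real_sqrt_divide)
    qed
    let ?E = "error_factor k T \<epsilon> N \<tau>"
    have "0 \<le> ?E"
      using e h by (intro add_nonneg_nonneg mult_nonneg_nonneg zero_le_power_int) auto
    then have "?E \<le> 3 * ?E" by (rule triple) (rule order_refl)
    moreover have "approx_error \<Omega> T \<epsilon> N \<tau> f \<le> C * ?E * sobolev_norm k \<Omega> f"
      by (rule main[OF f]) (use h a e in \<open>auto simp: \<epsilon>_def\<close>)
    ultimately have "approx_error \<Omega> T \<epsilon> N \<tau> f \<le> (3 * C) * ?E * sobolev_norm k \<Omega> f"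
      using weaken sobolev_norm_nonneg by blast
    then show "approx_error \<Omega> T (c * real N powr \<alpha>) N \<tau> f \<le>
          3 * C * ((c * real N powr \<alpha> * pi / T) powi (- int k) +
               (exp (- (pi\<^sup>2 * real N powr (2 * (1 - \<alpha>)) / (4 * c\<^sup>2 * T\<^sup>2))) +
                sqrt (c * T) * \<tau> / real N powr ((1 - \<alpha>) / 2)) * exp (pi\<^sup>2 / (4 * T\<^sup>2)))
            * sobolev_norm k \<Omega> f"
      unfolding e1 e2 unfolding \<epsilon>_def .
  next
    fix T \<tau> c :: real and N :: nat and f
    assume f: "f \<in> sobolev k \<Omega>" and h: "T > 0 \<and> \<Omega> \<subseteq> {-T<..<T} \<and> B < T \<and> \<tau> > 0 \<and> c > 0 \<and> N \<ge> 1"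
      and a: "ln (sqrt (2 * pi) * B * real N / (T * \<tau>\<^sup>2)) \<ge> 0 \<and>
     c * real N \<ge> 1 / (sqrt 2 * (T - B)) * sqrt (ln (sqrt (2 * pi) * B * real N / (T * \<tau>\<^sup>2)))"
    have N: "real N > 0" and c: "c > 0" and T: "T > 0" and \<tau>: "\<tau> > 0" using h by auto
    define y where "y = pi\<^sup>2 / (2 * c\<^sup>2 * T\<^sup>2)"
    define X where "X = exp (pi\<^sup>2 / (4 * T\<^sup>2))"
    define s where "s = sobolev_norm k \<Omega> f"
    have s0: "s \<ge> 0" by (simp add: s_def sobolev_norm_nonneg)
    have X0: "X > 0" by (simp add: X_def)
    have y0: "y > 0" using c T by (simp add: y_def)
    have e1: "pi\<^sup>2 * (real N)\<^sup>2 / (4 * (c * real N)\<^sup>2 * T\<^sup>2) = y / 2"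
      using N by (simp add: y_def power_mult_distrib)
    have e2: "c * real N * T / real N = c * T" using N by simp
    have base: "approx_error \<Omega> T (c * real N) N \<tau> f \<le> C * ((c * real N * pi / T) powi (- int k)
          + (exp (- (y / 2)) + sqrt (c * T) * \<tau>) * X) * s"
    proof -
      have "approx_error \<Omega> T (c * real N) N \<tau> f \<le> C * error_factor k T (c * real N) N \<tau> * sobolev_norm k \<Omega> f"
        by (rule main[OF f]) (use h a in auto)
      then show ?thesis unfolding e1 e2 s_def X_def .
    qed
    have P: "0 \<le> (c * real N * pi / T) powi (- int k)" using c T by (intro zero_le_power_int) auto
    have ey: "exp (- (y / 2)) \<le> 1 / sqrt (exp y - 1)"
    proof -
      have "sqrt (exp y - 1) \<le> sqrt (exp y)" by (rule real_sqrt_le_mono) simp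
      also have "\<dots> = exp (y / 2)" by (rule real_sqrt_unique) (simp_all flip: exp_double)
      finally have "1 / exp (y / 2) \<le> 1 / sqrt (exp y - 1)"
        using y0 by (intro divide_left_mono) auto
      then show ?thesis by (simp add: exp_minus inverse_eq_divide)
    qed
    have mono: "(c * real N * pi / T) powi (- int k) \<le> (min c 1 * real N * pi / T) powi (- int k)"
    proof -
      have "(min c 1 * real N * pi / T) ^ k \<le> (c * real N * pi / T) ^ k"
        using c T by (intro power_mono divide_right_mono mult_right_mono) auto
      moreover have "0 < (min c 1 * real N * pi / T) ^ k" using c T N by simp
      ultimately show ?thesis by (simp add: power_int_minus le_imp_inverse_le)
    qed
    have sq0: "0 \<le> sqrt (c * T) * \<tau> * X" using c T \<tau> X0 by simp
    have second: "approx_error \<Omega> T (c * real N) N \<tau> f \<le>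
          3 * C * ((min c 1 * real N * pi / T) powi (- int k) +
               (1 / sqrt (exp y - 1) + sqrt (c * T) * \<tau>) * X) * s"
    proof (rule weaken[OF base _ s0])
      let ?F = "(min c 1 * real N * pi / T) powi (- int k) + (1 / sqrt (exp y - 1) + sqrt (c * T) * \<tau>) * X"
      have le: "(c * real N * pi / T) powi (- int k) + (exp (- (y / 2)) + sqrt (c * T) * \<tau>) * X \<le> ?F"
        by (rule add_mono[OF mono mult_right_mono[OF add_right_mono[OF ey] less_imp_le[OF X0]]])
      have ge: "0 \<le> (c * real N * pi / T) powi (- int k) + (exp (- (y / 2)) + sqrt (c * T) * \<tau>) * X"
        using P c T \<tau> X0 by (intro add_nonneg_nonneg mult_nonneg_nonneg) auto
      show "(c * real N * pi / T) powi (- int k) + (exp (- (y / 2)) + sqrt (c * T) * \<tau>) * X \<le> 3 * ?F"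
        by (rule triple[OF ge le])
    qed
    then show "approx_error \<Omega> T (c * real N) N \<tau> f \<le>
          3 * C * ((min c 1 * real N * pi / T) powi (- int k) +
               (1 / sqrt (exp (pi\<^sup>2 / (2 * c\<^sup>2 * T\<^sup>2)) - 1) + sqrt (c * T) * \<tau>)
                 * exp (pi\<^sup>2 / (4 * T\<^sup>2)))
            * sobolev_norm k \<Omega> f" unfolding y_def X_def s_def .
    assume t: "\<tau> < 1 / 2 \<and> c \<le> min 1 (pi / (T * sqrt (2 * ln (1 + 1 / \<tau>\<^sup>2))))"
    define l where "l = ln (1 + 1 / \<tau>\<^sup>2)"
    have "\<tau>\<^sup>2 < (1/2)\<^sup>2" using t \<tau> by (intro power_strict_mono) auto
    then have "\<tau>\<^sup>2 \<le> 1/4" by (simp add: power2_eq_square)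
    then have t4: "4 \<le> 1 / \<tau>\<^sup>2" using \<tau> by (simp add: field_simps)
    have "exp 1 \<le> 1 + 1 / \<tau>\<^sup>2" using exp_le t4 by linarith
    then have l1: "l \<ge> 1" unfolding l_def using t4 by (subst ln_ge_iff) auto
    have cT: "c * T * sqrt (2 * l) \<le> pi"
      using t T l1 unfolding l_def[symmetric] by (simp add: field_simps)
    have "(c * T * sqrt (2 * l))\<^sup>2 \<le> pi\<^sup>2" using cT c T l1 by (intro power_mono) auto
    then have "l * (2 * c\<^sup>2 * T\<^sup>2) \<le> pi\<^sup>2" using l1 by (simp add: power_mult_distrib mult_ac)
    then have "l \<le> y" unfolding y_def using c T by (subst pos_le_divide_eq) auto
    then have "exp l \<le> exp y" by simp
    moreover have "exp l = 1 + 1 / \<tau>\<^sup>2" unfolding l_def using t4 by (intro exp_ln) linarith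
    ultimately have "1 / \<tau>\<^sup>2 \<le> exp y - 1" by linarith
    then have "sqrt (1 / \<tau>\<^sup>2) \<le> sqrt (exp y - 1)" by (rule real_sqrt_le_mono)
    then have "1 / \<tau> \<le> sqrt (exp y - 1)" using \<tau> by (simp add: real_sqrt_divide)
    then have "1 / sqrt (exp y - 1) \<le> 1 / (1 / \<tau>)" using \<tau> y0 by (intro divide_left_mono mult_pos_pos) auto
    then have ey': "exp (- (y / 2)) \<le> \<tau>" using ey by simp
    have "c * T \<le> 4"
    proof -
      have "c * T * 1 \<le> c * T * sqrt (2 * l)" using c T l1 by (intro mult_left_mono) auto
      then show ?thesis using cT pi_less_4 by linarith
    qed
    then have "sqrt (c * T) \<le> 2" by (intro real_le_lsqrt) auto
    then have "sqrt (c * T) * \<tau> \<le> 2 * \<tau>" using \<tau> by (intro mult_right_mono) auto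
    then have "(exp (- (y / 2)) + sqrt (c * T) * \<tau>) * X \<le> (3 * \<tau>) * X"
      using ey' by (intro mult_right_mono less_imp_le[OF X0]) linarith
    then have "(c * real N * pi / T) powi (- int k) + (exp (- (y / 2)) + sqrt (c * T) * \<tau>) * X
       \<le> 3 * ((c * real N * pi / T) powi (- int k) + \<tau> * X)" using P by (simp add: algebra_simps)
    from weaken[OF base this s0]
    show "approx_error \<Omega> T (c * real N) N \<tau> f \<le>
            3 * C * ((c * real N * pi / T) powi (- int k) + \<tau> * exp (pi\<^sup>2 / (4 * T\<^sup>2)))
              * sobolev_norm k \<Omega> f" unfolding X_def s_def .
  qed
qed

end
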